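(* Let $X=\overline{b_1(\mathcal{A}_d^* )}$ be the closed unit ball of $\mathcal{A}_d^*$ equipped with the weak-$*$ topology. Let $t\in\mathrm{C}(X)$ be strictly positive and concave and let \[ B_t=\{(c+\widehat{\phi})/t: c\in\mathbb{C},\ \phi\in\mathcal{A}_d\}\subset\mathrm{C}(X). \] Then, given $\Phi\in B_t^*$, there exists a measure $\mu$ on $X$ concentrated on the set $\operatorname{ext}X$ of extreme points of $X$ such that $\|\mu\|_{M(X)}=\|\Phi\|_{B_t^*}$ and \[ \Phi(b)=\int_{\operatorname{ext}X}b\,d\mu\quad\text{for all } b\in B_t . \]
   Context: Let $d\ge1$ be an integer and $\mathbb{B}_d$ the open unit ball of $\mathbb{C}^d$. The Drury-Arveson space $H^2_d$ is the reproducing kernel Hilbert space of analytic functions on $\mathbb{B}_d$ with kernel $k(w,z)=1/(1-\langle w,z\rangle)$. Its multiplier algebra $\mathcal{M}_d$ consists of all analytic $f$ on $\mathbb{B}_d$ with $fH^2_d\subset H^2_d$, identified with $M_f\in B(H^2_d)$ and normed by $\|f\|_{\mathcal{M}_d}=\|M_f\|$. $\mathcal{A}_d$ is the norm closure of the polynomials in $\mathcal{M}_d$ (a separable Banach space, so $X$ is compact metrizable). For $\phi\in\mathcal{A}_d$, $\widehat{\phi}$ is the canonical image of $\phi$ in $\mathcal{A}_d^{**}$, viewed as a function on $X$: $\widehat{\phi}(\xi)=\xi(\phi)$. A function $t\in\mathrm{C}(X)$ is concave if it is real valued and $t\big(\frac{x_1+x_2}{2}\big)\ge\frac{t(x_1)}{2}+\frac{t(x_2)}{2}$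 for all $x_1,x_2\in X$; strictly positive means $t(x)>0$ for every $x\in X$. $B_t$ carries the supremum norm of $\mathrm{C}(X)$. $M(X)$ is the space of finite regular complex Borel measures on $X$ with total variation norm. *)

theory Defs
  imports "HOL-Analysis.Analysis" "HOL-Library.Function_Algebras"
begin

text \<open>
  A function on a set \<open>S\<close> is represented throughout by a total function that vanishes off \<open>S\<close>,
  so that equality of functions on \<open>S\<close> is equality in HOL and the pointwise operations of
  \<^theory>\<open>HOL-Library.Function_Algebras\<close> apply.
\<close>

definition zero_ext :: "'a set \<Rightarrow> ('a \<Rightarrow> complex) \<Rightarrow> 'a \<Rightarrow> complex" where
  "zero_ext S f = (\<lambda>x. if x \<in> S then f x else 0)"

instantiation "fun" :: (type, real_vector) real_vector
begin

definition scaleR_fun :: "real \<Rightarrow> ('a \<Rightarrow> 'b) \<Rightarrow> 'a \<Rightarrow> 'b" where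
  "scaleR_fun r f = (\<lambda>x. r *\<^sub>R f x)"

instance
  by standard (simp_all add: scaleR_fun_def fun_eq_iff scaleR_add_right scaleR_add_left)

end


section \<open>Reproducing kernel Hilbert spaces\<close>

text \<open>The inner product \<open>ip\<close> is linear in its first argument.\<close>

locale function_hilbert_space =
  fixes S :: "'a set"
    and H :: "('a \<Rightarrow> complex) set"
    and ip :: "('a \<Rightarrow> complex) \<Rightarrow> ('a \<Rightarrow> complex) \<Rightarrow> complex"
  assumes supported: "\<And>f. f \<in> H \<Longrightarrow> zero_ext S f = f"
    and zero_mem: "0 \<in> H"
    and add_mem: "\<And>f g. f \<in> H \<Longrightarrow> g \<in> H \<Longrightarrow> f + g \<in> H"
    and scale_mem: "\<And>c f. f \<in> H \<Longrightarrow> (\<lambda>x. c * f x) \<in> H"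
    and ip_add: "\<And>f g h. f \<in> H \<Longrightarrow> g \<in> H \<Longrightarrow> h \<in> H \<Longrightarrow> ip (f + g) h = ip f h + ip g h"
    and ip_scale: "\<And>c f g. f \<in> H \<Longrightarrow> g \<in> H \<Longrightarrow> ip (\<lambda>x. c * f x) g = c * ip f g"
    and ip_commute: "\<And>f g. f \<in> H \<Longrightarrow> g \<in> H \<Longrightarrow> ip g f = cnj (ip f g)"
    and ip_nonneg: "\<And>f. f \<in> H \<Longrightarrow> 0 \<le> Re (ip f f)"
    and ip_definite: "\<And>f. f \<in> H \<Longrightarrow> ip f f = 0 \<Longrightarrow> f = 0"
    and complete:
      "\<And>F :: nat \<Rightarrow> 'a \<Rightarrow> complex.
         (\<forall>n. F n \<in> H) \<Longrightarrow>
         (\<forall>e>0. \<exists>N. \<forall>m\<ge>N. \<forall>n\<ge>N. sqrt (Re (ip (F m - F n) (F m - F n))) < e) \<Longrightarrow>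
         \<exists>f\<in>H. (\<lambda>n. sqrt (Re (ip (F n - f) (F n - f)))) \<longlonglongrightarrow> 0"

locale reproducing_kernel_hilbert_space = function_hilbert_space S H ip
  for S :: "'a set" and K :: "'a \<Rightarrow> 'a \<Rightarrow> complex" and H ip +
  assumes kernel_mem: "\<And>z. z \<in> S \<Longrightarrow> zero_ext S (\<lambda>w. K w z) \<in> H"
    and reproducing: "\<And>f z. f \<in> H \<Longrightarrow> z \<in> S \<Longrightarrow> ip f (zero_ext S (\<lambda>w. K w z)) = f z"

definition hilbert_norm ::
    "(('a \<Rightarrow> complex) \<Rightarrow> ('a \<Rightarrow> complex) \<Rightarrow> complex) \<Rightarrow> ('a \<Rightarrow> complex) \<Rightarrow> real" where
  "hilbert_norm ip f = sqrt (Re (ip f f))"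


section \<open>The Drury--Arveson space and its multipliers\<close>

text \<open>
  Analyticity in several complex variables is complex differentiability: the real derivative exists
  at every point and is complex linear. The norm of \<^typ>\<open>complex ^ 'd\<close> is the Euclidean one, so
  \<open>ball 0 1\<close> is the open unit ball of \<open>d\<close>-dimensional complex space.
\<close>

definition analytic_funs :: "(complex ^ 'd) set \<Rightarrow> (complex ^ 'd \<Rightarrow> complex) set" where
  "analytic_funs S = {f. zero_ext S f = f \<and>
     (\<forall>z\<in>S. \<exists>D. (f has_derivative D) (at z) \<and> (\<forall>c v. D (c *s v) = c * D v))}"

definition drury_arveson_kernel :: "complex ^ 'd \<Rightarrow> complex ^ 'd \<Rightarrow> complex" where
  "drury_arveson_kernel w z = 1 / (1 - (\<Sum>i\<in>UNIV. w $ i * cnj (z $ i)))"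

text \<open>A reproducing kernel Hilbert space is uniquely determined by its kernel.\<close>

locale drury_arveson_space =
  reproducing_kernel_hilbert_space "ball 0 1" drury_arveson_kernel H ip
  for H :: "(complex ^ 'd \<Rightarrow> complex) set" and ip +
  assumes analytic: "H \<subseteq> analytic_funs (ball 0 1)"

definition multipliers ::
    "(complex ^ 'd \<Rightarrow> complex) set \<Rightarrow> (complex ^ 'd \<Rightarrow> complex) set" where
  "multipliers H = {f \<in> analytic_funs (ball 0 1). \<forall>h\<in>H. f * h \<in> H}"

text \<open>
  The operator norm of \<open>M\<^sub>f\<close>; the supremum is finite for every multiplier by the closed graph
  theorem.
\<close>

definition multiplier_norm ::
    "(complex ^ 'd \<Rightarrow> complex) set \<Rightarrow>
     ((complex ^ 'd \<Rightarrow> complex) \<Rightarrow> (complex ^ 'd \<Rightarrow> complex) \<Rightarrow> complex) \<Rightarrow>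
     (complex ^ 'd \<Rightarrow> complex) \<Rightarrow> real" where
  "multiplier_norm H ip f = (SUP h \<in> {h \<in> H. hilbert_norm ip h \<le> 1}. hilbert_norm ip (f * h))"

definition ball_polynomials :: "(complex ^ 'd \<Rightarrow> complex) set" where
  "ball_polynomials =
     {zero_ext (ball 0 1) (\<lambda>z. \<Sum>\<alpha>\<in>F. a \<alpha> * (\<Prod>i\<in>UNIV. (z $ i) ^ \<alpha> i)) |
        (F :: ('d \<Rightarrow> nat) set) a. finite F}"

definition multiplier_poly_closure ::
    "(complex ^ 'd \<Rightarrow> complex) set \<Rightarrow>
     ((complex ^ 'd \<Rightarrow> complex) \<Rightarrow> (complex ^ 'd \<Rightarrow> complex) \<Rightarrow> complex) \<Rightarrow>
     (complex ^ 'd \<Rightarrow> complex) set" where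
  "multiplier_poly_closure H ip =
     {f \<in> multipliers H. \<forall>e>0. \<exists>p\<in>ball_polynomials. multiplier_norm H ip (f - p) < e}"


section \<open>Dual spaces\<close>

text \<open>Here \<open>V\<close> is a complex vector space of functions, normed by \<open>nrm\<close>.\<close>

definition dual_space ::
    "('a \<Rightarrow> complex) set \<Rightarrow> (('a \<Rightarrow> complex) \<Rightarrow> real) \<Rightarrow> (('a \<Rightarrow> complex) \<Rightarrow> complex) set" where
  "dual_space V nrm = {\<xi>. zero_ext V \<xi> = \<xi> \<and>
     (\<forall>f\<in>V. \<forall>g\<in>V. \<xi> (f + g) = \<xi> f + \<xi> g) \<and>
     (\<forall>c. \<forall>f\<in>V. \<xi> (\<lambda>x. c * f x) = c * \<xi> f) \<and>
     (\<exists>C. \<forall>f\<in>V. cmod (\<xi> f) \<le> C * nrm f)}"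

definition dual_norm ::
    "('a \<Rightarrow> complex) set \<Rightarrow> (('a \<Rightarrow> complex) \<Rightarrow> real) \<Rightarrow> (('a \<Rightarrow> complex) \<Rightarrow> complex) \<Rightarrow> real" where
  "dual_norm V nrm \<xi> = (SUP f \<in> {f \<in> V. nrm f \<le> 1}. cmod (\<xi> f))"

text \<open>
  The topology of the function type is that of pointwise convergence. As functionals vanish off \<open>V\<close>,
  the subspace topology which it induces on a set of functionals is the weak-* topology.
\<close>

definition dual_unit_ball ::
    "('a \<Rightarrow> complex) set \<Rightarrow> (('a \<Rightarrow> complex) \<Rightarrow> real) \<Rightarrow> (('a \<Rightarrow> complex) \<Rightarrow> complex) set" where
  "dual_unit_ball V nrm = {\<xi> \<in> dual_space V nrm. dual_norm V nrm \<xi> \<le> 1}"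

definition extreme_points :: "'a::real_vector set \<Rightarrow> 'a set" where
  "extreme_points X = {x. x extreme_point_of X}"

definition midpoint_concave_on :: "'a::real_vector set \<Rightarrow> ('a \<Rightarrow> real) \<Rightarrow> bool" where
  "midpoint_concave_on X t \<longleftrightarrow>
     (\<forall>x1\<in>X. \<forall>x2\<in>X. t (midpoint x1 x2) \<ge> t x1 / 2 + t x2 / 2)"

definition sup_norm :: "'a set \<Rightarrow> ('a \<Rightarrow> complex) \<Rightarrow> real" where
  "sup_norm X b = (SUP x\<in>X. cmod (b x))"

definition canonical_image ::
    "(('a \<Rightarrow> complex) \<Rightarrow> complex) set \<Rightarrow> ('a \<Rightarrow> complex) \<Rightarrow> (('a \<Rightarrow> complex) \<Rightarrow> complex) \<Rightarrow> complex" where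
  "canonical_image X \<phi> = zero_ext X (\<lambda>\<xi>. \<xi> \<phi>)"

definition weighted_space ::
    "('a \<Rightarrow> complex) set \<Rightarrow> (('a \<Rightarrow> complex) \<Rightarrow> complex) set \<Rightarrow> ((('a \<Rightarrow> complex) \<Rightarrow> complex) \<Rightarrow> real) \<Rightarrow>
     ((('a \<Rightarrow> complex) \<Rightarrow> complex) \<Rightarrow> complex) set" where
  "weighted_space V X t =
     {zero_ext X (\<lambda>\<xi>. (c + canonical_image X \<phi> \<xi>) / complex_of_real (t \<xi>)) | c \<phi>. \<phi> \<in> V}"


section \<open>Complex measures\<close>

definition complex_measure :: "'a measure \<Rightarrow> ('a set \<Rightarrow> complex) \<Rightarrow> bool" where
  "complex_measure M \<mu> \<longleftrightarrow> \<mu> {} = 0 \<and>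
     (\<forall>A :: nat \<Rightarrow> 'a set. range A \<subseteq> sets M \<longrightarrow> disjoint_family A \<longrightarrow>
        (\<lambda>n. \<mu> (A n)) sums \<mu> (\<Union>n. A n))"

definition variation_on :: "'a measure \<Rightarrow> ('a set \<Rightarrow> complex) \<Rightarrow> 'a set \<Rightarrow> ennreal" where
  "variation_on M \<mu> E =
     (SUP P \<in> {P. finite P \<and> P \<subseteq> sets M \<and> disjoint P \<and> \<Union>P = E}. \<Sum>A\<in>P. ennreal (cmod (\<mu> A)))"

definition variation :: "'a measure \<Rightarrow> ('a set \<Rightarrow> complex) \<Rightarrow> 'a measure" where
  "variation M \<mu> = measure_of (space M) (sets M) (variation_on M \<mu>)"

definition total_variation_norm :: "'a measure \<Rightarrow> ('a set \<Rightarrow> complex) \<Rightarrow> real" where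
  "total_variation_norm M \<mu> = measure (variation M \<mu>) (space M)"

text \<open>
  The unimodular density in the polar decomposition of \<open>\<mu>\<close> with respect to its variation. It is unique
  up to null sets of the variation, so integrals do not depend on the choice.
\<close>

definition polar_density :: "'a measure \<Rightarrow> ('a set \<Rightarrow> complex) \<Rightarrow> 'a \<Rightarrow> complex" where
  "polar_density M \<mu> = (SOME h. h \<in> borel_measurable M \<and> (\<forall>x\<in>space M. cmod (h x) = 1) \<and>
     (\<forall>E\<in>sets M. \<mu> E = (LINT x:E|variation M \<mu>. h x)))"

definition complex_integral ::
    "'a measure \<Rightarrow> ('a set \<Rightarrow> complex) \<Rightarrow> 'a set \<Rightarrow> ('a \<Rightarrow> complex) \<Rightarrow> complex" where
  "complex_integral M \<mu> E f = (LINT x:E|variation M \<mu>. f x * polar_density M \<mu> x)"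

definition concentrated_on :: "'a measure \<Rightarrow> ('a set \<Rightarrow> complex) \<Rightarrow> 'a set \<Rightarrow> bool" where
  "concentrated_on M \<mu> A \<longleftrightarrow> A \<in> sets M \<and> (\<forall>E\<in>sets M. \<mu> E = \<mu> (E \<inter> A))"

text \<open>The Borel sets of the subspace \<open>X\<close> are the traces on \<open>X\<close> of Borel sets of the whole type.\<close>

definition borel_on :: "'a::topological_space set \<Rightarrow> 'a measure" where
  "borel_on X = restrict_space borel X"

definition regular_complex_borel_measures ::
    "'a::topological_space set \<Rightarrow> ('a set \<Rightarrow> complex) set" where
  "regular_complex_borel_measures X = {\<mu>. complex_measure (borel_on X) \<mu> \<and>
     (\<forall>E\<in>sets (borel_on X).
        variation_on (borel_on X) \<mu> E =
          (SUP K \<in> {K. K \<subseteq> E \<and> compact K}. variation_on (borel_on X) \<mu> K) \<and>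
        variation_on (borel_on X) \<mu> E =
          (INF U \<in> {U. E \<subseteq> U \<and> openin (top_of_set X) U}. variation_on (borel_on X) \<mu> U))}"

end

theory Submission
  imports Defs
begin

text \<open>
  Let \<open>M\<close> be the norm of \<open>\<Phi>\<close> and \<open>T\<close> the unit circle. On real functions on \<open>X \<times> T\<close> consider the
  sublinear functional \<open>p\<close> whose value at \<open>F\<close> is the infimum of \<open>M l + Re \<Phi>(b)\<close> over all \<open>l \<ge> 0\<close>
  and \<open>b \<in> B\<close> with \<open>F(x, s) \<le> l t(x) + Re (s b(x) t(x))\<close>. A linear functional below \<open>p\<close> is positive,
  hence a measure \<open>\<tau>\<close>; it satisfies \<open>\<integral> t d\<tau> \<le> M\<close> and \<open>\<integral> s b(x) t(x) d\<tau> = \<Phi>(b)\<close>. The majorants are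
  concave in \<open>x\<close>, because \<open>t\<close> is concave and \<open>b t\<close> is affine. So if \<open>\<tau>\<close> is chosen by the Hahn--Banach
  theorem with \<open>\<tau>(w) = p(w)\<close> for a strictly convex continuous function \<open>w\<close> of \<open>x\<close>, then \<open>w\<close> is \<open>\<tau>\<close>-almost
  everywhere an infimum of concave majorants, which forces \<open>x\<close> to be an extreme point. The required
  measure is the image of \<open>s t(x) d\<tau>\<close> on \<open>X\<close>. The function \<open>w\<close> exists and the extreme points form a Borel
  set because evaluation at the monomials embeds \<open>X\<close> into a countable product of discs; this uses that
  the coordinate functions are contractive multipliers.
\<close>

section \<open>The Hahn--Banach theorem for sublinear functionals\<close>

text \<open>The obstacle is the phase. A measure on X representing \<Phi> with the right norm comes
  from extending \<Phi>, but moving its mass to extreme points mixes masses of different phases.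
  With the phase s as a second coordinate the measure becomes positive, and mass may spread out in x
  while s is held fixed: the affine functions b t keep their integrals, and the integral of the
  concave function t can only drop, so the norm bound survives. The functional p is dual to this
  picture: p(F) is the largest integral of F against a positive \<tau> with the two stated
  properties, l being the multiplier of the mass bound and b that of the representation. Hence
  \<tau>(w) = p(w) says that \<tau> is spread out as far as these constraints allow. Two technical
  points shape the rest. X lies in a very large product space, so measurability and regularity are
  reached through countably many coordinates. And the real supremum defining the multiplier norm
  carries information only when it is finite, so boundedness of multiplication operators has to be
  proved.\<close>

definition sublinear_on :: "'v::real_vector set \<Rightarrow> ('v \<Rightarrow> real) \<Rightarrow> bool" where
  "sublinear_on U q \<longleftrightarrow>
     (\<forall>f\<in>U. \<forall>g\<in>U. q (f + g) \<le> q f + q g) \<and> (\<forall>f\<in>U. \<forall>c>0. q (c *\<^sub>R f) = c * q f)"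

lemma sublinear_on_zero:
  assumes "subspace U" "sublinear_on U q" shows "q 0 = 0"
proof -
  have "q (2 *\<^sub>R 0) = 2 * q 0"
    using assms subspace_0 unfolding sublinear_on_def by (metis zero_less_numeral)
  then show ?thesis by simp
qed

lemma sublinear_on_neg_le:
  assumes U: "subspace U" and q: "sublinear_on U q" and f: "f \<in> U"
  shows "- q (- f) \<le> q f"
proof -
  have "q (f + - f) \<le> q f + q (- f)"
    using assms subspace_neg unfolding sublinear_on_def by blast
  then show ?thesis using sublinear_on_zero[OF U q] by simp
qed

text \<open>The lowering step of the Hahn-Banach argument: the infimum along the ray in direction h
  stays sublinear, is at most q (take r = 0), and at -h is at most - q h (take r = 1). A minimal q
  therefore satisfies q (- h) = - q h.\<close>

definition shift_sublinear :: "('v::real_vector \<Rightarrow> real) \<Rightarrow> 'v \<Rightarrow> 'v \<Rightarrow> real" where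
  "shift_sublinear q h f = (INF r\<in>{0..}. q (f + r *\<^sub>R h) - r * q h)"

text \<open>Keeps the infimum in \<open>shift_sublinear\<close> finite: r h is split as (f + r h) +
  (- f).\<close>

lemma shift_sublinear_lower:
  assumes U: "subspace U" and q: "sublinear_on U q" and h: "h \<in> U" and f: "f \<in> U" and r: "0 \<le> r"
  shows "- q (- f) \<le> q (f + r *\<^sub>R h) - r * q h"
proof -
  have "r * q h = q (r *\<^sub>R h)"
    using r q h sublinear_on_zero[OF U q] unfolding sublinear_on_def by (cases "r = 0") auto
  also have "\<dots> = q ((f + r *\<^sub>R h) + - f)" by simp
  also have "\<dots> \<le> q (f + r *\<^sub>R h) + q (- f)"
    using q f h U unfolding sublinear_on_def
    by (meson subspace_add subspace_neg subspace_scale)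
  finally show ?thesis by simp
qed

lemma shift_sublinear_le:
  assumes U: "subspace U" and q: "sublinear_on U q" and h: "h \<in> U" and f: "f \<in> U" and r: "0 \<le> r"
  shows "shift_sublinear q h f \<le> q (f + r *\<^sub>R h) - r * q h"
  unfolding shift_sublinear_def
proof (rule cINF_lower)
  show "bdd_below ((\<lambda>r. q (f + r *\<^sub>R h) - r * q h) ` {0..})"
    using shift_sublinear_lower[OF U q h f] by (intro bdd_belowI2) auto
qed (use r in auto)

lemma sublinear_on_shift:
  assumes U: "subspace U" and q: "sublinear_on U q" and h: "h \<in> U"
  shows "sublinear_on U (shift_sublinear q h)"
  unfolding sublinear_on_def
proof (intro conjI ballI allI impI)
  let ?s = "shift_sublinear q h"
  have ge: "a \<le> ?s f" if "\<And>r. 0 \<le> r \<Longrightarrow> a \<le> q (f + r *\<^sub>R h) - r * q h" for a f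
    unfolding shift_sublinear_def using that by (intro cINF_greatest) auto
  note le = shift_sublinear_le[OF U q h]
  fix f g assume f: "f \<in> U" and g: "g \<in> U"
  \<comment> \<open>A parameter r for f and a parameter u for g combine to r + u for f + g. Infima
    are then taken in r and in u separately.\<close>
  have "?s (f + g) - (q (g + u *\<^sub>R h) - u * q h) \<le> q (f + r *\<^sub>R h) - r * q h"
    if "0 \<le> r" "0 \<le> u" for r u
  proof -
    have "?s (f + g) \<le> q ((f + g) + (r + u) *\<^sub>R h) - (r + u) * q h"
      using le[of "f + g" "r + u"] that U f g by (auto intro: subspace_add)
    also have "(f + g) + (r + u) *\<^sub>R h = (f + r *\<^sub>R h) + (g + u *\<^sub>R h)"
      by (simp add: algebra_simps)
    also have "q \<dots> \<le> q (f + r *\<^sub>R h) + q (g + u *\<^sub>R h)"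
      using q f g h U unfolding sublinear_on_def by (meson subspace_add subspace_scale)
    finally show ?thesis by (simp add: algebra_simps)
  qed
  then have "?s (f + g) - (q (g + u *\<^sub>R h) - u * q h) \<le> ?s f" if "0 \<le> u" for u
    using that by (intro ge) auto
  then have "?s (f + g) - ?s f \<le> ?s g"
    by (intro ge) (auto simp: algebra_simps)
  then show "?s (f + g) \<le> ?s f + ?s g" by simp
next
  let ?s = "shift_sublinear q h"
  have ge: "a \<le> ?s f" if "\<And>r. 0 \<le> r \<Longrightarrow> a \<le> q (f + r *\<^sub>R h) - r * q h" for a f
    unfolding shift_sublinear_def using that by (intro cINF_greatest) auto
  note le = shift_sublinear_le[OF U q h]
  \<comment> \<open>Rescaling the ray parameter to r / c gives one inequality; the other is the same
    one for \<open>c *\<^sub>R f\<close> and \<open>1 / c\<close>.\<close>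
  have half: "c * ?s f \<le> ?s (c *\<^sub>R f)" if f: "f \<in> U" and c: "0 < c" for f and c :: real
  proof (rule ge)
    fix r :: real assume r: "0 \<le> r"
    have "c * ?s f \<le> c * (q (f + (r / c) *\<^sub>R h) - (r / c) * q h)"
      using le[OF f, of "r / c"] r c by simp
    also have "\<dots> = q (c *\<^sub>R (f + (r / c) *\<^sub>R h)) - r * q h"
    proof -
      have "f + (r / c) *\<^sub>R h \<in> U" using f h U by (auto intro: subspace_add subspace_scale)
      then have "q (c *\<^sub>R (f + (r / c) *\<^sub>R h)) = c * q (f + (r / c) *\<^sub>R h)"
        using c q unfolding sublinear_on_def by blast
      then show ?thesis using c by (simp add: field_simps)
    qed
    also have "c *\<^sub>R (f + (r / c) *\<^sub>R h) = c *\<^sub>R f + r *\<^sub>R h" using c by (simp add: algebra_simps)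
    finally show "c * ?s f \<le> q (c *\<^sub>R f + r *\<^sub>R h) - r * q h" .
  qed
  fix f and c :: real assume f: "f \<in> U" and c: "0 < c"
  have "c *\<^sub>R f \<in> U" using f U by (simp add: subspace_scale)
  from half[OF this, of "1 / c"] c have "?s (c *\<^sub>R f) / c \<le> ?s f" by simp
  then have "?s (c *\<^sub>R f) \<le> c * ?s f" using c by (simp add: field_simps)
  with half[OF f c] show "?s (c *\<^sub>R f) = c * ?s f" by simp
qed

text \<open>A minimal sublinear functional is linear, and shifting \<open>p\<close> in the direction \<open>w\<close> first
  makes the bound at \<open>w\<close> attained.\<close>

theorem Hahn_Banach_sublinear:
  fixes p :: "'v::real_vector \<Rightarrow> real"
  assumes U: "subspace U" and p: "sublinear_on U p" and w: "w \<in> U"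
  obtains \<tau> where "\<And>f g. f \<in> U \<Longrightarrow> g \<in> U \<Longrightarrow> \<tau> (f + g) = \<tau> f + \<tau> g"
    and "\<And>c f. f \<in> U \<Longrightarrow> \<tau> (c *\<^sub>R f) = c * \<tau> f"
    and "\<And>f. f \<in> U \<Longrightarrow> \<tau> f \<le> p f" and "\<tau> w = p w"
proof -
  define r where "r = shift_sublinear p w"
  have r: "sublinear_on U r" unfolding r_def by (rule sublinear_on_shift[OF U p w])
  have r_le: "r f \<le> p f" if "f \<in> U" for f
    using shift_sublinear_le[OF U p w that, of 0] by (simp add: r_def)
  have r_neg: "r (- w) \<le> - p w"
    using shift_sublinear_le[OF U p w subspace_neg[OF U w], of 1] sublinear_on_zero[OF U p]
    by (simp add: r_def)
  \<comment> \<open>Values off U are pinned to 0, so that infima of chains exist there too and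
    minimality yields an equality of total functions.\<close>
  define Q where "Q = {q. sublinear_on U q \<and> (\<forall>f\<in>U. q f \<le> r f) \<and> (\<forall>f. f \<notin> U \<longrightarrow> q f = 0)}"
  \<comment> \<open>The order is reversed: a maximal element for Zorn's lemma is a minimal
    functional.\<close>
  define R where "R = {(q, q'). q \<in> Q \<and> q' \<in> Q \<and> (\<forall>f. q' f \<le> q f)}"
  have cut: "sublinear_on U (\<lambda>f. if f \<in> U then q f else 0)" if "sublinear_on U q" for q
    using that U by (auto simp: sublinear_on_def subspace_add subspace_scale)
  have "\<exists>q\<in>Q. \<forall>q'\<in>Q. (q, q') \<in> R \<longrightarrow> q' = q"
  proof -
    have fld: "Field R = Q" unfolding R_def Field_def by auto
    have part: "Partial_order R"
      unfolding partial_order_on_def preorder_on_def fld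
      by (auto simp: R_def refl_on_def trans_def antisym_def fun_eq_iff intro: order_trans antisym)
    have "\<exists>q\<in>Field R. \<forall>a\<in>Field R. (q, a) \<in> R \<longrightarrow> a = q"
    proof (rule Zorns_po_lemma[OF part])
      fix C assume C: "C \<in> Chains R"
      show "\<exists>u\<in>Field R. \<forall>a\<in>C. (a, u) \<in> R"
      proof (cases "C = {}")
        case True
        have "(\<lambda>f. if f \<in> U then r f else 0) \<in> Q" using cut[OF r] by (simp add: Q_def)
        then show ?thesis using True fld by auto
      next
        case False
        have CQ: "C \<subseteq> Q" using C by (auto simp: Chains_def R_def)
        have dir: "(\<forall>f. a f \<le> b f) \<or> (\<forall>f. b f \<le> a f)" if "a \<in> C" "b \<in> C" for a b
          using C that by (auto simp: Chains_def R_def)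
        define u where "u f = (if f \<in> U then INF q\<in>C. q f else 0)" for f
        \<comment> \<open>The bound - r (- f) is the same for every member of the chain.\<close>
        have bdd: "bdd_below ((\<lambda>q. q f) ` C)" if f: "f \<in> U" for f
        proof (rule bdd_belowI2)
          fix q assume "q \<in> C"
          then have q: "sublinear_on U q" "q (- f) \<le> r (- f)"
            using CQ f U by (auto simp: Q_def subspace_neg)
          show "- r (- f) \<le> q f" using sublinear_on_neg_le[OF U q(1) f] q(2) by linarith
        qed
        have u_le: "u f \<le> q f" if "q \<in> C" "f \<in> U" for q f
          using cINF_lower[OF bdd that(1)] that by (simp add: u_def)
        have u_ge: "a \<le> u f" if "\<And>q. q \<in> C \<Longrightarrow> a \<le> q f" "f \<in> U" for a f
          using that False by (auto simp: u_def intro!: cINF_greatest)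
        have "sublinear_on U u"
          unfolding sublinear_on_def
        proof (intro conjI ballI allI impI)
          fix f g assume fg: "f \<in> U" "g \<in> U"
          \<comment> \<open>The smaller of a and b lies in the chain and serves for both
            summands.\<close>
          have "u (f + g) - b g \<le> a f" if ab: "a \<in> C" "b \<in> C" for a b
          proof -
            obtain c where c: "c \<in> C" "\<And>f. c f \<le> a f" "\<And>f. c f \<le> b f"
              using dir[OF ab] ab by blast
            have "u (f + g) \<le> c (f + g)" using u_le c fg U by (simp add: subspace_add)
            also have "\<dots> \<le> c f + c g" using CQ c(1) fg by (auto simp: Q_def sublinear_on_def)
            finally show ?thesis using c(2)[of f] c(3)[of g] by linarith
          qed
          then have "u (f + g) - b g \<le> u f" if "b \<in> C" for b
            using that fg by (intro u_ge) auto
          then have "u (f + g) - u f \<le> u g"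
            using fg by (intro u_ge) (auto simp: algebra_simps)
          then show "u (f + g) \<le> u f + u g" by simp
        next
          have half: "c * u f \<le> u (c *\<^sub>R f)" if "f \<in> U" "0 < c" for f and c :: real
          proof (rule u_ge)
            fix q assume q: "q \<in> C"
            then have "q (c *\<^sub>R f) = c * q f" using CQ that by (auto simp: Q_def sublinear_on_def)
            then show "c * u f \<le> q (c *\<^sub>R f)" using u_le[OF q that(1)] that by simp
          qed (use that U in \<open>simp add: subspace_scale\<close>)
          fix f and c :: real assume f: "f \<in> U" and c: "0 < c"
          have "c *\<^sub>R f \<in> U" using f U by (simp add: subspace_scale)
          from half[OF this, of "1 / c"] c have "u (c *\<^sub>R f) / c \<le> u f" by simp
          then have "u (c *\<^sub>R f) \<le> c * u f" using c by (simp add: field_simps)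
          with half[OF f c] show "u (c *\<^sub>R f) = c * u f" by simp
        qed
        moreover obtain q0 where "q0 \<in> C" using False by blast
        moreover have "\<forall>f\<in>U. u f \<le> r f"
        proof
          fix f assume "f \<in> U"
          then show "u f \<le> r f" using u_le[OF \<open>q0 \<in> C\<close>] CQ \<open>q0 \<in> C\<close> by (force simp: Q_def)
        qed
        ultimately have uQ: "u \<in> Q" by (simp add: Q_def u_def)
        have "u f \<le> q f" if "q \<in> C" for q f
          using u_le[OF that] CQ that by (cases "f \<in> U") (auto simp: u_def Q_def)
        then have "\<forall>a\<in>C. (a, u) \<in> R" using uQ CQ by (auto simp: R_def)
        then show ?thesis using uQ fld by blast
      qed
    qed
    then show ?thesis by (simp add: fld)
  qed
  then obtain q where qQ: "q \<in> Q" and min: "\<And>q'. q' \<in> Q \<Longrightarrow> (\<And>f. q' f \<le> q f) \<Longrightarrow> q' = q"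
    unfolding R_def by blast
  have q: "sublinear_on U q" and q_le: "\<And>f. f \<in> U \<Longrightarrow> q f \<le> r f" and q_off: "\<And>f. f \<notin> U \<Longrightarrow> q f = 0"
    using qQ by (auto simp: Q_def)
  have neg: "q (- h) = - q h" if h: "h \<in> U" for h
  proof -
    define s where "s = (\<lambda>f. if f \<in> U then shift_sublinear q h f else 0)"
    have s_le: "s f \<le> q f" for f
      using shift_sublinear_le[OF U q h, of f 0] q_off[of f] by (auto simp: s_def)
    have "s \<in> Q"
      unfolding Q_def
    proof (intro CollectI conjI)
      show "sublinear_on U s" unfolding s_def by (rule cut[OF sublinear_on_shift[OF U q h]])
      show "\<forall>f\<in>U. s f \<le> r f" using s_le q_le order_trans by blast
    qed (simp add: s_def)
    then have "s = q" using min s_le by blast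
    moreover have "s (- h) \<le> - q h"
      using shift_sublinear_le[OF U q h subspace_neg[OF U h], of 1] sublinear_on_zero[OF U q] h U
      by (simp add: s_def subspace_neg)
    ultimately show ?thesis using sublinear_on_neg_le[OF U q h] by simp
  qed
  have le_p: "q f \<le> p f" if "f \<in> U" for f using q_le[OF that] r_le[OF that] by linarith
  show ?thesis
  proof (rule that[of q])
    fix f g assume fg: "f \<in> U" "g \<in> U"
    have "q (- f + - g) \<le> q (- f) + q (- g)"
      using q fg U unfolding sublinear_on_def by (meson subspace_neg)
    moreover have "- f + - g = - (f + g)" by simp
    ultimately have "q f + q g \<le> q (f + g)"
      using neg[OF fg(1)] neg[OF fg(2)] neg[OF subspace_add[OF U fg]] by simp
    moreover have "q (f + g) \<le> q f + q g" using q fg unfolding sublinear_on_def by blast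
    ultimately show "q (f + g) = q f + q g" by simp
  next
    fix c :: real and f assume f: "f \<in> U"
    have pos: "q (a *\<^sub>R f) = a * q f" if "0 < a" for a
      using q f that unfolding sublinear_on_def by blast
    consider "0 < c" | "c = 0" | "0 < - c" by linarith
    then show "q (c *\<^sub>R f) = c * q f"
    proof cases
      case 3
      have "q (- ((- c) *\<^sub>R f)) = - q ((- c) *\<^sub>R f)" using neg[OF subspace_scale[OF U f]] .
      then show ?thesis using pos[OF 3] by simp
    qed (use pos sublinear_on_zero[OF U q] in auto)
  next
    \<comment> \<open>Linearity gives q w = - q (- w), which is at least - r (- w) and hence at
      least p w.\<close>
    show "q w = p w"
      using neg[OF w] q_le[OF subspace_neg[OF U w]] r_neg le_p[OF w] by linarith
  qed (rule le_p)
qed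


section \<open>The Riesz representation theorem on a compact space\<close>

text \<open>The measure will live on the Caratheodory sets of an outer measure on K. They contain {f
  > a} for every continuous f, which is all that integration of continuous functions asks
  for.\<close>

locale positive_functional =
  fixes K :: "'k::topological_space set" and \<tau> :: "('k \<Rightarrow> real) \<Rightarrow> real"
  assumes compact_K: "compact K"
    and add: "\<And>f g. continuous_on K f \<Longrightarrow> continuous_on K g \<Longrightarrow> \<tau> (\<lambda>x. f x + g x) = \<tau> f + \<tau> g"
    and scale: "\<And>c f. continuous_on K f \<Longrightarrow> \<tau> (\<lambda>x. c * f x) = c * \<tau> f"
    and nonneg: "\<And>f. continuous_on K f \<Longrightarrow> (\<And>x. x \<in> K \<Longrightarrow> 0 \<le> f x) \<Longrightarrow> 0 \<le> \<tau> f"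
begin

lemma diff:
  assumes "continuous_on K f" "continuous_on K g"
  shows "\<tau> (\<lambda>x. f x - g x) = \<tau> f - \<tau> g"
  using add[OF assms(1), of "\<lambda>x. (-1) * g x"] scale[OF assms(2), of "-1"] assms(2)
  by (simp add: continuous_on_minus)

lemma mono:
  assumes "continuous_on K f" "continuous_on K g" "\<And>x. x \<in> K \<Longrightarrow> f x \<le> g x"
  shows "\<tau> f \<le> \<tau> g"
  using nonneg[of "\<lambda>x. g x - f x"] diff[OF assms(2,1)] assms by (simp add: continuous_on_diff)

lemma cong:
  assumes "continuous_on K f" "continuous_on K g" "\<And>x. x \<in> K \<Longrightarrow> f x = g x"
  shows "\<tau> f = \<tau> g"
  using mono[of f g] mono[of g f] assms by (simp add: antisym)

lemma zero: "\<tau> (\<lambda>x. 0) = 0"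
  using scale[of "\<lambda>x. 0" 0] by simp

lemma sum:
  assumes "finite I" "\<And>i. i \<in> I \<Longrightarrow> continuous_on K (f i)"
  shows "\<tau> (\<lambda>x. \<Sum>i\<in>I. f i x) = (\<Sum>i\<in>I. \<tau> (f i))"
  using assms by (induction I) (auto simp: zero add continuous_on_sum)

section \<open>Daniell's outer measure\<close>

definition cover :: "(nat \<Rightarrow> 'k \<Rightarrow> real) \<Rightarrow> 'k set \<Rightarrow> bool" where
  "cover F E \<longleftrightarrow> (\<forall>n. continuous_on K (F n)) \<and> (\<forall>n. \<forall>x\<in>K. 0 \<le> F n x) \<and>
     (\<forall>x\<in>E. 1 \<le> (\<Sum>n. ennreal (F n x)))"

text \<open>Sets are covered by series of nonnegative continuous functions instead of open sets, so
  \<tau> applies to the covers directly and no separating functions have to be produced.\<close>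

definition outer :: "'k set \<Rightarrow> ennreal" where
  "outer E = (INF F \<in> {F. cover F E}. \<Sum>n. ennreal (\<tau> (F n)))"

lemma outer_le: "cover F E \<Longrightarrow> outer E \<le> (\<Sum>n. ennreal (\<tau> (F n)))"
  unfolding outer_def by (rule INF_lower) simp

lemma outer_le_single:
  assumes "continuous_on K f" "\<And>x. x \<in> K \<Longrightarrow> 0 \<le> f x" "\<And>x. x \<in> E \<Longrightarrow> 1 \<le> f x"
  shows "outer E \<le> ennreal (\<tau> f)"
proof -
  define F where "F = (\<lambda>n x. if n = (0::nat) then f x else 0)"
  have sing: "(\<Sum>n. if n = 0 then a else 0) = a" for a :: ennreal
    using suminf_finite[of "{0}" "\<lambda>n. if n = 0 then a else 0"] by simp
  have F: "F n = (if n = 0 then f else (\<lambda>x. 0))" for n by (auto simp: F_def)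
  have "ennreal (F n x) = (if n = 0 then ennreal (f x) else 0)" for n x by (simp add: F_def)
  then have "cover F E"
    using assms by (simp add: cover_def sing F ennreal_ge_1)
  from outer_le[OF this] have "outer E \<le> (\<Sum>n. ennreal (\<tau> (F n)))" .
  also have "(\<lambda>n. ennreal (\<tau> (F n))) = (\<lambda>n. if n = 0 then ennreal (\<tau> f) else 0)"
    by (auto simp: F zero)
  finally show ?thesis by (simp add: sing)
qed

text \<open>A double family is read as one sequence through \<open>prod_decode\<close>. This serves
  for countable unions and again for cutting a cover into layers.\<close>

lemma cover_prod_decode:
  assumes "\<And>n k. continuous_on K (G n k)" "\<And>n k x. x \<in> K \<Longrightarrow> 0 \<le> G n k x"
    and "\<And>x. x \<in> E \<Longrightarrow> 1 \<le> (\<Sum>n. \<Sum>k. ennreal (G n k x))"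
  shows "outer E \<le> (\<Sum>n. \<Sum>k. ennreal (\<tau> (G n k)))"
proof -
  define F where "F i = (case prod_decode i of (n, k) \<Rightarrow> G n k)" for i
  have two: "(\<Sum>i. (case prod_decode i of (n, k) \<Rightarrow> h n k)) = (\<Sum>n. \<Sum>k. h n k)"
    for h :: "nat \<Rightarrow> nat \<Rightarrow> ennreal"
    using suminf_ennreal_2dimen[of "\<lambda>n. \<Sum>k. h n k" "\<lambda>(n, k). h n k"] by simp
  have "ennreal (F i x) = (case prod_decode i of (n, k) \<Rightarrow> ennreal (G n k x))" for i x
    by (simp add: F_def split: prod.split)
  then have sx: "(\<Sum>i. ennreal (F i x)) = (\<Sum>n. \<Sum>k. ennreal (G n k x))" for x
    using two[of "\<lambda>n k. ennreal (G n k x)"] by simp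
  have "ennreal (\<tau> (F i)) = (case prod_decode i of (n, k) \<Rightarrow> ennreal (\<tau> (G n k)))" for i
    by (simp add: F_def split: prod.split)
  then have st: "(\<Sum>i. ennreal (\<tau> (F i))) = (\<Sum>n. \<Sum>k. ennreal (\<tau> (G n k)))"
    using two[of "\<lambda>n k. ennreal (\<tau> (G n k))"] by simp
  have "cover F E"
    using assms sx by (auto simp: cover_def F_def split: prod.split)
  from outer_le[OF this] show ?thesis by (simp add: st)
qed

lemma outer_close:
  assumes "outer E < e"
  shows "\<exists>F. cover F E \<and> (\<Sum>n. ennreal (\<tau> (F n))) < e"
  using assms unfolding outer_def INF_less_iff by auto

lemma outer_measure_space_outer: "outer_measure_space (Pow K) outer"
  unfolding outer_measure_space_def
proof (intro conjI)
  show "positive (Pow K) outer"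
    using outer_le_single[of "\<lambda>x. 0" "{}"] by (simp add: positive_def zero)
  show "increasing (Pow K) outer"
    unfolding increasing_def outer_def cover_def by (auto intro!: INF_superset_mono)
  show "countably_subadditive (Pow K) outer"
    unfolding countably_subadditive_def
  proof safe
    fix A :: "nat \<Rightarrow> 'k set" assume "range A \<subseteq> Pow K"
    show "outer (\<Union>i. A i) \<le> (\<Sum>n. outer (A n))"
    proof (rule ennreal_le_epsilon)
      fix b and e :: real assume e: "0 < e" and "(\<Sum>n. outer (A n)) < top"
      then have *: "outer (A n) < outer (A n) + e * (1/2)^Suc n" for n
        by (auto simp add: less_top dest!: ennreal_suminf_lessD)
      obtain B where cB: "\<And>n. cover (B n) (A n)"
        and B: "\<And>n. (\<Sum>i. ennreal (\<tau> (B n i))) \<le> outer (A n) + e * (1/2)^Suc n"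
        by (metis less_imp_le outer_close[OF *])
      have "outer (\<Union>i. A i) \<le> (\<Sum>n. \<Sum>k. ennreal (\<tau> (B n k)))"
      proof (rule cover_prod_decode)
        fix x assume "x \<in> (\<Union>i. A i)"
        then obtain n where "x \<in> A n" by blast
        then have "1 \<le> (\<Sum>k. ennreal (B n k x))" using cB by (auto simp: cover_def)
        also have "\<dots> \<le> (\<Sum>n. \<Sum>k. ennreal (B n k x))"
          using sum_le_suminf[of "\<lambda>n. \<Sum>k. ennreal (B n k x)" "{n}"] by simp
        finally show "1 \<le> (\<Sum>n. \<Sum>k. ennreal (B n k x))" .
      qed (use cB in \<open>auto simp: cover_def\<close>)
      also have "\<dots> \<le> (\<Sum>n. outer (A n) + e * (1/2) ^ Suc n)"
        by (intro suminf_le allI B) auto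
      also have "\<dots> = (\<Sum>n. outer (A n)) + (\<Sum>n. ennreal e * ennreal ((1/2) ^ Suc n))"
        using e by (subst suminf_add[symmetric])
          (auto simp del: ennreal_suminf_cmult simp add: ennreal_mult[symmetric])
      also have "\<dots> = (\<Sum>n. outer (A n)) + e"
        unfolding ennreal_suminf_cmult
        by (subst suminf_ennreal_eq[OF zero_le_power power_half_series]) auto
      finally show "outer (\<Union>i. A i) \<le> (\<Sum>n. outer (A n)) + e" .
    qed
  qed
qed

text \<open>Cutting a cover \<open>F\<close> of \<open>E\<close> by the functions \<open>G k = min 1 (k * f)\<close>, which increase to the indicator
  of \<open>{f > 0}\<close>, gives covers of the two parts of \<open>E\<close>.\<close>

lemma positive_set_in_lambda_system:
  fixes f :: "'k \<Rightarrow> real"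
  assumes f: "continuous_on K f" and f0: "\<And>x. x \<in> K \<Longrightarrow> 0 \<le> f x"
  shows "{x \<in> K. 0 < f x} \<in> lambda_system K (Pow K) outer"
proof -
  interpret P: sigma_algebra K "Pow K" by (rule sigma_algebra_Pow)
  let ?U = "{x \<in> K. 0 < f x}"
  define G where "G k x = min 1 (real k * f x)" for k x
  have G_cont: "continuous_on K (G k)" for k
    unfolding G_def by (intro continuous_intros f)
  have G_mono: "G k x \<le> G (Suc k) x" if "x \<in> K" for k x
    using f0[OF that] by (auto simp: G_def min_def algebra_simps)
  have G01: "0 \<le> G k x" "G k x \<le> 1" if "x \<in> K" for k x
    using f0[OF that] by (auto simp: G_def)
  have G_lim: "(\<lambda>k. G k x) \<longlonglongrightarrow> 1" if x: "x \<in> ?U" for x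
  proof (rule tendsto_eventually)
    obtain k0 where k0: "1 < real k0 * f x" using x reals_Archimedean3[of "f x"] by auto
    have "G k x = 1" if "k0 \<le> k" for k
    proof -
      have "real k0 * f x \<le> real k * f x" using x that by (intro mult_right_mono) auto
      then show ?thesis using k0 by (simp add: G_def)
    qed
    then show "\<forall>\<^sub>F k in sequentially. G k x = 1" by (auto simp: eventually_sequentially)
  qed
  have split: "outer (E \<inter> ?U) + outer (E - ?U) \<le> outer E" if E: "E \<subseteq> K" for E
    unfolding outer_def[of E]
  proof (rule INF_greatest, clarify)
    fix F assume F: "cover F E"
    have F_cont: "continuous_on K (F n)" and F0: "\<And>x. x \<in> K \<Longrightarrow> 0 \<le> F n x" for n
      using F by (auto simp: cover_def)
    \<comment> \<open>The increments of F n * G k in k: on \<open>?U\<close> they add up to F n,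
      because G 0 = 0 and G k tends to 1.\<close>
    define D where "D n k x = F n x * (G (Suc k) x - G k x)" for n k x
    have D_cont: "continuous_on K (D n k)" for n k
      unfolding D_def by (intro continuous_intros F_cont G_cont)
    have D0: "0 \<le> D n k x" if "x \<in> K" for n k x
      using F0 G_mono that by (simp add: D_def)
    have FG_cont: "continuous_on K (\<lambda>x. F n x * (1 - G k x))" for n k
      by (intro continuous_intros F_cont G_cont)
    have FG0: "0 \<le> F n x * (1 - G k x)" if "x \<in> K" for n k x
      using F0 G01 that by simp
    have part: "(\<Sum>k<N. \<tau> (D n k)) = \<tau> (\<lambda>x. F n x * G N x)" for n N
    proof -
      have "(\<Sum>k<N. D n k x) = F n x * G N x" for x
      proof -
        have "(\<Sum>k<N. D n k x) = F n x * (G N x - G 0 x)"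
          unfolding D_def sum_distrib_left[symmetric] sum_lessThan_telescope[of "\<lambda>k. G k x" N] ..
        then show ?thesis by (simp add: G_def)
      qed
      then show ?thesis using sum[of "{..<N}" "D n"] D_cont by simp
    qed
    have "outer (E \<inter> ?U) \<le> (\<Sum>n. \<Sum>k. ennreal (\<tau> (D n k)))"
    proof (rule cover_prod_decode)
      fix x assume x: "x \<in> E \<inter> ?U"
      then have xK: "x \<in> K" by blast
      have "(\<Sum>k. ennreal (D n k x)) = ennreal (F n x)" for n
      proof (rule suminf_ennreal_eq)
        have "(\<lambda>k. G (Suc k) x - G k x) sums (1 - G 0 x)"
          by (rule telescope_sums) (use x G_lim in auto)
        then show "(\<lambda>k. D n k x) sums F n x"
          unfolding D_def using sums_mult[of _ 1 "F n x"] by (simp add: G_def)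
      qed (use D0 xK in auto)
      then show "1 \<le> (\<Sum>n. \<Sum>k. ennreal (D n k x))" using F x by (simp add: cover_def)
    qed (use D_cont D0 in auto)
    \<comment> \<open>Only the first N layers are taken away. The remainder F n * (1 - G N) is still
      F n on E - ?U, where f = 0, and so covers that set. As N is arbitrary, the bound passes to the
      full series.\<close>
    moreover have "(\<Sum>k<N. \<Sum>n. ennreal (\<tau> (D n k))) + outer (E - ?U) \<le> (\<Sum>n. ennreal (\<tau> (F n)))" for N
    proof -
      have "outer (E - ?U) \<le> (\<Sum>n. ennreal (\<tau> (\<lambda>x. F n x * (1 - G N x))))"
      proof (rule outer_le)
        have "1 - G N x = 1" if "x \<in> E - ?U" for x
        proof -
          have "f x = 0" using that E f0[of x] by force
          then show ?thesis by (simp add: G_def)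
        qed
        then show "cover (\<lambda>n x. F n x * (1 - G N x)) (E - ?U)"
          using FG_cont FG0 F by (auto simp: cover_def)
      qed
      moreover have "(\<Sum>k<N. \<Sum>n. ennreal (\<tau> (D n k))) = (\<Sum>n. ennreal (\<tau> (\<lambda>x. F n x * G N x)))"
      proof -
        have "(\<Sum>k<N. ennreal (\<tau> (D n k))) = ennreal (\<tau> (\<lambda>x. F n x * G N x))" for n
          using part[of n N] nonneg[OF D_cont D0] by (simp add: sum_ennreal)
        then show ?thesis by (simp add: suminf_sum[symmetric])
      qed
      moreover have eq: "ennreal (\<tau> (\<lambda>x. F n x * G N x)) + ennreal (\<tau> (\<lambda>x. F n x * (1 - G N x))) = ennreal (\<tau> (F n))" for n
      proof -
        have c: "continuous_on K (\<lambda>x. F n x * G N x)" by (intro continuous_intros F_cont G_cont)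
        have "\<tau> (\<lambda>x. F n x * G N x + F n x * (1 - G N x)) = \<tau> (\<lambda>x. F n x * G N x) + \<tau> (\<lambda>x. F n x * (1 - G N x))"
          by (rule add[OF c FG_cont])
        moreover have "(\<lambda>x. F n x * G N x + F n x * (1 - G N x)) = F n" by (auto simp: algebra_simps)
        moreover have "0 \<le> \<tau> (\<lambda>x. F n x * G N x)" using c F0 G01 by (intro nonneg) auto
        moreover have "0 \<le> \<tau> (\<lambda>x. F n x * (1 - G N x))" using FG_cont FG0 by (intro nonneg) auto
        ultimately show ?thesis by (metis ennreal_plus)
      qed
      ultimately have "(\<Sum>k<N. \<Sum>n. ennreal (\<tau> (D n k))) + outer (E - ?U)
          \<le> (\<Sum>n. ennreal (\<tau> (\<lambda>x. F n x * G N x))) + (\<Sum>n. ennreal (\<tau> (\<lambda>x. F n x * (1 - G N x))))"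
        by (simp only: add_left_mono)
      also have "\<dots> = (\<Sum>n. ennreal (\<tau> (F n)))"
        using suminf_add[OF summableI summableI,
            of "\<lambda>n. ennreal (\<tau> (\<lambda>x. F n x * G N x))" "\<lambda>n. ennreal (\<tau> (\<lambda>x. F n x * (1 - G N x)))"]
        by (simp only: eq)
      finally show ?thesis .
    qed
    then have "(\<Sum>k. \<Sum>n. ennreal (\<tau> (D n k))) + outer (E - ?U) \<le> (\<Sum>n. ennreal (\<tau> (F n)))"
      by (rule ennreal_suminf_bound_add)
    moreover have "(\<Sum>k. \<Sum>n. ennreal (\<tau> (D n k))) = (\<Sum>n. \<Sum>k. ennreal (\<tau> (D n k)))"
      using nn_integral_suminf[of "\<lambda>k n. ennreal (\<tau> (D n k))" "count_space UNIV"]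
      by (simp add: nn_integral_count_space_nat)
    ultimately show "outer (E \<inter> ?U) + outer (E - ?U) \<le> (\<Sum>n. ennreal (\<tau> (F n)))"
      by (simp only:) (erule (1) order_trans[OF add_right_mono])
  qed
  have "outer (E \<inter> ?U) + outer (E - ?U) = outer E" if E: "E \<subseteq> K" for E
  proof (rule antisym)
    have "subadditive (Pow K) outer"
      using outer_measure_space_outer P.countably_subadditive_subadditive
      unfolding outer_measure_space_def by blast
    then have "outer ((E \<inter> ?U) \<union> (E - ?U)) \<le> outer (E \<inter> ?U) + outer (E - ?U)"
      using E by (intro subadditiveD) auto
    then show "outer E \<le> outer (E \<inter> ?U) + outer (E - ?U)" by (simp add: Int_Diff_Un)
  qed (rule split[OF E])
  then show ?thesis by (auto simp: P.lambda_system_eq)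
qed

text \<open>Compactness enters here, in the manner of Dini: the sets where a partial sum exceeds 1 -
  d are relatively open, increasing and cover K, so one of them is K. This lower bound on
  \<open>outer\<close> prevents mass from being lost.\<close>

lemma outer_K: "outer K = ennreal (\<tau> (\<lambda>x. 1))"
proof (rule antisym)
  show "outer K \<le> ennreal (\<tau> (\<lambda>x. 1))" by (rule outer_le_single) auto
  have t1: "0 \<le> \<tau> (\<lambda>x. 1)" by (rule nonneg) auto
  show "ennreal (\<tau> (\<lambda>x. 1)) \<le> outer K"
    unfolding outer_def
  proof (rule INF_greatest, clarify)
    fix F assume F: "cover F K"
    have F_cont: "continuous_on K (F n)" and F0: "\<And>x. x \<in> K \<Longrightarrow> 0 \<le> F n x" for n
      using F by (auto simp: cover_def)
    have part_cont: "continuous_on K (\<lambda>x. \<Sum>i<n. F i x)" for n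
      by (intro continuous_intros F_cont)
    have tF: "0 \<le> \<tau> (F n)" for n by (rule nonneg[OF F_cont F0])
    have "ennreal (\<tau> (\<lambda>x. 1)) \<le> (\<Sum>n. ennreal (\<tau> (F n))) + ennreal e" if e: "0 < e" for e
    proof -
      \<comment> \<open>Makes d times the mass at most e; the + 1 avoids a division by 0.\<close>
      define d where "d = e / (\<tau> (\<lambda>x. 1) + 1)"
      have d: "0 < d" "d * \<tau> (\<lambda>x. 1) \<le> e" using e t1 by (auto simp: d_def field_simps)
      define V where "V n = {x \<in> K. 1 - d < (\<Sum>i<n. F i x)}" for n
      have V_open: "openin (top_of_set K) (V n)" for n
      proof -
        have "V n = K \<inter> (\<lambda>x. \<Sum>i<n. F i x) -` {1 - d<..}" by (auto simp: V_def)
        then show ?thesis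
          using continuous_openin_preimage_gen[OF part_cont[of n] open_greaterThan] by simp
      qed
      have V_mono: "V m \<subseteq> V n" if "m \<le> n" for m n
      proof
        fix x assume "x \<in> V m"
        moreover have "(\<Sum>i<m. F i x) \<le> (\<Sum>i<n. F i x)" if "x \<in> K"
          using F0[OF that] \<open>m \<le> n\<close> by (intro sum_mono2) auto
        ultimately show "x \<in> V n" by (auto simp: V_def)
      qed
      have V_cov: "K \<subseteq> (\<Union>n. V n)"
      proof
        fix x assume x: "x \<in> K"
        have "ennreal (1 - d) < 1" using d by (simp add: ennreal_less_one_iff)
        also have "1 \<le> (\<Sum>n. ennreal (F n x))" using F x by (simp add: cover_def)
        finally obtain n where "ennreal (1 - d) < (\<Sum>i<n. ennreal (F i x))"
          unfolding suminf_eq_SUP less_SUP_iff by blast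
        then have "1 - d < (\<Sum>i<n. F i x)"
          using F0[OF x] by (simp add: sum_ennreal sum_nonneg) (smt (verit) ennreal_leI not_le)
        then show "x \<in> (\<Union>n. V n)" using x by (auto simp: V_def)
      qed
      obtain C where C: "C \<subseteq> range V" "finite C" "K \<subseteq> \<Union>C"
        using compact_K V_open V_cov unfolding compact_eq_openin_cover
        by (metis (no_types, lifting) imageE)
      then obtain I where I: "finite I" "C = V ` I" by (meson finite_subset_image)
      \<comment> \<open>0 is inserted to give \<open>Max\<close> a value when I is empty.\<close>
      define n where "n = Max (insert 0 I)"
      have "K \<subseteq> V n"
      proof
        fix x assume "x \<in> K"
        then obtain i where "i \<in> I" "x \<in> V i" using C I by blast
        then show "x \<in> V n" using V_mono[of i n] I by (auto simp: n_def)
      qed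
      then have le: "1 - d \<le> (\<Sum>i<n. F i x)" if "x \<in> K" for x using that by (auto simp: V_def)
      have "\<tau> (\<lambda>x. (1 - d) * 1) \<le> \<tau> (\<lambda>x. \<Sum>i<n. F i x)"
        using le by (intro mono part_cont) auto
      moreover have "\<tau> (\<lambda>x. (1 - d) * 1) = (1 - d) * \<tau> (\<lambda>x. 1)" by (rule scale) auto
      ultimately have "\<tau> (\<lambda>x. 1) \<le> (\<Sum>i<n. \<tau> (F i)) + e"
        using sum[of "{..<n}" F] F_cont d by (simp add: algebra_simps)
      then have "ennreal (\<tau> (\<lambda>x. 1)) \<le> ennreal ((\<Sum>i<n. \<tau> (F i)) + e)" by (rule ennreal_leI)
      also have "\<dots> = (\<Sum>i<n. ennreal (\<tau> (F i))) + ennreal e"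
        using tF e by (simp add: sum_ennreal sum_nonneg)
      also have "\<dots> \<le> (\<Sum>n. ennreal (\<tau> (F n))) + ennreal e"
        by (intro add_right_mono sum_le_suminf) auto
      finally show ?thesis .
    qed
    then show "ennreal (\<tau> (\<lambda>x. 1)) \<le> (\<Sum>n. ennreal (\<tau> (F n)))"
      by (rule ennreal_le_epsilon)
  qed
qed

section \<open>The Caratheodory measure and its integral\<close>

definition riesz_measure :: "'k measure" where
  "riesz_measure = measure_of K (lambda_system K (Pow K) outer) outer"

lemma measure_space_outer: "measure_space K (lambda_system K (Pow K) outer) outer"
  by (rule sigma_algebra.caratheodory_lemma[OF sigma_algebra_Pow outer_measure_space_outer])

lemma space_riesz_measure: "space riesz_measure = K"
  unfolding riesz_measure_def by (rule space_measure_of) (auto simp: lambda_system_def)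

lemma sets_riesz_measure: "sets riesz_measure = lambda_system K (Pow K) outer"
proof -
  have "sigma_algebra K (lambda_system K (Pow K) outer)"
    using measure_space_outer by (simp add: measure_space_def)
  then show ?thesis
    by (simp add: riesz_measure_def sigma_algebra.sets_measure_of_eq)
qed

lemma emeasure_riesz_measure:
  assumes "E \<in> sets riesz_measure" shows "emeasure riesz_measure E = outer E"
  unfolding riesz_measure_def
  by (rule emeasure_measure_of_sigma)
    (use measure_space_outer assms in \<open>auto simp: measure_space_def sets_riesz_measure\<close>)

lemma finite_measure_riesz: "finite_measure riesz_measure"
  using sets.top[of riesz_measure]
  by (intro finite_measureI) (simp only: emeasure_riesz_measure outer_K space_riesz_measure, simp)

lemma positive_set_measurable:
  fixes f :: "'k \<Rightarrow> real"
  assumes f: "continuous_on K f"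
  shows "{x \<in> K. a < f x} \<in> sets riesz_measure"
proof -
  have "continuous_on K (\<lambda>x. max (f x - a) 0)" by (intro continuous_intros f)
  from positive_set_in_lambda_system[OF this]
  have "{x \<in> K. 0 < max (f x - a) 0} \<in> sets riesz_measure" by (simp add: sets_riesz_measure)
  moreover have "{x \<in> K. 0 < max (f x - a) 0} = {x \<in> K. a < f x}" by auto
  ultimately show ?thesis by simp
qed

lemma continuous_on_measurable_riesz:
  fixes f :: "'k \<Rightarrow> real"
  assumes f: "continuous_on K f"
  shows "f \<in> borel_measurable riesz_measure"
  using positive_set_measurable[OF f] by (simp add: borel_measurable_iff_greater space_riesz_measure)

lemma integrable_riesz:
  fixes f :: "'k \<Rightarrow> real"
  assumes f: "continuous_on K f"
  shows "integrable riesz_measure f"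
proof -
  interpret finite_measure riesz_measure by (rule finite_measure_riesz)
  have "compact (f ` K)" by (rule compact_continuous_image[OF f compact_K])
  then obtain B where "\<And>x. x \<in> K \<Longrightarrow> norm (f x) \<le> B"
    using compact_imp_bounded bounded_iff by (metis image_eqI)
  then show ?thesis
    using continuous_on_measurable_riesz[OF f]
    by (intro integrable_const_bound[of _ B] AE_I2) (auto simp: space_riesz_measure)
qed

text \<open>Cut f into N slabs of height 1/N. On {f > (j+1)/N}, which is where slab j+1 is nonzero,
  slab j equals 1/N; so this set has measure at most N times \<tau> of slab j, and the integral of
  slab j+1 is at most \<tau> of slab j. The shift by one leaves over the integral of slab 0, at most
  1/N times the total mass.\<close>

lemma integral_riesz_le:
  assumes f: "continuous_on K f" and f01: "\<And>x. x \<in> K \<Longrightarrow> 0 \<le> f x \<and> f x \<le> 1"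
  shows "integral\<^sup>L riesz_measure f \<le> \<tau> f"
proof -
  interpret N: finite_measure riesz_measure by (rule finite_measure_riesz)
  let ?m = "measure riesz_measure K"
  have bound: "integral\<^sup>L riesz_measure f \<le> \<tau> f + ?m / real N" if N: "0 < N" for N :: nat
  proof -
    define h where "h j x = min (max (f x - real j / N) 0) (1 / N)" for j x
    have h_cont: "continuous_on K (h j)" for j
      unfolding h_def by (intro continuous_intros f)
    have h0: "0 \<le> h j x" "h j x \<le> 1 / N" for j x by (auto simp: h_def)
    have h_sum: "(\<Sum>j<n. h j x) = min (f x) (real n / N)" if "x \<in> K" for n x
    proof (induction n)
      case 0 then show ?case using f01[OF that] by simp
    next
      case (Suc n)
      have "min a b + min (max (a - b) 0) c = min a (b + c)" if "0 \<le> c" for a b c :: real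
        using that by (auto simp: min_def max_def)
      from this[of "1 / N" "f x" "real n / N"] Suc show ?case
        by (simp add: h_def add_divide_distrib)
    qed
    have f_sum: "f x = (\<Sum>j<N. h j x)" if "x \<in> K" for x
      using h_sum[OF that, of N] f01[OF that] N by simp
    have step: "integral\<^sup>L riesz_measure (h (Suc j)) \<le> \<tau> (h j)" for j
    proof -
      let ?E = "{x \<in> K. real (Suc j) / N < f x}"
      have E: "?E \<in> sets riesz_measure" by (rule positive_set_measurable[OF f])
      have "integral\<^sup>L riesz_measure (h (Suc j)) \<le> integral\<^sup>L riesz_measure (\<lambda>x. indicator ?E x * (1 / N))"
      proof (rule integral_mono)
        show "integrable riesz_measure (h (Suc j))" by (rule integrable_riesz[OF h_cont])
        show "integrable riesz_measure (\<lambda>x. indicator ?E x * (1 / real N))"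
          using E by (intro integrable_mult_left integrable_real_indicator) (auto simp: N.emeasure_finite less_top[symmetric])
        fix x assume "x \<in> space riesz_measure"
        then show "h (Suc j) x \<le> indicator ?E x * (1 / real N)"
          using h0(2)[of "Suc j" x] N
          by (cases "x \<in> ?E") (auto simp: space_riesz_measure h_def)
      qed
      also have "\<dots> = measure riesz_measure ?E / N"
        using E sets.sets_into_space[OF E] by (simp add: Int_absorb1 Int_absorb2)
      also have "\<dots> \<le> \<tau> (h j)"
      proof -
        have "outer ?E \<le> ennreal (\<tau> (\<lambda>x. real N * h j x))"
        proof (rule outer_le_single)
          fix x assume "x \<in> ?E"
          then have "1 / N \<le> f x - real j / N" by (simp add: add_divide_distrib)
          moreover have "0 < 1 / real N" using N by simp
          ultimately have "h j x = 1 / N" by (simp only: h_def)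
          then show "1 \<le> real N * h j x" using N by simp
        qed (use h_cont h0 in \<open>auto intro!: continuous_intros\<close>)
        also have "\<tau> (\<lambda>x. real N * h j x) = N * \<tau> (h j)" by (rule scale[OF h_cont])
        finally have "measure riesz_measure ?E \<le> N * \<tau> (h j)"
          using nonneg[OF h_cont h0(1)] E
          by (simp add: measure_def emeasure_riesz_measure enn2real_leI)
        then show ?thesis using N by (simp add: field_simps)
      qed
      finally show ?thesis .
    qed
    have "integral\<^sup>L riesz_measure f = integral\<^sup>L riesz_measure (\<lambda>x. \<Sum>j<N. h j x)"
      using f_sum by (intro Bochner_Integration.integral_cong) (auto simp: space_riesz_measure)
    also have "\<dots> = (\<Sum>j<N. integral\<^sup>L riesz_measure (h j))"
      by (intro Bochner_Integration.integral_sum integrable_riesz h_cont)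
    also have "\<dots> = integral\<^sup>L riesz_measure (h 0) + (\<Sum>j<N - 1. integral\<^sup>L riesz_measure (h (Suc j)))"
      using N sum.lessThan_Suc_shift[of "\<lambda>j. integral\<^sup>L riesz_measure (h j)" "N - 1"] by simp
    also have "\<dots> \<le> ?m / N + (\<Sum>j<N - 1. \<tau> (h j))"
    proof (intro add_mono sum_mono step)
      have "integral\<^sup>L riesz_measure (h 0) \<le> integral\<^sup>L riesz_measure (\<lambda>x. 1 / real N)"
        using h0 by (intro integral_mono integrable_riesz h_cont) auto
      then show "integral\<^sup>L riesz_measure (h 0) \<le> ?m / N" by (simp add: space_riesz_measure)
    qed
    also have "\<dots> \<le> ?m / N + (\<Sum>j<N. \<tau> (h j))"
      using nonneg[OF h_cont h0(1)] by (intro add_left_mono sum_mono2) auto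
    also have "(\<Sum>j<N. \<tau> (h j)) = \<tau> (\<lambda>x. \<Sum>j<N. h j x)" using sum[of "{..<N}" h] h_cont by simp
    also have "\<dots> = \<tau> f" using f_sum by (intro cong) (auto intro!: continuous_intros h_cont f)
    finally show ?thesis by simp
  qed
  have "(\<lambda>N. \<tau> f + ?m / real N) \<longlonglongrightarrow> \<tau> f + 0"
    by (intro tendsto_intros lim_const_over_n)
  then show ?thesis
    using bound by (intro tendsto_lowerbound[of "\<lambda>N. \<tau> f + ?m / real N" _ sequentially])
      (auto intro!: eventually_sequentiallyI[of 1])
qed

text \<open>The inequality is applied to g and to 1 - g. Both sides agree at the constant 1 by
  \<open>outer_K\<close>, so equality holds for functions with values in [0, 1]; an affine change
  reduces the general case to this one.\<close>

theorem integral_riesz: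
  assumes f: "continuous_on K f"
  shows "integral\<^sup>L riesz_measure f = \<tau> f"
proof -
  interpret N: finite_measure riesz_measure by (rule finite_measure_riesz)
  have one: "integral\<^sup>L riesz_measure (\<lambda>x. 1) = \<tau> (\<lambda>x. 1)"
    using nonneg[of "\<lambda>x. 1"] sets.top[of riesz_measure]
    by (simp add: measure_def emeasure_riesz_measure space_riesz_measure outer_K)
  have unit: "integral\<^sup>L riesz_measure g = \<tau> g"
    if g: "continuous_on K g" and g01: "\<And>x. x \<in> K \<Longrightarrow> 0 \<le> g x \<and> g x \<le> 1" for g
  proof (rule antisym)
    show "integral\<^sup>L riesz_measure g \<le> \<tau> g" by (rule integral_riesz_le[OF g g01])
    have "integral\<^sup>L riesz_measure (\<lambda>x. 1 - g x) \<le> \<tau> (\<lambda>x. 1 - g x)"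
      using g g01 by (intro integral_riesz_le continuous_intros) auto
    also have "\<tau> (\<lambda>x. 1 - g x) = \<tau> (\<lambda>x. 1) - \<tau> g" by (rule diff[OF continuous_on_const g])
    also have "integral\<^sup>L riesz_measure (\<lambda>x. 1 - g x) = integral\<^sup>L riesz_measure (\<lambda>x. 1) - integral\<^sup>L riesz_measure g"
      by (intro Bochner_Integration.integral_diff integrable_riesz g continuous_on_const)
    finally show "\<tau> g \<le> integral\<^sup>L riesz_measure g" using one by simp
  qed
  have "compact (f ` K)" by (rule compact_continuous_image[OF f compact_K])
  then obtain B0 where B0: "\<And>x. x \<in> K \<Longrightarrow> norm (f x) \<le> B0"
    using compact_imp_bounded bounded_iff by (metis image_eqI)
  define B where "B = max B0 1"
  have B: "0 < B" "\<And>x. x \<in> K \<Longrightarrow> \<bar>f x\<bar> \<le> B" using B0 by (auto simp: B_def le_max_iff_disj)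
  define g where "g x = 1/2 + 1/(2 * B) * f x" for x
  have g: "continuous_on K g" unfolding g_def by (intro continuous_intros f)
  have "0 \<le> g x \<and> g x \<le> 1" if "x \<in> K" for x
    using B(2)[OF that] B(1) by (auto simp: g_def field_simps abs_le_iff)
  then have "integral\<^sup>L riesz_measure g = \<tau> g" using unit g by blast
  moreover have "integral\<^sup>L riesz_measure g = 1/2 * integral\<^sup>L riesz_measure (\<lambda>x. 1) + 1/(2 * B) * integral\<^sup>L riesz_measure f"
    using integrable_riesz[OF f] by (simp add: g_def[abs_def])
  moreover have "\<tau> g = \<tau> (\<lambda>x. 1/2 * 1) + \<tau> (\<lambda>x. 1/(2 * B) * f x)"
    unfolding g_def[abs_def] mult_1_right
    by (intro add continuous_intros f)
  then have "\<tau> g = 1/2 * \<tau> (\<lambda>x. 1) + 1/(2 * B) * \<tau> f"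
    using scale[of "\<lambda>x. 1" "1/2"] scale[OF f, of "1/(2*B)"] by simp
  ultimately show ?thesis using one B by simp
qed

end


section \<open>Complex measures given by a density\<close>

text \<open>For \<mu> = g \<sigma> the variation is |g| \<sigma> and the polar density is the phase
  of g, so the suprema and choices in the definitions can be evaluated.\<close>

locale complex_density =
  fixes M \<sigma> :: "'a measure" and g :: "'a \<Rightarrow> complex" and \<mu> :: "'a set \<Rightarrow> complex"
  assumes sets_eq: "sets \<sigma> = sets M"
    and integrable_g: "integrable \<sigma> g"
    and \<mu>_eq: "\<mu> = (\<lambda>E. LINT x:E|\<sigma>. g x)"
begin

lemma space_eq: "space \<sigma> = space M"
  by (rule sets_eq_imp_space_eq[OF sets_eq])

lemma measurable_g: "g \<in> borel_measurable \<sigma>"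
  using integrable_g by (rule borel_measurable_integrable)

lemma set_integrable_g: "E \<in> sets M \<Longrightarrow> set_integrable \<sigma> E g"
  unfolding set_integrable_def
  using integrable_g by (intro integrable_mult_indicator) (auto simp: sets_eq)

lemma complex_measure: "complex_measure M \<mu>"
  unfolding complex_measure_def
proof (intro conjI allI impI)
  show "\<mu> {} = 0" by (simp add: \<mu>_eq set_lebesgue_integral_def)
  fix A :: "nat \<Rightarrow> 'a set" assume A: "range A \<subseteq> sets M" and disj: "disjoint_family A"
  have A_sets: "A n \<in> sets \<sigma>" for n using A sets_eq by auto
  have part: "(\<Sum>n<N. \<mu> (A n)) = (LINT x:(\<Union>n<N. A n)|\<sigma>. g x)" for N
    unfolding \<mu>_eq
    by (rule set_integral_finite_Union[symmetric])
      (use A disj set_integrable_g in \<open>auto simp: disjoint_family_on_def sets_eq\<close>)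
  have "(\<lambda>N. LINT x:(\<Union>n<N. A n)|\<sigma>. g x) \<longlonglongrightarrow> (LINT x:(\<Union>n. A n)|\<sigma>. g x)"
    unfolding set_lebesgue_integral_def
  proof (rule integral_dominated_convergence[where w = "\<lambda>x. norm (g x)"])
    show "AE x in \<sigma>. (\<lambda>N. indicat_real (\<Union>n<N. A n) x *\<^sub>R g x) \<longlonglongrightarrow> indicat_real (\<Union>n. A n) x *\<^sub>R g x"
    proof (intro AE_I2 tendsto_scaleR tendsto_const)
      fix x
      have "eventually (\<lambda>N. indicat_real (\<Union>n<N. A n) x = indicat_real (\<Union>n. A n) x) sequentially"
      proof (cases "x \<in> (\<Union>n. A n)")
        case True
        then obtain n where n: "x \<in> A n" by blast
        then have "indicat_real (\<Union>n<N. A n) x = indicat_real (\<Union>n. A n) x" if "Suc n \<le> N" for N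
          using that by (auto simp: indicator_def)
        then show ?thesis by (auto simp: eventually_sequentially)
      qed (auto simp: indicator_def)
      then show "(\<lambda>N. indicat_real (\<Union>n<N. A n) x) \<longlonglongrightarrow> indicat_real (\<Union>n. A n) x"
        by (rule tendsto_eventually)
    qed
  qed (use A_sets measurable_g integrable_g in \<open>auto simp: indicator_def\<close>)
  then show "(\<lambda>n. \<mu> (A n)) sums \<mu> (\<Union>n. A n)"
    unfolding sums_def part by (simp add: \<mu>_eq)
qed

abbreviation "V \<equiv> density \<sigma> (\<lambda>x. ennreal (norm (g x)))"

lemma emeasure_V:
  assumes E: "E \<in> sets M"
  shows "emeasure V E = ennreal (LINT x:E|\<sigma>. norm (g x))"
proof -
  have "emeasure V E = (\<integral>\<^sup>+x. ennreal (indicator E x *\<^sub>R norm (g x)) \<partial>\<sigma>)"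
    using E measurable_g sets_eq
    by (subst emeasure_density) (auto intro!: nn_integral_cong simp: indicator_def)
  also have "\<dots> = ennreal (LINT x|\<sigma>. indicator E x *\<^sub>R norm (g x))"
    using E integrable_g sets_eq by (intro nn_integral_eq_integral integrable_mult_indicator) auto
  finally show ?thesis by (simp add: set_lebesgue_integral_def)
qed

lemma norm_\<mu>_le:
  assumes E: "E \<in> sets M" shows "norm (\<mu> E) \<le> (LINT x:E|\<sigma>. norm (g x))"
proof -
  have "norm (\<mu> E) \<le> (LINT x|\<sigma>. norm (indicat_real E x *\<^sub>R g x))"
    unfolding \<mu>_eq set_lebesgue_integral_def by (rule integral_norm_bound)
  then show ?thesis by (simp add: set_lebesgue_integral_def)
qed

lemma variation_on_le:
  assumes E: "E \<in> sets M" shows "variation_on M \<mu> E \<le> emeasure V E"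
  unfolding variation_on_def
proof (rule SUP_least, clarify)
  fix P assume P: "finite P" "P \<subseteq> sets M" "disjoint P" and E: "E = \<Union>P"
  have "(\<Sum>A\<in>P. ennreal (cmod (\<mu> A))) \<le> (\<Sum>A\<in>P. emeasure V A)"
  proof (rule sum_mono)
    fix A assume "A \<in> P"
    then have "A \<in> sets M" using P by blast
    then show "ennreal (cmod (\<mu> A)) \<le> emeasure V A"
      using ennreal_leI[OF norm_\<mu>_le] by (simp only: emeasure_V)
  qed
  also have "\<dots> = emeasure V (\<Union>A\<in>P. A)"
    using P by (intro sum_emeasure) (auto simp: sets_eq disjoint_family_on_def disjoint_def)
  finally show "(\<Sum>A\<in>P. ennreal (cmod (\<mu> A))) \<le> emeasure V (\<Union>P)" by simp
qed

text \<open>For the reverse inequality \<open>E\<close> is partitioned by the level sets of a simple function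
  approximating the density.\<close>

lemma variation_on_ge_approx:
  assumes E: "E \<in> sets M" and s: "simple_function \<sigma> s" and int_s: "integrable \<sigma> s"
  shows "ennreal ((LINT x:E|\<sigma>. norm (g x)) - 2 * (LINT x|\<sigma>. norm (g x - s x))) \<le> variation_on M \<mu> E"
proof -
  define L where "L v = E \<inter> (s -` {v} \<inter> space \<sigma>)" for v
  have fin: "finite (s ` space \<sigma>)" using s by (rule simple_functionD)
  have L_sets: "L v \<in> sets M" for v
    using E simple_functionD(2)[OF s] by (auto simp: L_def sets_eq)
  have E_eq: "E = (\<Union>v\<in>s ` space \<sigma>. L v)"
    using sets.sets_into_space[OF E] by (auto simp: L_def space_eq)
  have L_disj: "disjoint_family_on L (s ` space \<sigma>)" by (auto simp: disjoint_family_on_def L_def)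
  let ?d = "\<lambda>x. norm (g x - s x)"
  have int_d: "integrable \<sigma> ?d" using integrable_g int_s by auto
  have set_int: "set_integrable \<sigma> A f" if "integrable \<sigma> f" "A \<in> sets M"
    for A and f :: "'a \<Rightarrow> 'b::{banach,second_countable_topology}"
    unfolding set_integrable_def using that by (intro integrable_mult_indicator) (auto simp: sets_eq)
  have split: "(LINT x:E|\<sigma>. f x) = (\<Sum>v\<in>s ` space \<sigma>. LINT x:L v|\<sigma>. f x)"
    if f: "integrable \<sigma> f" for f :: "'a \<Rightarrow> real"
    unfolding E_eq
    by (rule set_integral_finite_Union[OF fin L_disj]) (use f set_int L_sets in \<open>auto simp: sets_eq\<close>)
  \<comment> \<open>Passing from |g| to |s| costs one integral of |g - s|, and passing from the
    integral of s to that of g costs another, whence the factor 2. In between, s is constant on the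
    level set, so its integral has modulus equal to the integral of |s|.\<close>
  have level: "(LINT x:L v|\<sigma>. norm (g x)) - 2 * (LINT x:L v|\<sigma>. ?d x) \<le> norm (\<mu> (L v))" for v
  proof -
    have "(LINT x:L v|\<sigma>. norm (s x)) \<le> norm (LINT x:L v|\<sigma>. s x)"
    proof -
      \<comment> \<open>Applied with h = norm and h = id. The case v = 0 is apart because that level
        set may have infinite measure; there \<open>h 0 = 0\<close> settles it.\<close>
      have const: "(LINT x:L v|\<sigma>. h (s x)) = (LINT x:L v|\<sigma>. 1) *\<^sub>R h v"
        if "h 0 = 0" for h :: "complex \<Rightarrow> 'c::{banach,second_countable_topology}"
      proof (cases "v = 0")
        case True
        then have "(LINT x:L v|\<sigma>. h (s x)) = (LINT x:L v|\<sigma>. 0)"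
          using that by (intro set_lebesgue_integral_cong) (use L_sets sets_eq in \<open>auto simp: L_def\<close>)
        then show ?thesis using True that by (simp add: set_lebesgue_integral_def)
      next
        case False
        have "(LINT x:L v|\<sigma>. h (s x)) = (LINT x|\<sigma>. indicator (L v) x *\<^sub>R h v)"
          unfolding set_lebesgue_integral_def
          by (intro Bochner_Integration.integral_cong) (auto simp: L_def indicator_def)
        also have "\<dots> = measure \<sigma> (L v) *\<^sub>R h v"
        proof -
          have "integrable \<sigma> (indicat_real (L v))"
          proof (rule Bochner_Integration.integrable_bound)
            show "integrable \<sigma> (\<lambda>x. norm (s x) / norm v)" using int_s by auto
            show "indicat_real (L v) \<in> borel_measurable \<sigma>" using L_sets sets_eq by auto
          qed (use False in \<open>auto simp: L_def indicator_def\<close>)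
          then show ?thesis using L_sets sets_eq
            by (subst integral_scaleR_left) (auto simp: L_def Int_absorb1 Int_absorb2 sets.sets_into_space Int_commute)
        qed
        finally show ?thesis using L_sets sets_eq
          by (simp add: set_lebesgue_integral_def L_def Int_absorb1 Int_absorb2 Int_commute)
      qed
      have "0 \<le> (LINT x:L v|\<sigma>. (1::real))" by (simp add: set_lebesgue_integral_def)
      then show ?thesis using const[of norm] const[of id] by simp
    qed
    moreover have "(LINT x:L v|\<sigma>. norm (g x)) \<le> (LINT x:L v|\<sigma>. norm (s x) + ?d x)"
      using L_sets integrable_g int_s int_d
      by (intro set_integral_mono set_int) (auto simp: norm_triangle_sub)
    moreover have "(LINT x:L v|\<sigma>. norm (s x) + ?d x) = (LINT x:L v|\<sigma>. norm (s x)) + (LINT x:L v|\<sigma>. ?d x)"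
      using L_sets int_s int_d by (intro set_integral_add(2) set_int) auto
    moreover have "norm (LINT x:L v|\<sigma>. s x) - norm (\<mu> (L v)) \<le> (LINT x:L v|\<sigma>. ?d x)"
    proof -
      have "norm (LINT x:L v|\<sigma>. s x) - norm (\<mu> (L v)) \<le> norm ((LINT x:L v|\<sigma>. g x) - (LINT x:L v|\<sigma>. s x))"
        unfolding \<mu>_eq using norm_triangle_ineq2[of "LINT x:L v|\<sigma>. s x" "LINT x:L v|\<sigma>. g x"]
        by (simp add: norm_minus_commute)
      also have "(LINT x:L v|\<sigma>. g x) - (LINT x:L v|\<sigma>. s x) = (LINT x:L v|\<sigma>. g x - s x)"
        using L_sets integrable_g int_s by (intro set_integral_diff(2)[symmetric] set_int)
      also have "norm \<dots> \<le> (LINT x|\<sigma>. norm (indicat_real (L v) x *\<^sub>R (g x - s x)))"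
        unfolding set_lebesgue_integral_def by (rule integral_norm_bound)
      also have "\<dots> = (LINT x:L v|\<sigma>. ?d x)" by (simp add: set_lebesgue_integral_def)
      finally show ?thesis .
    qed
    ultimately show ?thesis by linarith
  qed
  have d_le: "(LINT x:E|\<sigma>. ?d x) \<le> (LINT x|\<sigma>. ?d x)"
    unfolding set_lebesgue_integral_def
    using E sets_eq int_d by (intro integral_mono integrable_mult_indicator) (auto simp: indicator_def)
  have "(LINT x:E|\<sigma>. norm (g x)) - 2 * (LINT x|\<sigma>. ?d x)
      \<le> (LINT x:E|\<sigma>. norm (g x)) - 2 * (LINT x:E|\<sigma>. ?d x)" using d_le by simp
  also have "\<dots> = (\<Sum>v\<in>s ` space \<sigma>. (LINT x:L v|\<sigma>. norm (g x)) - 2 * (LINT x:L v|\<sigma>. ?d x))"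
    using split[OF integrable_norm[OF integrable_g]] split[OF int_d]
    by (simp add: sum_subtractf sum_distrib_left)
  also have "\<dots> \<le> (\<Sum>v\<in>s ` space \<sigma>. norm (\<mu> (L v)))" by (intro sum_mono level)
  also have "\<dots> = (\<Sum>A\<in>L ` s ` space \<sigma>. norm (\<mu> A))"
  proof (rule sum.reindex_nontrivial[symmetric, unfolded comp_def, OF fin])
    \<comment> \<open>Two values can share a level set only if it is empty, and then its term is
      0.\<close>
    fix v w assume "v \<noteq> w" "L v = L w"
    then have "L v = {}" by (auto simp: L_def)
    then show "cmod (\<mu> (L v)) = 0" by (simp add: \<mu>_eq set_lebesgue_integral_def)
  qed
  finally have "ennreal ((LINT x:E|\<sigma>. norm (g x)) - 2 * (LINT x|\<sigma>. ?d x))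
      \<le> ennreal (\<Sum>A\<in>L ` s ` space \<sigma>. norm (\<mu> A))" by (rule ennreal_leI)
  also have "\<dots> = (\<Sum>A\<in>L ` s ` space \<sigma>. ennreal (norm (\<mu> A)))" by (simp add: sum_ennreal)
  also have "\<dots> \<le> variation_on M \<mu> E"
    unfolding variation_on_def
  proof (rule SUP_upper, intro CollectI conjI)
    show "finite (L ` s ` space \<sigma>)" using fin by simp
    show "L ` s ` space \<sigma> \<subseteq> sets M" using L_sets by auto
    show "disjoint (L ` s ` space \<sigma>)" using L_disj by (rule disjoint_family_on_disjoint_image)
    show "\<Union> (L ` s ` space \<sigma>) = E" using E_eq by simp
  qed
  finally show ?thesis .
qed

text \<open>Simple functions dominated by 2 |g| converge to g in mean, so the error term of
  \<open>variation_on_ge_approx\<close> tends to 0.\<close>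

lemma variation_on_eq:
  assumes E: "E \<in> sets M" shows "variation_on M \<mu> E = emeasure V E"
proof (rule antisym[OF variation_on_le[OF E]])
  obtain F where F: "\<And>i. simple_function \<sigma> (F i)"
    and F_lim: "\<And>x. x \<in> space \<sigma> \<Longrightarrow> (\<lambda>i. F i x) \<longlonglongrightarrow> g x"
    and F_dist: "\<And>i x. x \<in> space \<sigma> \<Longrightarrow> dist (F i x) 0 \<le> 2 * dist (g x) 0"
    using borel_measurable_implies_sequence_metric[OF measurable_g, of 0] by blast
  have F_meas: "F i \<in> borel_measurable \<sigma>" for i by (rule borel_measurable_simple_function[OF F])
  have F_int: "integrable \<sigma> (F i)" for i
  proof (rule Bochner_Integration.integrable_bound[OF _ F_meas])
    show "integrable \<sigma> (\<lambda>x. 2 * norm (g x))" using integrable_g by auto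
  qed (use F_dist in auto)
  have lim0: "(\<lambda>i. LINT x|\<sigma>. norm (g x - F i x)) \<longlonglongrightarrow> (LINT x|\<sigma>. 0)"
  proof (rule integral_dominated_convergence[where w = "\<lambda>x. 3 * norm (g x)"])
    show "AE x in \<sigma>. (\<lambda>i. norm (g x - F i x)) \<longlonglongrightarrow> 0"
      using F_lim by (intro AE_I2 tendsto_norm_zero) (auto intro!: tendsto_eq_intros)
    show "AE x in \<sigma>. norm (norm (g x - F i x)) \<le> 3 * norm (g x)" for i
    proof (rule AE_I2)
      fix x assume "x \<in> space \<sigma>"
      then show "norm (norm (g x - F i x)) \<le> 3 * norm (g x)"
        using F_dist[of x i] norm_triangle_ineq4[of "g x" "F i x"] by simp
    qed
  qed (use measurable_g F_meas integrable_g in auto)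
  let ?a = "LINT x:E|\<sigma>. norm (g x)"
  have "(\<lambda>i. ?a - 2 * (LINT x|\<sigma>. norm (g x - F i x))) \<longlonglongrightarrow> ?a - 2 * 0"
    using lim0 by (intro tendsto_intros) simp
  then have "(\<lambda>i. ennreal (?a - 2 * (LINT x|\<sigma>. norm (g x - F i x)))) \<longlonglongrightarrow> ennreal ?a"
    using tendsto_ennrealI by fastforce
  then have "ennreal ?a \<le> variation_on M \<mu> E"
    by (rule tendsto_upperbound) (use variation_on_ge_approx[OF E F F_int] in auto)
  then show "emeasure V E \<le> variation_on M \<mu> E" using emeasure_V[OF E] by simp
qed

lemma sets_V: "sets V = sets M" and space_V: "space V = space M"
  by (simp_all add: sets_eq space_eq)

lemma variation_eq: "variation M \<mu> = V"
proof -
  have "variation M \<mu> = measure_of (space V) (sets V) (emeasure V)"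
    unfolding variation_def sets_V space_V
    by (rule measure_of_eq) (auto simp: sets.space_closed variation_on_eq sets.sigma_sets_eq)
  then show ?thesis by (simp only: measure_of_of_measure)
qed

lemma finite_V: "finite_measure V"
  using emeasure_V[of "space M"] by (intro finite_measureI) (simp add: space_eq)

lemma total_variation_norm_eq: "total_variation_norm M \<mu> = (LINT x|\<sigma>. norm (g x))"
proof -
  have "(LINT x:space M|\<sigma>. norm (g x)) = (LINT x|\<sigma>. norm (g x))"
    unfolding set_lebesgue_integral_def space_eq[symmetric]
    by (intro Bochner_Integration.integral_cong) auto
  then show ?thesis
    using emeasure_V[of "space M"]
    by (simp add: total_variation_norm_def variation_eq measure_def set_integral_space)
qed

text \<open>The value 1 at the zeros of g keeps the modulus equal to 1 everywhere; these zeros form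
  a null set for V.\<close>

definition phase :: "'a \<Rightarrow> complex" where
  "phase x = (if g x = 0 then 1 else sgn (g x))"

lemma measurable_phase: "phase \<in> borel_measurable \<sigma>"
  unfolding phase_def[abs_def] sgn_div_norm using measurable_g by measurable

lemma integral_phase:
  assumes E: "E \<in> sets M" shows "(LINT x:E|V. phase x) = \<mu> E"
proof -
  have "(LINT x:E|V. phase x) = (LINT x|\<sigma>. norm (g x) *\<^sub>R (indicat_real E x *\<^sub>R phase x))"
    unfolding set_lebesgue_integral_def using E sets_eq measurable_g measurable_phase
    by (intro integral_density) auto
  also have "\<dots> = \<mu> E"
    unfolding \<mu>_eq set_lebesgue_integral_def
    by (intro Bochner_Integration.integral_cong) (auto simp: phase_def indicator_def sgn_div_norm)
  finally show ?thesis .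
qed

lemma polar_density:
  shows "polar_density M \<mu> \<in> borel_measurable M"
    and "x \<in> space M \<Longrightarrow> norm (polar_density M \<mu> x) = 1"
    and "E \<in> sets M \<Longrightarrow> \<mu> E = (LINT x:E|V. polar_density M \<mu> x)"
proof -
  have "\<exists>h. h \<in> borel_measurable M \<and> (\<forall>x\<in>space M. cmod (h x) = 1) \<and>
     (\<forall>E\<in>sets M. \<mu> E = (LINT x:E|variation M \<mu>. h x))"
    using measurable_phase integral_phase
    by (intro exI[of _ phase])
      (auto simp: phase_def norm_sgn variation_eq measurable_cong_sets[OF sets_eq refl])
  from someI_ex[OF this] show "polar_density M \<mu> \<in> borel_measurable M"
    and "x \<in> space M \<Longrightarrow> norm (polar_density M \<mu> x) = 1"
    and "E \<in> sets M \<Longrightarrow> \<mu> E = (LINT x:E|V. polar_density M \<mu> x)"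
    unfolding polar_density_def[symmetric] by (auto simp: variation_eq)
qed

text \<open>The density picked by \<open>polar_density\<close> may differ from \<open>phase\<close>,
  but both integrate to \<mu> over every measurable set, which determines them almost everywhere for
  V.\<close>

lemma polar_density_AE: "AE x in V. norm (g x) *\<^sub>R polar_density M \<mu> x = g x"
proof -
  interpret V: finite_measure V by (rule finite_V)
  have "AE x in V. polar_density M \<mu> x = phase x"
  proof (rule V.density_unique_banach)
    show "integrable V (polar_density M \<mu>)"
      using polar_density(1,2)
      by (intro V.integrable_const_bound[of _ 1]) (auto simp: measurable_cong_sets[OF sets_V refl] space_eq)
    show "integrable V phase"
      using measurable_phase by (intro V.integrable_const_bound[of _ 1]) (auto simp: phase_def norm_sgn)
    fix E assume "E \<in> sets V"
    then have E: "E \<in> sets M" by (simp add: sets_eq)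
    show "(LINT x:E|V. polar_density M \<mu> x) = (LINT x:E|V. phase x)"
      using polar_density(3)[OF E] integral_phase[OF E] by simp
  qed
  then show ?thesis by eventually_elim (auto simp: phase_def sgn_div_norm)
qed

lemma complex_integral_eq:
  assumes E: "E \<in> sets M" and b: "b \<in> borel_measurable M"
  shows "complex_integral M \<mu> E b = (LINT x:E|\<sigma>. b x * g x)"
proof -
  let ?p = "polar_density M \<mu>"
  have b': "b \<in> borel_measurable \<sigma>" and p': "?p \<in> borel_measurable \<sigma>"
    using b polar_density(1) by (simp_all add: measurable_cong_sets[OF sets_eq refl])
  have "complex_integral M \<mu> E b = (LINT x|\<sigma>. norm (g x) *\<^sub>R (indicat_real E x *\<^sub>R (b x * ?p x)))"
    unfolding complex_integral_def variation_eq set_lebesgue_integral_def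
    using E sets_eq measurable_g b' p' by (intro integral_density) auto
  also have "\<dots> = (LINT x|\<sigma>. indicat_real E x *\<^sub>R (b x * g x))"
  proof (rule integral_cong_AE)
    \<comment> \<open>V does not see the points where g vanishes, but there both sides are
      0.\<close>
    have "AE x in \<sigma>. norm (g x) *\<^sub>R ?p x = g x"
      using polar_density_AE measurable_g by (subst (asm) AE_density) auto
    then show "AE x in \<sigma>. norm (g x) *\<^sub>R (indicat_real E x *\<^sub>R (b x * ?p x)) = indicat_real E x *\<^sub>R (b x * g x)"
      by eventually_elim (auto simp: indicator_def scaleR_conv_of_real mult.left_commute)
  qed (use E sets_eq measurable_g b' p' in auto)
  finally show ?thesis by (simp add: set_lebesgue_integral_def)
qed

end


section \<open>Compact convex sets embedded in a countable product\<close>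

text \<open>Midpoints replace segments because concavity of t is a midpoint condition, and because
  the non-extreme points become values of a continuous map. The proof uses that a point inside a
  segment is the centre of a shorter one.\<close>

lemma extreme_points_midpoint:
  assumes "convex X"
  shows "extreme_points X = {x \<in> X. \<forall>y\<in>X. \<forall>z\<in>X. x = midpoint y z \<longrightarrow> y = z}"
proof (intro equalityI subsetI)
  fix x assume x: "x \<in> extreme_points X"
  then have xX: "x \<in> X" by (simp add: extreme_points_def extreme_point_of_def)
  moreover have "y = z" if "y \<in> X" "z \<in> X" "x = midpoint y z" for y z
  proof (rule ccontr)
    assume "y \<noteq> z"
    moreover have "midpoint y z = (1 - 1/2) *\<^sub>R y + (1/2) *\<^sub>R z"
      by (simp add: midpoint_def scaleR_add_right)
    ultimately have "x \<in> open_segment y z"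
      unfolding in_segment using that(3) by (intro conjI exI[of _ "1/2"]) auto
    then show False using x that(1,2) unfolding extreme_points_def extreme_point_of_def by blast
  qed
  ultimately show "x \<in> {x \<in> X. \<forall>y\<in>X. \<forall>z\<in>X. x = midpoint y z \<longrightarrow> y = z}" by blast
next
  fix x assume x: "x \<in> {x \<in> X. \<forall>y\<in>X. \<forall>z\<in>X. x = midpoint y z \<longrightarrow> y = z}"
  have "x \<notin> open_segment a b" if ab: "a \<in> X" "b \<in> X" for a b
  proof
    assume "x \<in> open_segment a b"
    then obtain u where u: "a \<noteq> b" "0 < u" "u < 1" "x = (1 - u) *\<^sub>R a + u *\<^sub>R b"
      unfolding in_segment by blast
    \<comment> \<open>The largest radius for which the interval around u stays in [0, 1].\<close>
    define r where "r = min u (1 - u)"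
    have r: "0 < r" "r \<le> u" "r \<le> 1 - u" using u by (auto simp: r_def)
    let ?y = "(1 - (u - r)) *\<^sub>R a + (u - r) *\<^sub>R b" and ?z = "(1 - (u + r)) *\<^sub>R a + (u + r) *\<^sub>R b"
    have "?y \<in> X" "?z \<in> X"
      using \<open>convex X\<close> ab r u by (auto intro!: convexD)
    moreover have "x = midpoint ?y ?z"
    proof -
      have "?y + ?z = ((1 - (u - r)) + (1 - (u + r))) *\<^sub>R a + ((u - r) + (u + r)) *\<^sub>R b"
        unfolding scaleR_left_distrib by (simp only: add_ac)
      also have "(1 - (u - r)) + (1 - (u + r)) = 2 * (1 - u)" by simp
      also have "(u - r) + (u + r) = 2 * u" by simp
      also have "(2 * (1 - u)) *\<^sub>R a + (2 * u) *\<^sub>R b = 2 *\<^sub>R x"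
        unfolding u(4) scaleR_right_distrib scaleR_scaleR ..
      finally have "?y + ?z = 2 *\<^sub>R x" .
      then show ?thesis by (simp add: midpoint_def)
    qed
    ultimately have "?y = ?z" using x by blast
    then have "r *\<^sub>R a + r *\<^sub>R a = r *\<^sub>R b + r *\<^sub>R b" by (simp add: algebra_simps)
    then have "(r + r) *\<^sub>R a = (r + r) *\<^sub>R b" by (simp only: scaleR_left_distrib)
    then show False using u r by simp
  qed
  then show "x \<in> extreme_points X" using x by (simp add: extreme_points_def extreme_point_of_def)
qed

text \<open>As X is compact, the continuous injection j is a homeomorphism onto a compact subset of
  a Polish space. Continuity of the midpoint map, \<open>mid_cont\<close>, serves to show that the
  extreme points are a Borel set.\<close>

locale compact_convex_coordinates =
  fixes X :: "'a::{topological_space, real_vector} set" and j :: "'a \<Rightarrow> nat \<Rightarrow> complex"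
  assumes compact_X: "compact X" and convex_X: "convex X"
    and j_cont: "continuous_on X j" and j_inj: "inj_on j X"
    and j_mid: "\<And>x y n. x \<in> X \<Longrightarrow> y \<in> X \<Longrightarrow> j (midpoint x y) n = (j x n + j y n) / 2"
    and j_bound: "\<And>x n. x \<in> X \<Longrightarrow> norm (j x n) \<le> 1"
    and mid_cont: "continuous_on (X \<times> X) (\<lambda>(x, y). midpoint x y)"
begin

lemma midpoint_mem: "x \<in> X \<Longrightarrow> y \<in> X \<Longrightarrow> midpoint x y \<in> X"
  using convexD[OF convex_X, of x y "1/2" "1/2"] by (simp add: midpoint_def scaleR_add_right)

lemma compact_closedin: "closedin (top_of_set X) C \<Longrightarrow> compact C"
  using compact_X by (rule closedin_compact)

lemma closed_j_image: "closedin (top_of_set X) C \<Longrightarrow> closed (j ` C)"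
  by (meson closedin_imp_subset compact_closedin compact_continuous_image compact_imp_closed
      continuous_on_subset j_cont)

lemma openin_eq_vimage:
  assumes "openin (top_of_set X) U"
  shows "\<exists>V. open V \<and> U = X \<inter> j -` V"
proof (intro exI conjI)
  have U: "U \<subseteq> X" using assms by (rule openin_imp_subset)
  have "closedin (top_of_set X) (X - U)" using assms by (simp add: closedin_diff)
  then show "open (- (j ` (X - U)))" using closed_j_image by blast
  show "U = X \<inter> j -` (- (j ` (X - U)))"
    using U j_inj by (auto simp: inj_on_def)
qed

lemma vimage_openin: "open V \<Longrightarrow> openin (top_of_set X) (X \<inter> j -` V)"
  using j_cont by (simp add: continuous_openin_preimage_gen)

lemma space_borel_on: "space (borel_on S) = S"
  by (simp add: borel_on_def space_restrict_space)

text \<open>Relatively open sets are preimages of open sets under the homeomorphism j. So the Borel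
  sets of X are countably generated even when the ambient topology has no countable base.\<close>

lemma borel_on_eq_vimage: "sets (borel_on X) = sets (vimage_algebra X j borel)"
proof (rule antisym)
  have "X \<inter> V \<in> sets (vimage_algebra X j borel)" if "open V" for V
  proof -
    have "openin (top_of_set X) (X \<inter> V)" using that by (rule openin_open_Int)
    then obtain W where "open W" "X \<inter> V = X \<inter> j -` W" using openin_eq_vimage by blast
    then show ?thesis
      using in_vimage_algebra[of W borel j X] by (simp add: Int_commute)
  qed
  then show "sets (borel_on X) \<subseteq> sets (vimage_algebra X j borel)"
  proof -
    assume opens: "\<And>V. open V \<Longrightarrow> X \<inter> V \<in> sets (vimage_algebra X j borel)"
    have "(\<lambda>x. x) \<in> borel_measurable (vimage_algebra X j borel)"
      using opens by (intro borel_measurableI) (simp add: Int_commute)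
    from measurable_sets[OF this]
    have "X \<inter> A \<in> sets (vimage_algebra X j borel)" if "A \<in> sets borel" for A
      using that by (simp add: Int_commute)
    then show ?thesis unfolding borel_on_def sets_restrict_space by blast
  qed
  have "j \<in> borel_measurable (borel_on X)"
    unfolding borel_on_def by (rule borel_measurable_continuous_on_restrict[OF j_cont])
  then show "sets (vimage_algebra X j borel) \<subseteq> sets (borel_on X)"
    by (rule sets_image_in_sets[OF space_borel_on])
qed

text \<open>For the Riesz measure only continuous functions are known to be measurable. Through
  countably many coordinates this is enough to make the projection to X measurable.\<close>

lemma measurable_borel_on:
  assumes "f \<in> space N \<rightarrow> X" and "\<And>n. (\<lambda>x. j (f x) n) \<in> borel_measurable N"
  shows "f \<in> measurable N (borel_on X)"
proof -
  have "(\<lambda>x. j (f x)) \<in> borel_measurable N"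
    using assms(2) by (rule measurable_coordinatewise_then_product)
  from measurable_vimage_algebra2[OF assms(1) this] show ?thesis
    by (simp add: measurable_cong_sets[OF refl borel_on_eq_vimage])
qed

lemma borel_on_cases:
  assumes "E \<in> sets (borel_on X)"
  obtains D where "D \<in> sets borel" "E = X \<inter> j -` D"
proof -
  have "j \<in> X \<rightarrow> space borel" by simp
  from assms sets_vimage_algebra2[OF this] show ?thesis
    using that by (auto simp: borel_on_eq_vimage)
qed

lemma vimage_borel: "D \<in> sets borel \<Longrightarrow> X \<inter> j -` D \<in> sets (borel_on X)"
  using in_vimage_algebra[of D borel j X] by (simp add: borel_on_eq_vimage Int_commute)

lemma openin_sets: "openin (top_of_set X) U \<Longrightarrow> U \<in> sets (borel_on X)"
  using openin_eq_vimage vimage_borel by (metis borel_open)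

lemma compact_sets:
  assumes "compact C" "C \<subseteq> X" shows "C \<in> sets (borel_on X)"
proof -
  have "closed (j ` C)"
    using assms by (meson compact_continuous_image compact_imp_closed continuous_on_subset j_cont)
  moreover have "C = X \<inter> j -` (j ` C)" using assms(2) j_inj by (auto simp: inj_on_def)
  ultimately show ?thesis using vimage_borel[of "j ` C"] by (metis borel_closed)
qed

lemma compact_vimage:
  assumes "compact C" shows "compact (X \<inter> j -` C)"
proof -
  have "closedin (top_of_set X) (X \<inter> j -` C)"
    using j_cont compact_imp_closed[OF assms] by (simp add: continuous_closedin_preimage)
  then show ?thesis by (rule compact_closedin)
qed

text \<open>Finite Borel measures on the Polish space \<open>nat \<Rightarrow> complex\<close> are
  regular. This carries over to X because preimages of compact and open sets under j are compact and
  relatively open.\<close>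

lemma regular:
  assumes fin: "finite_measure N" and sets_N: "sets N = sets (borel_on X)"
    and E: "E \<in> sets (borel_on X)"
  shows "emeasure N E = (SUP K \<in> {K. K \<subseteq> E \<and> compact K}. emeasure N K)"
    and "emeasure N E = (INF U \<in> {U. E \<subseteq> U \<and> openin (top_of_set X) U}. emeasure N U)"
proof -
  interpret N: finite_measure N by fact
  have space_N: "space N = X" using sets_eq_imp_space_eq[OF sets_N] by (simp add: space_borel_on)
  obtain D where D: "D \<in> sets borel" "E = X \<inter> j -` D" using borel_on_cases[OF E] .
  have j_meas: "j \<in> borel_measurable N"
    unfolding measurable_cong_sets[OF sets_N refl] borel_on_def
    by (rule borel_measurable_continuous_on_restrict[OF j_cont])
  let ?P = "distr N borel j"
  have P: "emeasure ?P A = emeasure N (X \<inter> j -` A)" if "A \<in> sets borel" for A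
    using emeasure_distr[OF j_meas that] by (simp add: space_N Int_commute)
  have top: "emeasure ?P (space ?P) \<noteq> \<infinity>" using P[of UNIV] by (simp add: N.emeasure_finite)
  show "emeasure N E = (SUP K \<in> {K. K \<subseteq> E \<and> compact K}. emeasure N K)"
  proof (rule antisym)
    have "emeasure N E = emeasure ?P D" using P[OF D(1)] D(2) by simp
    also have "\<dots> = (SUP K \<in> {K. K \<subseteq> D \<and> compact K}. emeasure ?P K)"
      by (rule inner_regular[OF _ top D(1)]) simp
    also have "\<dots> \<le> (SUP K \<in> {K. K \<subseteq> E \<and> compact K}. emeasure N K)"
    proof (rule SUP_mono)
      fix K assume K: "K \<in> {K. K \<subseteq> D \<and> compact K}"
      then have "X \<inter> j -` K \<in> {K. K \<subseteq> E \<and> compact K}" using D(2) compact_vimage by auto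
      moreover have "emeasure ?P K = emeasure N (X \<inter> j -` K)"
        using K by (intro P borel_closed compact_imp_closed) auto
      ultimately show "\<exists>K'\<in>{K. K \<subseteq> E \<and> compact K}. emeasure ?P K \<le> emeasure N K'"
        by (intro bexI[of _ "X \<inter> j -` K"]) simp_all
    qed
    finally show "emeasure N E \<le> (SUP K \<in> {K. K \<subseteq> E \<and> compact K}. emeasure N K)" .
    show "(SUP K \<in> {K. K \<subseteq> E \<and> compact K}. emeasure N K) \<le> emeasure N E"
      using E sets_N by (intro SUP_least emeasure_mono) auto
  qed
  show "emeasure N E = (INF U \<in> {U. E \<subseteq> U \<and> openin (top_of_set X) U}. emeasure N U)"
  proof (rule antisym)
    show "emeasure N E \<le> (INF U \<in> {U. E \<subseteq> U \<and> openin (top_of_set X) U}. emeasure N U)"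
      using openin_sets sets_N by (intro INF_greatest emeasure_mono) auto
    have "(INF U \<in> {U. E \<subseteq> U \<and> openin (top_of_set X) U}. emeasure N U)
        \<le> (INF U \<in> {U. D \<subseteq> U \<and> open U}. emeasure ?P U)"
    proof (rule INF_mono)
      fix U assume U: "U \<in> {U. D \<subseteq> U \<and> open U}"
      then have "X \<inter> j -` U \<in> {U. E \<subseteq> U \<and> openin (top_of_set X) U}"
        using D(2) vimage_openin by auto
      moreover have "emeasure ?P U = emeasure N (X \<inter> j -` U)" using U by (intro P borel_open) auto
      ultimately show "\<exists>U'\<in>{U. E \<subseteq> U \<and> openin (top_of_set X) U}. emeasure N U' \<le> emeasure ?P U"
        by (intro bexI[of _ "X \<inter> j -` U"]) simp_all
    qed
    also have "\<dots> = emeasure ?P D" by (rule outer_regular[OF _ top D(1), symmetric]) simp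
    also have "\<dots> = emeasure N E" using P[OF D(1)] D(2) by simp
    finally show "(INF U \<in> {U. E \<subseteq> U \<and> openin (top_of_set X) U}. emeasure N U) \<le> emeasure N E" .
  qed
qed

text \<open>The midpoints of pairs whose images under j are at distance at least 1 / (n + 1) form a
  compact set, a continuous image of one. The non-extreme points are the union of these sets over
  n.\<close>

lemma extreme_points_sets: "extreme_points X \<in> sets (borel_on X)"
proof -
  define C where "C n = {p \<in> X \<times> X. 1 / real (Suc n) \<le> dist (j (fst p)) (j (snd p))}" for n
  have j1: "continuous_on (X \<times> X) (\<lambda>p. j (fst p))" "continuous_on (X \<times> X) (\<lambda>p. j (snd p))"
    by (rule continuous_on_compose2[OF j_cont]; auto intro!: continuous_intros)+
  have "compact (C n)" for n
  proof -
    have "closedin (top_of_set (X \<times> X)) ((X \<times> X) \<inter> (\<lambda>p. dist (j (fst p)) (j (snd p))) -` {1 / real (Suc n)..})"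
      by (intro continuous_closedin_preimage continuous_on_dist j1 closed_atLeast)
    moreover have "(X \<times> X) \<inter> (\<lambda>p. dist (j (fst p)) (j (snd p))) -` {1 / real (Suc n)..} = C n"
      by (auto simp: C_def)
    ultimately show ?thesis using closedin_compact[OF compact_Times[OF compact_X compact_X]] by simp
  qed
  then have "compact ((\<lambda>(x, y). midpoint x y) ` C n)" for n
    by (rule compact_continuous_image[rotated]) (auto simp: C_def intro: continuous_on_subset[OF mid_cont])
  then have mid_sets: "(\<lambda>(x, y). midpoint x y) ` C n \<in> sets (borel_on X)" for n
    by (rule compact_sets) (auto simp: C_def midpoint_mem)
  have "extreme_points X = X - (\<Union>n. (\<lambda>(x, y). midpoint x y) ` C n)"
  proof (intro equalityI subsetI)
    fix x assume x: "x \<in> extreme_points X"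
    then have "x \<in> X" and uniq: "\<And>y z. y \<in> X \<Longrightarrow> z \<in> X \<Longrightarrow> x = midpoint y z \<Longrightarrow> y = z"
      by (auto simp: extreme_points_midpoint[OF convex_X])
    then show "x \<in> X - (\<Union>n. (\<lambda>(x, y). midpoint x y) ` C n)"
      by (fastforce simp: C_def)
  next
    fix x assume x: "x \<in> X - (\<Union>n. (\<lambda>(x, y). midpoint x y) ` C n)"
    have "y = z" if yz: "y \<in> X" "z \<in> X" "x = midpoint y z" for y z
    proof (rule ccontr)
      assume "y \<noteq> z"
      then have "0 < dist (j y) (j z)" using j_inj yz by (auto simp: inj_on_def)
      then obtain n where "1 / real (Suc n) < dist (j y) (j z)" using nat_approx_posE by blast
      then have "(y, z) \<in> C n" using yz by (simp add: C_def)
      then show False using x yz(3) by force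
    qed
    then show "x \<in> extreme_points X" using x by (auto simp: extreme_points_midpoint[OF convex_X])
  qed
  moreover have "X \<in> sets (borel_on X)" using sets.top[of "borel_on X"] by (simp add: space_borel_on)
  ultimately show ?thesis using mid_sets by auto
qed

text \<open>The strictly convex function of Choquet theory on metrizable compact convex sets. The
  weights make the series converge uniformly, as |j x n| <= 1.\<close>

definition w :: "'a \<Rightarrow> real" where
  "w x = (\<Sum>n. (1/2)^n * (norm (j x n))\<^sup>2)"

lemma w_bound: "x \<in> X \<Longrightarrow> norm ((1/2)^n * (norm (j x n))\<^sup>2) \<le> (1/2)^n"
  using j_bound[of x n] by (simp add: abs_mult power_le_one mult_left_le)

lemma w_summable: "x \<in> X \<Longrightarrow> summable (\<lambda>n. (1/2)^n * (norm (j x n))\<^sup>2)"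
  by (rule summable_comparison_test'[of "\<lambda>n. (1/2)^n" 0]) (use w_bound in \<open>auto intro: summable_geometric\<close>)

lemma w_cont: "continuous_on X w"
proof -
  have "uniform_limit X (\<lambda>n x. \<Sum>i<n. (1/2)^i * (norm (j x i))\<^sup>2) w sequentially"
    unfolding w_def using w_bound by (intro Weierstrass_m_test[where M = "\<lambda>n. (1/2)^n"]) (auto intro: summable_geometric)
  then show ?thesis
    by (rule uniform_limit_theorem[rotated])
      (auto intro!: always_eventually continuous_intros continuous_on_product_then_coordinatewise[OF j_cont])
qed

text \<open>By the parallelogram identity the gap is the sum of the terms 2^-n |j x n - j y n|^2 /
  4, and injectivity of j makes one of them positive.\<close>

lemma w_strictly_convex:
  assumes x: "x \<in> X" and y: "y \<in> X" and "x \<noteq> y"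
  shows "w (midpoint x y) < (w x + w y) / 2"
proof -
  have para: "(norm ((a + b) / 2))\<^sup>2 = ((norm a)\<^sup>2 + (norm b)\<^sup>2) / 2 - (norm (a - b))\<^sup>2 / 4" for a b :: complex
    unfolding cmod_power2 by (simp add: power2_eq_square field_simps)
  let ?d = "\<lambda>n. (1/2)^n * ((norm (j x n - j y n))\<^sup>2 / 4)"
  have eq: "(1/2)^n * (norm (j (midpoint x y) n))\<^sup>2 =
      ((1/2)^n * (norm (j x n))\<^sup>2 + (1/2)^n * (norm (j y n))\<^sup>2) / 2 - ?d n" for n
    unfolding j_mid[OF x y] para by (simp add: algebra_simps)
  have "(\<lambda>n. ((1/2)^n * (norm (j x n))\<^sup>2 + (1/2)^n * (norm (j y n))\<^sup>2) / 2) sums ((w x + w y) / 2)"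
    unfolding w_def using x y by (intro sums_divide sums_add summable_sums w_summable)
  moreover have "(\<lambda>n. (1/2)^n * (norm (j (midpoint x y) n))\<^sup>2) sums w (midpoint x y)"
    unfolding w_def using x y by (intro summable_sums w_summable midpoint_mem)
  ultimately have "(\<lambda>n. ((1/2)^n * (norm (j x n))\<^sup>2 + (1/2)^n * (norm (j y n))\<^sup>2) / 2
      - (1/2)^n * (norm (j (midpoint x y) n))\<^sup>2) sums ((w x + w y) / 2 - w (midpoint x y))"
    by (rule sums_diff)
  then have d: "?d sums ((w x + w y) / 2 - w (midpoint x y))" unfolding eq by simp
  obtain n where "j x n \<noteq> j y n" using assms j_inj by (auto simp: inj_on_def fun_eq_iff)
  then have "0 < ?d n" by simp
  then have "0 < suminf ?d" using d by (intro suminf_pos2[of _ n]) (auto simp: sums_iff)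
  then show ?thesis using d by (simp add: sums_iff)
qed

end

section \<open>Conditional expectations along a measurable map\<close>

lemma conditional_density_real:
  fixes u :: "'b \<Rightarrow> real"
  assumes N: "finite_measure N" and \<pi>: "\<pi> \<in> measurable N M"
    and u: "u \<in> borel_measurable N" and u1: "\<And>x. x \<in> space N \<Longrightarrow> \<bar>u x\<bar> \<le> 1"
  obtains g :: "'c \<Rightarrow> real" where "integrable (distr N M \<pi>) g"
    and "\<And>(b :: 'c \<Rightarrow> complex) C. b \<in> borel_measurable M \<Longrightarrow> (\<And>x. norm (b x) \<le> C) \<Longrightarrow>
      integrable (distr N M \<pi>) (\<lambda>x. g x *\<^sub>R b x) \<and>
      (LINT x|distr N M \<pi>. g x *\<^sub>R b x) = (LINT x|N. u x *\<^sub>R b (\<pi> x))"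
proof -
  interpret N: finite_measure N by fact
  let ?\<sigma> = "distr N M \<pi>"
  interpret \<sigma>: finite_measure ?\<sigma> by (rule N.finite_measure_distr[OF \<pi>])
  \<comment> \<open>Since |u| <= 1, the density 1 + u is nonnegative and the Radon-Nikodym theorem
    for positive measures applies to the image of D. The 1 is subtracted from the derivative at the
    end, so g is the conditional expectation of u given \<pi>.\<close>
  define D where "D = density N (\<lambda>x. ennreal (1 + u x))"
  have D_meas: "\<pi> \<in> measurable D M" using \<pi> by (simp add: D_def)
  have bdd_int: "integrable N f" if "f \<in> borel_measurable N" "\<And>x. x \<in> space N \<Longrightarrow> norm (f x) \<le> C"
    for f :: "'b \<Rightarrow> 'd::{banach,second_countable_topology}" and C
    using that by (intro N.integrable_const_bound[of _ C]) auto
  have u_int: "integrable N (\<lambda>x. 1 + u x)"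
    using u u1 by (intro Bochner_Integration.integrable_add bdd_int[of _ 1]) auto
  have u0: "0 \<le> 1 + u x" if "x \<in> space N" for x using u1[OF that] by linarith
  have D_fin: "finite_measure D"
  proof (rule finite_measureI)
    have "emeasure D (space D) = (\<integral>\<^sup>+x. ennreal (1 + u x) \<partial>N)"
      using u by (simp add: D_def emeasure_density)
    also have "\<dots> = ennreal (LINT x|N. 1 + u x)"
      using u0 by (intro nn_integral_eq_integral u_int AE_I2)
    finally show "emeasure D (space D) \<noteq> \<infinity>" by simp
  qed
  interpret D: finite_measure D by (rule D_fin)
  have ac: "absolutely_continuous ?\<sigma> (distr D M \<pi>)"
    unfolding absolutely_continuous_def
  proof
    fix A assume "A \<in> null_sets ?\<sigma>"
    then have A: "A \<in> sets M" and "emeasure N (\<pi> -` A \<inter> space N) = 0"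
      using \<pi> by (auto simp: null_sets_def emeasure_distr)
    then have "\<pi> -` A \<inter> space N \<in> null_sets N" using \<pi> by (auto simp: null_sets_def)
    then have "\<pi> -` A \<inter> space N \<in> null_sets D"
      using absolutely_continuousI_density[of "\<lambda>x. ennreal (1 + u x)" N] u
      by (auto simp: D_def absolutely_continuous_def)
    then show "A \<in> null_sets (distr D M \<pi>)"
      using A D_meas by (simp add: null_sets_def emeasure_distr) (simp add: D_def)
  qed
  obtain f where f: "f \<in> borel_measurable ?\<sigma>" "density ?\<sigma> f = distr D M \<pi>"
    using \<sigma>.Radon_Nikodym_finite_measure[OF D.finite_measure_distr[OF D_meas] _ ac] by auto
  have f_int: "(\<integral>\<^sup>+x. f x \<partial>?\<sigma>) < \<infinity>"
  proof -
    have "(\<integral>\<^sup>+x. f x \<partial>?\<sigma>) = emeasure (density ?\<sigma> f) (space (density ?\<sigma> f))"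
      using f(1) by (simp add: emeasure_density) (auto intro!: nn_integral_cong)
    also have "\<dots> < \<infinity>"
      using finite_measure.emeasure_finite[OF D.finite_measure_distr[OF D_meas]] f(2)
      by (simp add: less_top)
    finally show ?thesis .
  qed
  define g0 where "g0 x = enn2real (f x)" for x
  have g0_nonneg: "0 \<le> g0 x" for x by (simp add: g0_def)
  have g0_meas: "g0 \<in> borel_measurable ?\<sigma>" unfolding g0_def using f(1) by measurable
  have f_g0: "AE x in ?\<sigma>. f x = ennreal (g0 x)"
    using nn_integral_PInf_AE[OF f(1)] f_int by (auto simp: g0_def less_top)
  have dens: "density ?\<sigma> (\<lambda>x. ennreal (g0 x)) = distr D M \<pi>"
    using f g0_meas f_g0 by (subst f(2)[symmetric]) (intro density_cong; auto)
  have g0_int: "integrable ?\<sigma> g0"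
  proof (rule integrableI_nonneg[OF g0_meas])
    have "(\<integral>\<^sup>+x. ennreal (g0 x) \<partial>?\<sigma>) = (\<integral>\<^sup>+x. f x \<partial>?\<sigma>)"
      using f_g0 by (intro nn_integral_cong_AE) auto
    then show "(\<integral>\<^sup>+x. ennreal (g0 x) \<partial>?\<sigma>) < \<infinity>" using f_int by simp
  qed (simp add: g0_def)
  show ?thesis
  proof (rule that[of "\<lambda>x. g0 x - 1"])
    show "integrable ?\<sigma> (\<lambda>x. g0 x - 1)" using g0_int by simp
    fix b :: "'c \<Rightarrow> complex" and C assume b: "b \<in> borel_measurable M" "\<And>x. norm (b x) \<le> C"
    have b\<pi>: "(\<lambda>x. b (\<pi> x)) \<in> borel_measurable N" using b(1) \<pi> by measurable
    have b_int: "integrable ?\<sigma> b"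
      using b by (intro \<sigma>.integrable_const_bound[of _ C]) auto
    have gb_int: "integrable ?\<sigma> (\<lambda>x. g0 x *\<^sub>R b x)"
    proof (rule Bochner_Integration.integrable_bound)
      show "integrable ?\<sigma> (\<lambda>x. C * g0 x)" using g0_int by simp
      show "AE x in ?\<sigma>. norm (g0 x *\<^sub>R b x) \<le> norm (C * g0 x)"
      proof (rule AE_I2)
        fix x
        have "norm (b x) \<le> \<bar>C\<bar>" using b(2)[of x] by simp
        then show "norm (g0 x *\<^sub>R b x) \<le> norm (C * g0 x)"
          using mult_left_mono[of "norm (b x)" "\<bar>C\<bar>" "\<bar>g0 x\<bar>"]
          by (simp add: abs_mult mult.commute)
      qed
    qed (use g0_meas b in auto)
    have "(LINT x|?\<sigma>. g0 x *\<^sub>R b x) = (LINT x|density ?\<sigma> (\<lambda>x. ennreal (g0 x)). b x)"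
      using b g0_meas g0_nonneg by (intro integral_density[symmetric]) auto
    also have "\<dots> = (LINT x|D. b (\<pi> x))"
      unfolding dens using D_meas b by (intro integral_distr)
    also have "\<dots> = (LINT x|N. (1 + u x) *\<^sub>R b (\<pi> x))"
      unfolding D_def using b\<pi> u u0 by (intro integral_density AE_I2) auto
    also have "\<dots> = (LINT x|N. b (\<pi> x)) + (LINT x|N. u x *\<^sub>R b (\<pi> x))"
    proof -
      have "norm (u x *\<^sub>R b (\<pi> x)) \<le> C" if "x \<in> space N" for x
        using mult_mono[OF u1[OF that] b(2)[of "\<pi> x"]] by simp
      then have "integrable N (\<lambda>x. u x *\<^sub>R b (\<pi> x))"
        using b\<pi> u by (intro bdd_int[of _ C]) auto
      moreover have "integrable N (\<lambda>x. b (\<pi> x))" using b\<pi> b by (intro bdd_int[of _ C]) auto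
      ultimately show ?thesis by (simp add: scaleR_add_left)
    qed
    also have "(LINT x|N. b (\<pi> x)) = (LINT x|?\<sigma>. b x)"
      using \<pi> b by (intro integral_distr[symmetric])
    finally show "integrable ?\<sigma> (\<lambda>x. (g0 x - 1) *\<^sub>R b x) \<and>
        (LINT x|?\<sigma>. (g0 x - 1) *\<^sub>R b x) = (LINT x|N. u x *\<^sub>R b (\<pi> x))"
      using gb_int b_int by (simp add: scaleR_diff_left)
  qed
qed

text \<open>Serves to integrate out the phase: with s the circle coordinate and \<pi> the projection
  to X, g is the average phase over a fibre. Real and imaginary parts are treated
  separately.\<close>

lemma conditional_density:
  fixes s :: "'b \<Rightarrow> complex"
  assumes N: "finite_measure N" and \<pi>: "\<pi> \<in> measurable N M"
    and s: "s \<in> borel_measurable N" and s1: "\<And>x. x \<in> space N \<Longrightarrow> norm (s x) \<le> 1"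
  obtains g :: "'c \<Rightarrow> complex" where "integrable (distr N M \<pi>) g"
    and "\<And>b C. b \<in> borel_measurable M \<Longrightarrow> (\<And>x. norm (b x) \<le> C) \<Longrightarrow>
      (LINT x|distr N M \<pi>. b x * g x) = (LINT x|N. b (\<pi> x) * s x)"
proof -
  interpret N: finite_measure N by fact
  let ?\<sigma> = "distr N M \<pi>"
  have sR: "\<bar>Re (s x)\<bar> \<le> 1" and sI: "\<bar>Im (s x)\<bar> \<le> 1" if "x \<in> space N" for x
    using s1[OF that] abs_Re_le_cmod abs_Im_le_cmod order_trans by blast+
  obtain g1 :: "'c \<Rightarrow> real" where g1: "integrable ?\<sigma> g1"
    and g1_eq: "\<And>(b :: 'c \<Rightarrow> complex) C. b \<in> borel_measurable M \<Longrightarrow> (\<And>x. norm (b x) \<le> C) \<Longrightarrow>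
      integrable ?\<sigma> (\<lambda>x. g1 x *\<^sub>R b x) \<and>
      (LINT x|?\<sigma>. g1 x *\<^sub>R b x) = (LINT x|N. Re (s x) *\<^sub>R b (\<pi> x))"
    using conditional_density_real[OF N \<pi>, of "\<lambda>x. Re (s x)"] s sR by auto
  obtain g2 :: "'c \<Rightarrow> real" where g2: "integrable ?\<sigma> g2"
    and g2_eq: "\<And>(b :: 'c \<Rightarrow> complex) C. b \<in> borel_measurable M \<Longrightarrow> (\<And>x. norm (b x) \<le> C) \<Longrightarrow>
      integrable ?\<sigma> (\<lambda>x. g2 x *\<^sub>R b x) \<and>
      (LINT x|?\<sigma>. g2 x *\<^sub>R b x) = (LINT x|N. Im (s x) *\<^sub>R b (\<pi> x))"
    using conditional_density_real[OF N \<pi>, of "\<lambda>x. Im (s x)"] s sI by auto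
  let ?g = "\<lambda>x. complex_of_real (g1 x) + \<i> * complex_of_real (g2 x)"
  have int_b: "integrable N (\<lambda>x. r x *\<^sub>R b (\<pi> x))"
    if "b \<in> borel_measurable M" "\<And>x. norm (b x) \<le> C" "r \<in> borel_measurable N" "\<And>x. x \<in> space N \<Longrightarrow> \<bar>r x\<bar> \<le> 1"
    for b :: "'c \<Rightarrow> complex" and C r
  proof (rule N.integrable_const_bound[of _ C])
    show "AE x in N. norm (r x *\<^sub>R b (\<pi> x)) \<le> C"
    proof (rule AE_I2)
      fix x assume "x \<in> space N"
      then show "norm (r x *\<^sub>R b (\<pi> x)) \<le> C" using mult_mono[OF that(4) that(2)[of "\<pi> x"], of x] by simp
    qed
    have "(\<lambda>x. b (\<pi> x)) \<in> borel_measurable N" using that(1) \<pi> by measurable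
    then show "(\<lambda>x. r x *\<^sub>R b (\<pi> x)) \<in> borel_measurable N" using that(3) by measurable
  qed
  show ?thesis
  proof (rule that[of ?g])
    show "integrable ?\<sigma> ?g" using g1 g2 by auto
    fix b :: "'c \<Rightarrow> complex" and C assume b: "b \<in> borel_measurable M" "\<And>x. norm (b x) \<le> C"
    have "(LINT x|?\<sigma>. b x * ?g x) = (LINT x|?\<sigma>. g1 x *\<^sub>R b x + \<i> * (g2 x *\<^sub>R b x))"
      by (intro Bochner_Integration.integral_cong) (auto simp: scaleR_conv_of_real algebra_simps)
    also have "\<dots> = (LINT x|N. Re (s x) *\<^sub>R b (\<pi> x)) + \<i> * (LINT x|N. Im (s x) *\<^sub>R b (\<pi> x))"
    proof (subst Bochner_Integration.integral_add)
      show "integrable ?\<sigma> (\<lambda>x. \<i> * (g2 x *\<^sub>R b x))"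
        using g2_eq[OF b] by (intro integrable_mult_right) simp
    qed (use g1_eq[OF b] g2_eq[OF b] in \<open>simp_all only: integral_mult_right_zero\<close>)
    also have "\<dots> = (LINT x|N. Re (s x) *\<^sub>R b (\<pi> x) + \<i> * (Im (s x) *\<^sub>R b (\<pi> x)))"
    proof (subst Bochner_Integration.integral_add)
      show "integrable N (\<lambda>x. Re (s x) *\<^sub>R b (\<pi> x))"
        using s sR by (intro int_b[OF b]) auto
      have "integrable N (\<lambda>x. Im (s x) *\<^sub>R b (\<pi> x))" using s sI by (intro int_b[OF b]) auto
      then show "integrable N (\<lambda>x. \<i> * (Im (s x) *\<^sub>R b (\<pi> x)))"
        by (rule integrable_mult_right)
    qed (simp only: integral_mult_right_zero)
    also have "\<dots> = (LINT x|N. b (\<pi> x) * s x)"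
    proof (intro Bochner_Integration.integral_cong refl)
      fix x
      have "b (\<pi> x) * s x = b (\<pi> x) * (complex_of_real (Re (s x)) + \<i> * complex_of_real (Im (s x)))"
        by (simp add: complex_eq[symmetric])
      then show "Re (s x) *\<^sub>R b (\<pi> x) + \<i> * (Im (s x) *\<^sub>R b (\<pi> x)) = b (\<pi> x) * s x"
        by (simp add: scaleR_conv_of_real algebra_simps)
    qed
    finally show "(LINT x|?\<sigma>. b x * ?g x) = (LINT x|N. b (\<pi> x) * s x)" .
  qed
qed


section \<open>Representing measures on the extreme points\<close>

text \<open>\<open>dual_norm\<close> is a supremum of reals, so boundedness must be known before any
  value can be compared with it. The constant from \<open>dual_space\<close> may be negative, hence
  the absolute value in the proof.\<close>

lemma dual_norm_bdd_above:
  assumes \<xi>: "\<xi> \<in> dual_space V nrm" and nrm0: "\<And>f. f \<in> V \<Longrightarrow> 0 \<le> nrm f"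
  shows "bdd_above ((\<lambda>f. cmod (\<xi> f)) ` {f \<in> V. nrm f \<le> 1})"
proof -
  obtain C where C: "\<And>f. f \<in> V \<Longrightarrow> cmod (\<xi> f) \<le> C * nrm f"
    using \<xi> unfolding dual_space_def by blast
  show ?thesis
  proof (rule bdd_aboveI2)
    fix f assume f: "f \<in> {f \<in> V. nrm f \<le> 1}"
    have "C * nrm f \<le> \<bar>C\<bar> * 1" using f nrm0 by (intro mult_mono) auto
    then show "cmod (\<xi> f) \<le> \<bar>C\<bar>" using C[of f] f by simp
  qed
qed

lemma dual_norm_bound:
  assumes \<xi>: "\<xi> \<in> dual_space V nrm" and f: "f \<in> V"
    and scale: "\<And>c f. f \<in> V \<Longrightarrow> (\<lambda>x. c * f x) \<in> V"
    and nrm_scale: "\<And>c f. f \<in> V \<Longrightarrow> nrm (\<lambda>x. c * f x) = cmod c * nrm f"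
    and nrm0: "\<And>f. f \<in> V \<Longrightarrow> 0 \<le> nrm f"
  shows "cmod (\<xi> f) \<le> dual_norm V nrm \<xi> * nrm f"
proof (cases "nrm f = 0")
  case True
  then show ?thesis using \<xi> f by (auto simp: dual_space_def)
next
  case False
  then have pos: "0 < nrm f" using nrm0[OF f] by simp
  define c where "c = complex_of_real (1 / nrm f)"
  have c: "cmod c = 1 / nrm f" using pos by (simp add: c_def norm_divide)
  have "cmod (\<xi> (\<lambda>x. c * f x)) \<le> dual_norm V nrm \<xi>"
    unfolding dual_norm_def
    using scale[OF f] nrm_scale[OF f] c pos
    by (intro cSUP_upper dual_norm_bdd_above[OF \<xi> nrm0]) auto
  moreover have "\<xi> (\<lambda>x. c * f x) = c * \<xi> f" using \<xi> f by (auto simp: dual_space_def)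
  ultimately show ?thesis using pos by (simp add: norm_mult c field_simps)
qed

lemma sup_norm_nonneg_scale:
  assumes "X \<noteq> {}" and "\<And>x. x \<in> X \<Longrightarrow> cmod (b x) \<le> C"
  shows "0 \<le> sup_norm X b" and "x \<in> X \<Longrightarrow> cmod (b x) \<le> sup_norm X b"
    and "sup_norm X (\<lambda>x. c * b x) = cmod c * sup_norm X b"
proof -
  have bdd: "bdd_above ((\<lambda>x. cmod (b x)) ` X)" using assms(2) by (intro bdd_aboveI2)
  show le: "x \<in> X \<Longrightarrow> cmod (b x) \<le> sup_norm X b" for x
    unfolding sup_norm_def by (rule cSUP_upper[OF _ bdd])
  obtain y where "y \<in> X" using assms(1) by blast
  then show nn: "0 \<le> sup_norm X b" using le[of y] norm_ge_zero order_trans by blast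
  show "sup_norm X (\<lambda>x. c * b x) = cmod c * sup_norm X b"
  proof (rule antisym)
    show "sup_norm X (\<lambda>x. c * b x) \<le> cmod c * sup_norm X b"
      unfolding sup_norm_def[of X "\<lambda>x. c * b x"]
      using le assms(1) by (intro cSUP_least) (auto simp: norm_mult mult_left_mono)
    have bdd': "bdd_above ((\<lambda>x. cmod (c * b x)) ` X)"
      using assms(2) by (intro bdd_aboveI2[of _ _ "cmod c * C"]) (auto simp: norm_mult mult_left_mono)
    show "cmod c * sup_norm X b \<le> sup_norm X (\<lambda>x. c * b x)"
    proof (cases "c = 0")
      case True then show ?thesis using assms(1) by (simp add: sup_norm_def)
    next
      case False
      have "sup_norm X b \<le> sup_norm X (\<lambda>x. c * b x) / cmod c"
        unfolding sup_norm_def[of X b]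
      proof (rule cSUP_least[OF assms(1)])
        fix x assume "x \<in> X"
        then have "cmod (c * b x) \<le> sup_norm X (\<lambda>x. c * b x)"
          unfolding sup_norm_def by (rule cSUP_upper[OF _ bdd'])
        then show "cmod (b x) \<le> sup_norm X (\<lambda>x. c * b x) / cmod c"
          using False by (simp add: norm_mult field_simps)
      qed
      then show ?thesis using False by (simp add: field_simps)
    qed
  qed
qed

text \<open>What the argument requires of the space B: its members become continuous and affine
  under midpoints after multiplication by t. The Drury-Arveson space enters through an instance of
  this locale.\<close>

locale weighted_affine_space = compact_convex_coordinates X j
  for X :: "'a::{topological_space, real_vector} set" and j +
  fixes t :: "'a \<Rightarrow> real" and B :: "('a \<Rightarrow> complex) set" and \<Phi> :: "('a \<Rightarrow> complex) \<Rightarrow> complex"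
  assumes X_ne: "X \<noteq> {}"
    and t_cont: "continuous_on X t" and t_pos: "\<And>x. x \<in> X \<Longrightarrow> 0 < t x"
    and t_concave: "midpoint_concave_on X t"
    and B_off: "\<And>b x. b \<in> B \<Longrightarrow> x \<notin> X \<Longrightarrow> b x = 0"
    and B_0: "0 \<in> B"
    and B_add: "\<And>b b'. b \<in> B \<Longrightarrow> b' \<in> B \<Longrightarrow> b + b' \<in> B"
    and B_scale: "\<And>c b. b \<in> B \<Longrightarrow> (\<lambda>x. c * b x) \<in> B"
    and B_cont: "\<And>b. b \<in> B \<Longrightarrow> continuous_on X (\<lambda>x. b x * complex_of_real (t x))"
    and B_mid: "\<And>b x y. b \<in> B \<Longrightarrow> x \<in> X \<Longrightarrow> y \<in> X \<Longrightarrow>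
      b (midpoint x y) * complex_of_real (t (midpoint x y)) =
      (b x * complex_of_real (t x) + b y * complex_of_real (t y)) / 2"
    and \<Phi>: "\<Phi> \<in> dual_space B (sup_norm X)"
begin

section \<open>The sublinear functional on continuous functions on X times the circle\<close>

definition "K = X \<times> sphere (0::complex) 1"
definition "M = dual_norm B (sup_norm X) \<Phi>"
text \<open>Every positive measure with the desired properties integrates \<open>major l b\<close>
  to at most \<open>cost (l, b)\<close>. The condition l >= 0 in \<open>majors\<close> keeps these
  functions concave in the first coordinate.\<close>

definition major :: "real \<Rightarrow> ('a \<Rightarrow> complex) \<Rightarrow> 'a \<times> complex \<Rightarrow> real" where
  "major l b z = l * t (fst z) + Re (snd z * (b (fst z) * complex_of_real (t (fst z))))"
definition majors :: "('a \<times> complex \<Rightarrow> real) \<Rightarrow> (real \<times> ('a \<Rightarrow> complex)) set" where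
  "majors F = {(l, b). 0 \<le> l \<and> b \<in> B \<and> (\<forall>z\<in>K. F z \<le> major l b z)}"
definition cost :: "real \<times> ('a \<Rightarrow> complex) \<Rightarrow> real" where
  "cost q = M * fst q + Re (\<Phi> (snd q))"
definition p :: "('a \<times> complex \<Rightarrow> real) \<Rightarrow> real" where
  "p F = (INF q\<in>majors F. cost q)"

lemma compact_K: "compact K"
  unfolding K_def by (intro compact_Times compact_X compact_sphere)

lemma B_cont': "b \<in> B \<Longrightarrow> continuous_on X b"
proof -
  assume b: "b \<in> B"
  have "continuous_on X (\<lambda>x. (b x * complex_of_real (t x)) / complex_of_real (t x))"
    using t_pos by (intro continuous_on_divide B_cont b continuous_on_of_real t_cont) force
  then show ?thesis
    by (rule continuous_on_cong[THEN iffD1, OF refl, rotated]) (use t_pos in force)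
qed

text \<open>The bound is over the whole type because \<open>conditional_density\<close> asks for
  such a bound; off X the members of B vanish.\<close>

lemma B_bounded: "b \<in> B \<Longrightarrow> \<exists>C. \<forall>x. cmod (b x) \<le> C"
proof -
  assume b: "b \<in> B"
  have "compact (b ` X)" by (rule compact_continuous_image[OF B_cont'[OF b] compact_X])
  then obtain C where C0: "\<forall>y\<in>b ` X. cmod y \<le> C"
    using compact_imp_bounded bounded_iff by metis
  then have C: "cmod (b x) \<le> C" if "x \<in> X" for x using that by blast
  have "cmod (b x) \<le> max C 0" for x
    using C[of x] B_off[OF b, of x] by (cases "x \<in> X") auto
  then show ?thesis by blast
qed

lemma sup_norm_B:
  assumes "b \<in> B"
  shows "0 \<le> sup_norm X b" and "x \<in> X \<Longrightarrow> cmod (b x) \<le> sup_norm X b"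
    and "sup_norm X (\<lambda>x. c * b x) = cmod c * sup_norm X b"
proof -
  obtain C where "\<forall>x. cmod (b x) \<le> C" using B_bounded[OF assms] by (rule exE)
  then have C: "cmod (b x) \<le> C" if "x \<in> X" for x by (rule spec)
  show "0 \<le> sup_norm X b" "x \<in> X \<Longrightarrow> cmod (b x) \<le> sup_norm X b"
    "sup_norm X (\<lambda>x. c * b x) = cmod c * sup_norm X b"
    by (rule sup_norm_nonneg_scale[OF X_ne C]; assumption)+
qed

lemma \<Phi>_bound: "b \<in> B \<Longrightarrow> cmod (\<Phi> b) \<le> M * sup_norm X b"
  unfolding M_def by (rule dual_norm_bound[OF \<Phi> _ B_scale sup_norm_B(3,1)])

lemma \<Phi>_add: "b \<in> B \<Longrightarrow> b' \<in> B \<Longrightarrow> \<Phi> (b + b') = \<Phi> b + \<Phi> b'"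
  and \<Phi>_scale: "b \<in> B \<Longrightarrow> \<Phi> (\<lambda>x. c * b x) = c * \<Phi> b"
  using \<Phi> by (auto simp: dual_space_def)

lemma \<Phi>_0: "\<Phi> 0 = 0"
  using \<Phi>_add[OF B_0 B_0] by simp

lemma M_nonneg: "0 \<le> M"
proof -
  have "cmod (\<Phi> 0) \<le> M"
    unfolding M_def dual_norm_def
  proof (rule cSUP_upper)
    show "bdd_above ((\<lambda>f. cmod (\<Phi> f)) ` {f \<in> B. sup_norm X f \<le> 1})"
      by (rule dual_norm_bdd_above[OF \<Phi> sup_norm_B(1)])
    have "sup_norm X 0 = 0" using X_ne by (simp add: sup_norm_def)
    then show "0 \<in> {f \<in> B. sup_norm X f \<le> 1}" using B_0 by (simp only: mem_Collect_eq) simp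
  qed
  then show ?thesis by (simp add: \<Phi>_0)
qed

lemma continuous_fst_K: "continuous_on X f \<Longrightarrow> continuous_on K (\<lambda>z. f (fst z))"
  by (rule continuous_on_compose2[of X f]) (auto simp: K_def intro!: continuous_intros)

lemma major_cont: "b \<in> B \<Longrightarrow> continuous_on K (major l b)"
  unfolding major_def[abs_def]
  by (intro continuous_intros continuous_fst_K[OF t_cont] continuous_fst_K[OF B_cont])

lemma major_0: "major l 0 z = l * t (fst z)"
  by (simp add: major_def)

text \<open>Keeps p finite. At each x the unimodular s can be taken opposite to the phase of b x, so
  that the majorant is (l - |b x|) t x there; as it lies above - k t x, this gives |b| <= l + k on
  X. Since M is the norm of \<Phi>, the cost is at least M l - M (l + k).\<close>

lemma cost_lower:
  assumes q: "(l, b) \<in> majors F" and F: "\<And>z. z \<in> K \<Longrightarrow> - k * t (fst z) \<le> F z"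
  shows "- M * k \<le> cost (l, b)"
proof -
  have l: "0 \<le> l" and b: "b \<in> B" and maj: "\<And>z. z \<in> K \<Longrightarrow> F z \<le> major l b z"
    using q by (auto simp: majors_def)
  have "cmod (b x) \<le> l + k" if x: "x \<in> X" for x
  proof -
    define s where "s = (if b x = 0 then 1 else - cnj (sgn (b x)))"
    have s: "cmod s = 1" by (simp add: s_def norm_sgn)
    have "s * b x = - complex_of_real (cmod (b x))"
      by (simp add: s_def sgn_div_norm scaleR_conv_of_real complex_norm_square[symmetric] field_simps power2_eq_square)
    then have "major l b (x, s) = l * t x - cmod (b x) * t x"
      by (simp add: major_def mult.assoc[symmetric])
    moreover have "- k * t x \<le> major l b (x, s)"
      using F[of "(x, s)"] maj[of "(x, s)"] s x by (simp add: K_def)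
    ultimately have "cmod (b x) * t x \<le> (l + k) * t x" by (simp add: algebra_simps)
    then show ?thesis using t_pos[OF x] by simp
  qed
  then have "sup_norm X b \<le> l + k"
    unfolding sup_norm_def by (rule cSUP_least[OF X_ne])
  then have "M * sup_norm X b \<le> M * (l + k)" by (rule mult_left_mono[OF _ M_nonneg])
  then have "cmod (\<Phi> b) \<le> M * (l + k)" using \<Phi>_bound[OF b] by linarith
  then show ?thesis
    using abs_Re_le_cmod[of "\<Phi> b"] by (simp add: cost_def algebra_simps)
qed

text \<open>Compactness bounds F / t. The constant supplies the member (k, 0) of
  \<open>majors F\<close> and, through \<open>cost_lower\<close>, a lower bound for all
  costs.\<close>

lemma weight_bound:
  fixes F :: "'a \<times> complex \<Rightarrow> real"
  assumes "continuous_on K F"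
  shows "\<exists>k\<ge>0. \<forall>z\<in>K. \<bar>F z\<bar> \<le> k * t (fst z)"
proof -
  have "t (fst z) \<noteq> 0" if "z \<in> K" for z using t_pos[of "fst z"] that by (auto simp: K_def)
  then have "continuous_on K (\<lambda>z. F z / t (fst z))"
    using assms by (intro continuous_on_divide continuous_fst_K t_cont) auto
  then have "compact ((\<lambda>z. F z / t (fst z)) ` K)"
    using compact_K by (rule compact_continuous_image)
  then obtain C where C0: "\<forall>y\<in>(\<lambda>z. F z / t (fst z)) ` K. norm y \<le> C"
    using compact_imp_bounded bounded_iff by metis
  then have C: "norm (F z / t (fst z)) \<le> C" if "z \<in> K" for z using that by blast
  show ?thesis
  proof (intro exI[of _ "\<bar>C\<bar>"] conjI ballI)
    fix z assume z: "z \<in> K"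
    then have tz: "0 < t (fst z)" using t_pos by (auto simp: K_def)
    have "\<bar>F z\<bar> \<le> C * t (fst z)" using C[OF z] tz by (simp add: field_simps)
    also have "\<dots> \<le> \<bar>C\<bar> * t (fst z)" using tz by (intro mult_right_mono) auto
    finally show "\<bar>F z\<bar> \<le> \<bar>C\<bar> * t (fst z)" .
  qed simp
qed

lemma majors_ne:
  assumes F: "continuous_on K F" shows "majors F \<noteq> {}"
proof -
  obtain k where k: "0 \<le> k" "\<forall>z\<in>K. \<bar>F z\<bar> \<le> k * t (fst z)"
    using weight_bound[OF F] by metis
  have "(k, 0) \<in> majors F"
    unfolding majors_def mem_Collect_eq case_prod_conv major_0
    using k abs_le_D1 by (intro conjI B_0) auto
  then show ?thesis by blast
qed

lemma cost_bdd_below: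
  assumes F: "continuous_on K F" shows "bdd_below (cost ` majors F)"
proof -
  obtain k where k: "0 \<le> k" "\<forall>z\<in>K. \<bar>F z\<bar> \<le> k * t (fst z)"
    using weight_bound[OF F] by metis
  have "- k * t (fst z) \<le> F z" if "z \<in> K" for z using bspec[OF k(2) that] by linarith
  then have low: "- M * k \<le> cost (l, b)" if "(l, b) \<in> majors F" for l b
    by (rule cost_lower[OF that])
  show ?thesis
  proof (rule bdd_belowI2)
    fix q assume "q \<in> majors F"
    then show "- M * k \<le> cost q" using low by (cases q) simp
  qed
qed

lemma p_le: "continuous_on K F \<Longrightarrow> q \<in> majors F \<Longrightarrow> p F \<le> cost q"
  unfolding p_def by (rule cINF_lower[OF cost_bdd_below])

lemma p_leI:
  assumes "continuous_on K F" "0 \<le> l" "b \<in> B" "\<And>z. z \<in> K \<Longrightarrow> F z \<le> major l b z"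
  shows "p F \<le> M * l + Re (\<Phi> b)"
  using p_le[OF assms(1), of "(l, b)"] assms(2-4) by (simp add: majors_def cost_def)

lemma p_ge: "continuous_on K F \<Longrightarrow> (\<And>q. q \<in> majors F \<Longrightarrow> a \<le> cost q) \<Longrightarrow> a \<le> p F"
  unfolding p_def by (rule cINF_greatest[OF majors_ne])

lemma sublinear_p: "sublinear_on {F. continuous_on K F} p"
  unfolding sublinear_on_def
proof (intro conjI ballI allI impI)
  fix F G :: "'a \<times> complex \<Rightarrow> real" assume FG: "F \<in> {F. continuous_on K F}" "G \<in> {F. continuous_on K F}"
  then have F: "continuous_on K F" and G: "continuous_on K G" by (simp_all only: mem_Collect_eq)
  then have FG_cont: "continuous_on K (F + G)" by (simp add: plus_fun_def continuous_on_add)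
  have "p (F + G) \<le> cost q + cost q'" if "q \<in> majors F" "q' \<in> majors G" for q q'
  proof -
    obtain l b l' b' where q: "q = (l, b)" "q' = (l', b')" by (metis surj_pair)
    have "(l + l', b + b') \<in> majors (F + G)"
      unfolding majors_def
    proof (intro CollectI case_prodI conjI ballI)
      fix z assume "z \<in> K"
      then have "F z \<le> major l b z" "G z \<le> major l' b' z" using that q by (auto simp: majors_def)
      then show "(F + G) z \<le> major (l + l') (b + b') z" by (simp add: major_def algebra_simps)
    qed (use that q B_add in \<open>auto simp: majors_def\<close>)
    from p_le[OF FG_cont this] show ?thesis
      using that q \<Phi>_add by (simp add: cost_def majors_def algebra_simps)
  qed
  then have "p (F + G) - cost q' \<le> p F" if "q' \<in> majors G" for q'
    using that by (intro p_ge[OF F]) (simp add: algebra_simps)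
  then have "p (F + G) - p F \<le> p G"
    by (intro p_ge[OF G]) (simp add: algebra_simps)
  then show "p (F + G) \<le> p F + p G" by simp
next
  have half: "p (c *\<^sub>R F) \<le> c * p F" if F: "continuous_on K F" and c: "0 < c"
    for F :: "'a \<times> complex \<Rightarrow> real" and c :: real
  proof -
    have cF: "continuous_on K (c *\<^sub>R F)" using F by (simp add: scaleR_fun_def continuous_on_mult_left)
    have "p (c *\<^sub>R F) / c \<le> p F"
    proof (rule p_ge[OF F])
      fix q assume q: "q \<in> majors F"
      obtain l b where lb: "q = (l, b)" by (metis surj_pair)
      have b: "b \<in> B" using q lb by (simp add: majors_def)
      have "(c * l, \<lambda>x. complex_of_real c * b x) \<in> majors (c *\<^sub>R F)"
        unfolding majors_def
      proof (intro CollectI case_prodI conjI ballI)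
        fix z assume "z \<in> K"
        then have "c * F z \<le> c * major l b z" using q lb c by (auto simp: majors_def)
        also have "\<dots> = major (c * l) (\<lambda>x. complex_of_real c * b x) z"
          by (simp add: major_def algebra_simps)
        finally show "(c *\<^sub>R F) z \<le> major (c * l) (\<lambda>x. complex_of_real c * b x) z"
          by (simp add: scaleR_fun_def)
      qed (use q lb c B_scale in \<open>auto simp: majors_def\<close>)
      from p_le[OF cF this] have "p (c *\<^sub>R F) \<le> c * cost q"
        using \<Phi>_scale[OF b] by (simp add: cost_def lb algebra_simps)
      then show "p (c *\<^sub>R F) / c \<le> cost q" using c by (simp add: field_simps)
    qed
    then show ?thesis using c by (simp add: field_simps)
  qed
  fix F :: "'a \<times> complex \<Rightarrow> real" and c :: real assume F: "F \<in> {F. continuous_on K F}" and c: "0 < c"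
  then have cF: "continuous_on K (c *\<^sub>R F)" by (simp add: scaleR_fun_def continuous_on_mult_left)
  have "p F \<le> p (c *\<^sub>R F) / c" using half[OF cF, of "1 / c"] c by simp
  then have "c * p F \<le> p (c *\<^sub>R F)" using c by (simp add: field_simps)
  then show "p (c *\<^sub>R F) = c * p F" using half[of F c] F c by simp
qed

lemma subspace_cont: "subspace {F. continuous_on K (F :: 'a \<times> complex \<Rightarrow> real)}"
  by (auto simp: subspace_def plus_fun_def zero_fun_def scaleR_fun_def continuous_on_add continuous_on_mult_left)

text \<open>Only x moves while the phase s is held fixed: the first summand is concave because l >=
  0, and the second is affine by \<open>B_mid\<close>.\<close>

lemma major_concave:
  assumes "0 \<le> l" "b \<in> B" "x \<in> X" "y \<in> X"
  shows "(major l b (x, s) + major l b (y, s)) / 2 \<le> major l b (midpoint x y, s)"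
proof -
  have "l * (t x / 2 + t y / 2) \<le> l * t (midpoint x y)"
    using t_concave assms by (intro mult_left_mono) (auto simp: midpoint_concave_on_def)
  moreover have "s * (b (midpoint x y) * complex_of_real (t (midpoint x y)))
      = (s * (b x * complex_of_real (t x)) + s * (b y * complex_of_real (t y))) / 2"
    unfolding B_mid[OF assms(2-4)] by (simp add: distrib_left)
  then have "Re (s * (b (midpoint x y) * complex_of_real (t (midpoint x y))))
      = (Re (s * (b x * complex_of_real (t x))) + Re (s * (b y * complex_of_real (t y)))) / 2"
    by (simp only: Re_divide_numeral plus_complex.sel)
  ultimately show ?thesis
    by (simp only: major_def fst_conv snd_conv) (simp add: field_simps)
qed

text \<open>N carries the sigma-algebra of the Riesz construction, so measurability of continuous
  functions is recorded instead of an equation for its measurable sets.\<close>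

lemma exists_riesz_measure:
  obtains N where "finite_measure N" "space N = K"
    and "\<And>F :: 'a \<times> complex \<Rightarrow> real. continuous_on K F \<Longrightarrow> F \<in> borel_measurable N"
    and "(LINT z|N. t (fst z)) \<le> M"
    and "\<And>b. b \<in> B \<Longrightarrow> (LINT z|N. Re (snd z * (b (fst z) * complex_of_real (t (fst z))))) = Re (\<Phi> b)"
    and "AE z in N. fst z \<in> extreme_points X"
proof -
  define W where "W z = w (fst z)" for z :: "'a \<times> complex"
  have W_cont: "continuous_on K W" unfolding W_def by (rule continuous_fst_K[OF w_cont])
  obtain \<tau> where \<tau>_add: "\<And>f g. continuous_on K f \<Longrightarrow> continuous_on K g \<Longrightarrow> \<tau> (f + g) = \<tau> f + \<tau> g"
    and \<tau>_scale: "\<And>c f. continuous_on K f \<Longrightarrow> \<tau> (c *\<^sub>R f) = c * \<tau> f"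
    and \<tau>_le: "\<And>f. continuous_on K f \<Longrightarrow> \<tau> f \<le> p f" and \<tau>_W: "\<tau> W = p W"
    by (rule Hahn_Banach_sublinear[OF subspace_cont sublinear_p, unfolded mem_Collect_eq, OF W_cont]) (rule that)
  interpret T: positive_functional K \<tau>
  proof
    show "compact K" by (rule compact_K)
  next
    fix f g :: "'a \<times> complex \<Rightarrow> real" assume "continuous_on K f" "continuous_on K g"
    then show "\<tau> (\<lambda>x. f x + g x) = \<tau> f + \<tau> g" using \<tau>_add by (simp add: plus_fun_def)
  next
    fix c and f :: "'a \<times> complex \<Rightarrow> real" assume "continuous_on K f"
    then show "\<tau> (\<lambda>x. c * f x) = c * \<tau> f" using \<tau>_scale by (simp add: scaleR_fun_def)
  next
    fix f :: "'a \<times> complex \<Rightarrow> real" assume f: "continuous_on K f" and f0: "\<And>x. x \<in> K \<Longrightarrow> 0 \<le> f x"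
    have nf: "continuous_on K ((-1) *\<^sub>R f)" using f by (simp add: scaleR_fun_def continuous_on_minus)
    \<comment> \<open>-f <= 0 on K, and the zero function is the majorant with l = 0 and b = 0, at
      cost 0.\<close>
    have "p ((-1) *\<^sub>R f) \<le> M * 0 + Re (\<Phi> 0)"
      using f0 by (intro p_leI[OF nf order_refl B_0]) (simp add: major_0 scaleR_fun_def)
    then have "p ((-1) *\<^sub>R f) \<le> 0" by (simp add: \<Phi>_0)
    then show "0 \<le> \<tau> f" using \<tau>_le[OF nf] \<tau>_scale[OF f, of "-1"] by simp
  qed
  let ?N = "T.riesz_measure"
  have int_t: "(LINT z|?N. t (fst z)) \<le> M"
  proof -
    have c: "continuous_on K (\<lambda>z. t (fst z))" by (rule continuous_fst_K[OF t_cont])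
    have "p (\<lambda>z. t (fst z)) \<le> M * 1 + Re (\<Phi> 0)"
      by (intro p_leI[OF c zero_le_one B_0]) (simp add: major_0)
    then have "p (\<lambda>z. t (fst z)) \<le> M" by (simp add: \<Phi>_0)
    then show ?thesis using \<tau>_le[OF c] T.integral_riesz[OF c] by simp
  qed
  have le_\<Phi>: "(LINT z|?N. Re (snd z * (b (fst z) * complex_of_real (t (fst z))))) \<le> Re (\<Phi> b)" if b: "b \<in> B" for b
  proof -
    have eq: "(\<lambda>z. Re (snd z * (b (fst z) * complex_of_real (t (fst z))))) = major 0 b"
      by (simp add: major_def fun_eq_iff)
    \<comment> \<open>\<open>major 0 b\<close> is its own majorant. The same bound for -b turns the
      inequality into the equality \<open>int_\<Phi>\<close>.\<close>
    have "p (major 0 b) \<le> M * 0 + Re (\<Phi> b)"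
      by (rule p_leI[OF major_cont[OF b] order_refl b order_refl])
    then have "p (major 0 b) \<le> Re (\<Phi> b)" by simp
    then show ?thesis
      using \<tau>_le[OF major_cont[OF b, of 0]] T.integral_riesz[OF major_cont[OF b, of 0]] unfolding eq by simp
  qed
  have int_\<Phi>: "(LINT z|?N. Re (snd z * (b (fst z) * complex_of_real (t (fst z))))) = Re (\<Phi> b)" if b: "b \<in> B" for b
  proof (rule antisym[OF le_\<Phi>[OF b]])
    have "(LINT z|?N. Re (snd z * ((- 1 * b (fst z)) * complex_of_real (t (fst z))))) \<le> Re (\<Phi> (\<lambda>x. - 1 * b x))"
      by (rule le_\<Phi>[OF B_scale[OF b]])
    moreover have "(\<lambda>z. Re (snd z * ((- 1 * b (fst z)) * complex_of_real (t (fst z)))))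
        = (\<lambda>z. - Re (snd z * (b (fst z) * complex_of_real (t (fst z)))))" by (simp add: fun_eq_iff)
    moreover have "Re (\<Phi> (\<lambda>x. - 1 * b x)) = - Re (\<Phi> b)"
      using \<Phi>_scale[OF b, of "-1"] by simp
    ultimately show "Re (\<Phi> b) \<le> (LINT z|?N. Re (snd z * (b (fst z) * complex_of_real (t (fst z)))))"
      by (simp only: integral_minus neg_le_iff_le)
  qed
  \<comment> \<open>Nearly optimal majorants of W. As \<open>\<tau> W = p W\<close>, the integral of
    the n-th majorant minus W will be at most 2^-n.\<close>
  have "\<exists>q\<in>majors W. cost q < p W + (1/2)^n" for n :: nat
  proof (rule ccontr)
    assume "\<not> ?thesis"
    then have "p W + (1/2)^n \<le> p W" by (intro p_ge[OF W_cont]) (auto simp: not_less)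
    moreover have "0 < (1/2 :: real)^n" by simp
    ultimately show False by linarith
  qed
  then have "\<forall>n::nat. \<exists>q. q \<in> majors W \<and> cost q < p W + (1/2)^n" by blast
  then obtain q where "\<forall>n::nat. q n \<in> majors W \<and> cost (q n) < p W + (1/2)^n" by (rule choice[THEN exE])
  then have q: "q n \<in> majors W" and q_cost: "cost (q n) < p W + (1/2)^n" for n by blast+
  define l where "l n = fst (q n)" for n
  define b where "b n = snd (q n)" for n
  have lb: "0 \<le> l n" "b n \<in> B" and maj: "\<And>z. z \<in> K \<Longrightarrow> W z \<le> major (l n) (b n) z" for n
    using q[of n] by (auto simp: majors_def l_def b_def split: prod.splits)
  have int_diff: "(LINT z|?N. major (l n) (b n) z - W z) \<le> (1/2)^n" for n
  proof -
    have "\<tau> (major (l n) (b n)) \<le> cost (q n)"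
    proof -
      have "\<tau> (major (l n) (b n)) \<le> p (major (l n) (b n))" by (rule \<tau>_le[OF major_cont[OF lb(2)]])
      also have "\<dots> \<le> M * l n + Re (\<Phi> (b n))"
        by (rule p_leI[OF major_cont[OF lb(2)] lb order_refl])
      finally show ?thesis by (simp add: cost_def l_def b_def)
    qed
    then have "\<tau> (major (l n) (b n)) - \<tau> W \<le> (1/2)^n" using q_cost[of n] \<tau>_W by simp
    moreover have "(LINT z|?N. major (l n) (b n) z - W z) = \<tau> (major (l n) (b n)) - \<tau> W"
      using T.integral_riesz[of "\<lambda>z. major (l n) (b n) z - W z"] T.diff[OF major_cont[OF lb(2)] W_cont]
        major_cont[OF lb(2)] W_cont by (simp add: continuous_on_diff)
    ultimately show ?thesis by simp
  qed
  \<comment> \<open>A countable infimum, hence measurable. Its integral is at most every 2^-n, so W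
    is almost everywhere the infimum of these majorants.\<close>
  define h where "h z = (INF n. ennreal (major (l n) (b n) z - W z))" for z
  have diff_cont: "continuous_on K (\<lambda>z. major (l n) (b n) z - W z)" for n
    by (intro continuous_on_diff major_cont lb W_cont)
  have h_meas: "h \<in> borel_measurable ?N"
    unfolding h_def using T.continuous_on_measurable_riesz[OF diff_cont] by measurable
  have "(\<integral>\<^sup>+z. h z \<partial>?N) \<le> ennreal ((1/2)^n)" for n
  proof -
    have "(\<integral>\<^sup>+z. h z \<partial>?N) \<le> (\<integral>\<^sup>+z. ennreal (major (l n) (b n) z - W z) \<partial>?N)"
      unfolding h_def by (intro nn_integral_mono INF_lower) simp
    also have "\<dots> = ennreal (LINT z|?N. major (l n) (b n) z - W z)"
      using maj by (intro nn_integral_eq_integral T.integrable_riesz diff_cont AE_I2) (simp add: T.space_riesz_measure)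
    finally show ?thesis using int_diff[of n] ennreal_leI order_trans by blast
  qed
  moreover have "(\<lambda>n. ennreal ((1/2)^n)) \<longlonglongrightarrow> ennreal 0"
    by (intro tendsto_ennrealI LIMSEQ_power_zero) simp
  ultimately have "(\<integral>\<^sup>+z. h z \<partial>?N) \<le> 0"
    using LIMSEQ_le_const by fastforce
  then have "AE z in ?N. h z = 0" using nn_integral_0_iff_AE[OF h_meas] by simp
  then have AE_ext: "AE z in ?N. fst z \<in> extreme_points X"
  proof (rule AE_mp, intro AE_I2 impI)
    fix z assume z: "z \<in> space ?N" and hz: "h z = 0"
    obtain x s where xs: "z = (x, s)" by (metis surj_pair)
    have "z \<in> K" using z by (simp only: T.space_riesz_measure)
    then have x: "x \<in> X" and s: "cmod s = 1" using xs by (auto simp: K_def)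
    have "y = y'" if y: "y \<in> X" "y' \<in> X" "x = midpoint y y'" for y y'
    proof (rule ccontr)
      assume "y \<noteq> y'"
      \<comment> \<open>Every majorant is concave in x and lies above w at y and y', so at their
        midpoint it exceeds w by at least d, whatever n is. Then h z >= d > 0.\<close>
      define d where "d = (w y + w y') / 2 - w x"
      have d: "0 < d" using w_strictly_convex[OF y(1,2) \<open>y \<noteq> y'\<close>] y(3) by (simp add: d_def)
      have "d \<le> major (l n) (b n) z - W z" for n
      proof -
        have "w y \<le> major (l n) (b n) (y, s)" "w y' \<le> major (l n) (b n) (y', s)"
          using maj[of "(y, s)" n] maj[of "(y', s)" n] y s by (auto simp: K_def W_def)
        then show ?thesis
          using major_concave[OF lb(1)[of n] lb(2)[of n] y(1,2), of s] by (simp add: d_def xs y(3) W_def)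
      qed
      then have "ennreal d \<le> h z" unfolding h_def by (intro INF_greatest ennreal_leI)
      then show False using hz d by simp
    qed
    then show "fst z \<in> extreme_points X" using x xs by (auto simp: extreme_points_midpoint[OF convex_X])
  qed
  show ?thesis
    by (rule that[OF T.finite_measure_riesz T.space_riesz_measure T.continuous_on_measurable_riesz int_t int_\<Phi> AE_ext])
qed

text \<open>The phase is projected out: \<sigma> is the image of t N under \<open>fst\<close>, g the
  conditional expectation of s, and \<mu> = g \<sigma>. As |s| = 1, the variation is at most the
  mass of \<sigma>, hence at most M; it is at least M because \<mu> represents \<Phi>. So averaging
  phases over a fibre loses no mass.\<close>

theorem exists_representing_measure:
  "\<exists>\<mu> \<in> regular_complex_borel_measures X.
     concentrated_on (borel_on X) \<mu> (extreme_points X) \<and>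
     total_variation_norm (borel_on X) \<mu> = dual_norm B (sup_norm X) \<Phi> \<and>
     (\<forall>b\<in>B. \<Phi> b = complex_integral (borel_on X) \<mu> (extreme_points X) b)"
proof -
  obtain N where N: "finite_measure N" and space_N: "space N = K"
    and meas_N: "\<And>F :: 'a \<times> complex \<Rightarrow> real. continuous_on K F \<Longrightarrow> F \<in> borel_measurable N"
    and int_t: "(LINT z|N. t (fst z)) \<le> M"
    and int_\<Phi>: "\<And>b. b \<in> B \<Longrightarrow> (LINT z|N. Re (snd z * (b (fst z) * complex_of_real (t (fst z))))) = Re (\<Phi> b)"
    and AE_ext: "AE z in N. fst z \<in> extreme_points X"
    by (rule exists_riesz_measure) (rule that)
  interpret N: finite_measure N by (rule N)
  let ?BX = "borel_on X"
  have meas_complex: "F \<in> borel_measurable N" if "continuous_on K F" for F :: "'a \<times> complex \<Rightarrow> complex"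
    unfolding borel_measurable_complex_iff
    using meas_N[of "\<lambda>z. Re (F z)"] meas_N[of "\<lambda>z. Im (F z)"] that
    by (simp add: continuous_on_Re continuous_on_Im)
  have fst_meas: "fst \<in> measurable N ?BX"
  proof (rule measurable_borel_on)
    show "fst \<in> space N \<rightarrow> X" by (auto simp: space_N K_def)
    show "(\<lambda>z. j (fst z) n) \<in> borel_measurable N" for n
      by (intro meas_complex continuous_fst_K continuous_on_product_then_coordinatewise[OF j_cont])
  qed
  have snd_meas: "snd \<in> borel_measurable N"
    by (intro meas_complex continuous_on_snd continuous_on_id)
  have t_meas: "(\<lambda>z. t (fst z)) \<in> borel_measurable N"
    by (intro meas_N continuous_fst_K t_cont)
  have t_nonneg: "0 \<le> t (fst z)" if "z \<in> space N" for z
    using t_pos[of "fst z"] that by (auto simp: space_N K_def)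
  obtain C where C: "\<forall>z\<in>K. norm (t (fst z)) \<le> C"
  proof -
    have "compact ((\<lambda>z. t (fst z)) ` K)"
      by (intro compact_continuous_image continuous_fst_K t_cont compact_K)
    then obtain C where "\<forall>y\<in>(\<lambda>z. t (fst z)) ` K. norm y \<le> C"
      using compact_imp_bounded bounded_iff by metis
    then have "\<forall>z\<in>K. norm (t (fst z)) \<le> C" by simp
    then show ?thesis by (rule that)
  qed
  have t_int: "integrable N (\<lambda>z. t (fst z))"
    using C by (intro N.integrable_const_bound[of _ C] AE_I2 t_meas) (simp add: space_N)
  \<comment> \<open>The weight t turns the known integrals of s b t into integrals of s b, and makes
    the total mass the integral of t, which is at most M.\<close>
  define D where "D = density N (\<lambda>z. ennreal (t (fst z)))"
  have D_mass: "emeasure D (space D) = ennreal (LINT z|N. t (fst z))"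
  proof -
    have "emeasure D (space D) = (\<integral>\<^sup>+z. ennreal (t (fst z)) \<partial>N)"
      using t_meas by (simp add: D_def emeasure_density)
    also have "\<dots> = ennreal (LINT z|N. t (fst z))"
      using t_nonneg by (intro nn_integral_eq_integral t_int AE_I2)
    finally show ?thesis .
  qed
  have D: "finite_measure D" by (rule finite_measureI) (simp add: D_mass)
  interpret D: finite_measure D by (rule D)
  have D_le: "measure D (space D) \<le> M"
  proof -
    have "0 \<le> (LINT z|N. t (fst z))" using t_nonneg by (intro integral_nonneg_AE AE_I2)
    then show ?thesis using int_t by (simp add: measure_def D_mass)
  qed
  have fst_D: "fst \<in> measurable D ?BX" using fst_meas by (simp add: D_def)
  have snd_D: "snd \<in> borel_measurable D" using snd_meas by (simp add: D_def)
  have snd_1: "cmod (snd z) = 1" if "z \<in> space D" for z using that by (auto simp: D_def space_N K_def)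
  let ?\<sigma> = "distr D ?BX fst"
  obtain g :: "'a \<Rightarrow> complex" where g: "integrable ?\<sigma> g"
    and g_int: "\<And>b C. b \<in> borel_measurable ?BX \<Longrightarrow> (\<And>x. norm (b x) \<le> C) \<Longrightarrow>
      (LINT x|?\<sigma>. b x * g x) = (LINT z|D. b (fst z) * snd z)"
    by (rule conditional_density[OF D fst_D snd_D]) (use snd_1 that in auto)
  define \<mu> where "\<mu> = (\<lambda>E. LINT x:E|?\<sigma>. g x)"
  interpret \<mu>: complex_density ?BX ?\<sigma> g \<mu>
    by standard (simp_all add: g \<mu>_def)
  have g_meas: "g \<in> borel_measurable ?BX" using \<mu>.measurable_g by simp
  have ext: "extreme_points X \<in> sets ?BX" by (rule extreme_points_sets)
  have AE_\<sigma>: "AE x in ?\<sigma>. x \<in> extreme_points X"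
  proof -
    have "AE z in D. fst z \<in> extreme_points X"
      unfolding D_def using AE_ext t_meas by (subst AE_density) auto
    moreover have "{x \<in> space ?BX. x \<in> extreme_points X} = extreme_points X"
      using sets.sets_into_space[OF ext] by blast
    ultimately show ?thesis using ext fst_D by (subst AE_distr_iff) simp_all
  qed
  have B_meas: "b \<in> borel_measurable ?BX" if "b \<in> B" for b
    unfolding borel_on_def by (rule borel_measurable_continuous_on_restrict[OF B_cont'[OF that]])
  have rep: "(LINT x|?\<sigma>. b x * g x) = \<Phi> b" if b: "b \<in> B" for b
  proof -
    let ?f = "\<lambda>z. snd z * (b (fst z) * complex_of_real (t (fst z)))"
    obtain C where "\<And>x. cmod (b x) \<le> C" using B_bounded[OF b] by blast
    from g_int[OF B_meas[OF b] this] have "(LINT x|?\<sigma>. b x * g x) = (LINT z|D. b (fst z) * snd z)" .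
    also have "\<dots> = (LINT z|N. t (fst z) *\<^sub>R (b (fst z) * snd z))"
      unfolding D_def using B_meas[OF b] fst_meas snd_meas t_meas t_nonneg
      by (intro integral_density) auto
    also have "\<dots> = (LINT z|N. ?f z)"
      by (intro Bochner_Integration.integral_cong) (auto simp: scaleR_conv_of_real mult_ac)
    also have "\<dots> = \<Phi> b"
    proof (rule complex_eqI)
      have f_cont: "continuous_on K ?f"
        by (intro continuous_intros continuous_fst_K[OF B_cont[OF b]])
      have "compact (?f ` K)" by (rule compact_continuous_image[OF f_cont compact_K])
      then obtain C where "\<forall>y\<in>?f ` K. cmod y \<le> C"
        using compact_imp_bounded bounded_iff by metis
      then have f_int: "integrable N ?f"
        by (intro N.integrable_const_bound[of _ C] AE_I2 meas_complex f_cont) (simp add: space_N)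
      show "Re (LINT z|N. ?f z) = Re (\<Phi> b)"
        using int_\<Phi>[OF b] integral_Re[OF f_int] by simp
      \<comment> \<open>The representation is known for real parts; applied to - i b it gives the
        imaginary part, as Re (- i z) = Im z.\<close>
      have "(LINT z|N. Re (snd z * ((- \<i> * b (fst z)) * complex_of_real (t (fst z))))) = Re (\<Phi> (\<lambda>x. - \<i> * b x))"
        by (rule int_\<Phi>[OF B_scale[OF b]])
      moreover have "(\<lambda>z. Re (snd z * ((- \<i> * b (fst z)) * complex_of_real (t (fst z))))) = (\<lambda>z. Im (?f z))"
        by (simp add: fun_eq_iff algebra_simps)
      ultimately have "(LINT z|N. Im (?f z)) = Re (\<Phi> (\<lambda>x. - \<i> * b x))" by simp
      then show "Im (LINT z|N. ?f z) = Im (\<Phi> b)"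
        using integral_Im[OF f_int] \<Phi>_scale[OF b, of "- \<i>"] by simp
    qed
    finally show ?thesis .
  qed
  have integral: "\<Phi> b = complex_integral ?BX \<mu> (extreme_points X) b" if b: "b \<in> B" for b
  proof -
    have "complex_integral ?BX \<mu> (extreme_points X) b = (LINT x:extreme_points X|?\<sigma>. b x * g x)"
      by (rule \<mu>.complex_integral_eq[OF ext B_meas[OF b]])
    also have "\<dots> = (LINT x|?\<sigma>. b x * g x)"
      unfolding set_lebesgue_integral_def
      using AE_\<sigma> ext B_meas[OF b] g_meas
      by (intro integral_cong_AE) auto
    finally show ?thesis using rep[OF b] by simp
  qed
  have conc: "\<mu> E = \<mu> (E \<inter> extreme_points X)" if E: "E \<in> sets ?BX" for E
    unfolding \<mu>_def set_lebesgue_integral_def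
    using AE_\<sigma> ext E g_meas
    by (intro integral_cong_AE) (auto simp: indicator_def)
  have norm_le: "(LINT x|?\<sigma>. cmod (g x)) \<le> M"
  proof -
    \<comment> \<open>Testing g against its conjugate phase turns the integral of |g| into the
      integral of b0 s over D. Since |b0 s| <= 1, this is at most the mass of D.\<close>
    define b0 where "b0 x = cnj (sgn (g x))" for x
    have b0_meas: "b0 \<in> borel_measurable ?BX" 
    proof -
      have "(\<lambda>x. sgn (g x)) \<in> borel_measurable ?BX" unfolding sgn_div_norm using g_meas by measurable
      then show ?thesis
        unfolding b0_def by (rule borel_measurable_continuous_on[rotated]) (intro continuous_intros)
    qed
    have b0_1: "cmod (b0 x) \<le> 1" for x by (simp add: b0_def norm_sgn)
    have "complex_of_real (LINT x|?\<sigma>. cmod (g x)) = (LINT x|?\<sigma>. complex_of_real (cmod (g x)))"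
      by simp
    also have "\<dots> = (LINT x|?\<sigma>. b0 x * g x)"
    proof (intro Bochner_Integration.integral_cong refl)
      fix x
      show "complex_of_real (cmod (g x)) = b0 x * g x"
      proof (cases "g x = 0")
        case False
        have "b0 x * g x = cnj (g x) * g x / complex_of_real (cmod (g x))"
          by (simp add: b0_def sgn_div_norm scaleR_conv_of_real field_simps)
        also have "cnj (g x) * g x = complex_of_real (cmod (g x)) ^ 2"
          by (simp add: complex_norm_square[symmetric] mult.commute)
        finally show ?thesis using False by (simp add: power2_eq_square)
      qed (simp add: b0_def)
    qed
    also have "\<dots> = (LINT z|D. b0 (fst z) * snd z)" by (rule g_int[OF b0_meas b0_1])
    finally have "(LINT x|?\<sigma>. cmod (g x)) \<le> norm (LINT z|D. b0 (fst z) * snd z)"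
      by (metis abs_ge_self norm_of_real)
    also have "\<dots> \<le> (LINT z|D. norm (b0 (fst z) * snd z))" by (rule integral_norm_bound)
    also have "\<dots> \<le> (LINT z|D. 1)"
    proof (rule integral_mono)
      have "(\<lambda>z. norm (b0 (fst z) * snd z)) \<in> borel_measurable D"
        using b0_meas fst_D snd_D by measurable
      then show "integrable D (\<lambda>z. norm (b0 (fst z) * snd z))"
        using b0_1 snd_1 by (intro D.integrable_const_bound[of _ 1] AE_I2) (auto simp: norm_mult)
    qed (use b0_1 snd_1 in \<open>auto simp: norm_mult\<close>)
    also have "\<dots> \<le> M" using D_le by simp
    finally show ?thesis .
  qed
  have norm_ge: "M \<le> (LINT x|?\<sigma>. cmod (g x))"
    unfolding M_def dual_norm_def
  proof (rule cSUP_least)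
    have "sup_norm X 0 = 0" using X_ne by (simp add: sup_norm_def)
    then have "sup_norm X 0 \<le> 1" by simp
    then show "{f \<in> B. sup_norm X f \<le> 1} \<noteq> {}" using B_0 by blast
    fix b assume "b \<in> {f \<in> B. sup_norm X f \<le> 1}"
    then have b: "b \<in> B" "sup_norm X b \<le> 1" by auto
    have b1: "cmod (b x) \<le> 1" for x
      using sup_norm_B(2)[OF b(1), of x] b(2) B_off[OF b(1), of x] by (cases "x \<in> X") auto
    have "cmod (\<Phi> b) \<le> (LINT x|?\<sigma>. cmod (b x * g x))"
      unfolding rep[OF b(1), symmetric] by (rule integral_norm_bound)
    also have "\<dots> \<le> (LINT x|?\<sigma>. cmod (g x))"
    proof (rule integral_mono)
      have le: "cmod (b x * g x) \<le> cmod (g x)" for x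
        using mult_right_mono[OF b1[of x], of "cmod (g x)"] by (simp add: norm_mult)
      show "cmod (b x * g x) \<le> cmod (g x)" for x by (rule le)
      show "integrable ?\<sigma> (\<lambda>x. cmod (b x * g x))"
        using g g_meas B_meas[OF b(1)] le
        by (intro Bochner_Integration.integrable_bound[OF g]) auto
    qed (use g in auto)
    finally show "cmod (\<Phi> b) \<le> (LINT x|?\<sigma>. cmod (g x))" .
  qed
  have "total_variation_norm ?BX \<mu> = dual_norm B (sup_norm X) \<Phi>"
    using \<mu>.total_variation_norm_eq norm_le norm_ge by (simp add: M_def)
  moreover have "concentrated_on ?BX \<mu> (extreme_points X)"
    unfolding concentrated_on_def using ext conc by blast
  moreover have "\<mu> \<in> regular_complex_borel_measures X"
    unfolding regular_complex_borel_measures_def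
  proof (intro CollectI conjI ballI \<mu>.complex_measure)
    fix E assume E: "E \<in> sets ?BX"
    note reg = regular[OF \<mu>.finite_V \<mu>.sets_V E]
    show "variation_on ?BX \<mu> E = (SUP K \<in> {K. K \<subseteq> E \<and> compact K}. variation_on ?BX \<mu> K)"
      unfolding \<mu>.variation_on_eq[OF E] reg(1)
    proof (intro SUP_cong refl)
      fix K assume "K \<in> {K. K \<subseteq> E \<and> compact K}"
      then have "K \<in> sets ?BX" using sets.sets_into_space[OF E] by (intro compact_sets) (auto simp: space_borel_on)
      then show "emeasure \<mu>.V K = variation_on ?BX \<mu> K" by (simp add: \<mu>.variation_on_eq)
    qed
    show "variation_on ?BX \<mu> E = (INF U \<in> {U. E \<subseteq> U \<and> openin (top_of_set X) U}. variation_on ?BX \<mu> U)"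
      unfolding \<mu>.variation_on_eq[OF E] reg(2)
      by (intro INF_cong refl) (simp add: \<mu>.variation_on_eq openin_sets)
  qed
  ultimately show ?thesis using integral by blast
qed

end


section \<open>Reproducing kernel Hilbert spaces\<close>

context function_hilbert_space
begin

abbreviation "nrm \<equiv> hilbert_norm ip"

lemma zero_ip: "g \<in> H \<Longrightarrow> ip 0 g = 0"
  using ip_add[OF zero_mem zero_mem, of g] by simp

lemma ip_add_right:
  assumes "f \<in> H" "g \<in> H" "h \<in> H" shows "ip h (f + g) = ip h f + ip h g"
  using ip_add[OF assms] assms add_mem by (metis complex_cnj_add ip_commute)

lemma ip_scale_right:
  assumes "f \<in> H" "g \<in> H" shows "ip f (\<lambda>x. c * g x) = cnj c * ip f g"
  using ip_scale[OF assms(2,1), of c] assms scale_mem by (metis complex_cnj_mult ip_commute)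

lemma diff_mem: "f \<in> H \<Longrightarrow> g \<in> H \<Longrightarrow> f - g \<in> H"
proof -
  assume f: "f \<in> H" and g: "g \<in> H"
  have "f + (\<lambda>x. (-1) * g x) \<in> H" using f g by (intro add_mem scale_mem)
  moreover have "f + (\<lambda>x. (-1) * g x) = f - g" by (simp add: fun_eq_iff)
  ultimately show ?thesis by simp
qed

lemma norm_square: "f \<in> H \<Longrightarrow> (nrm f)\<^sup>2 = Re (ip f f)"
  using ip_nonneg by (simp add: hilbert_norm_def)

lemma nrm_nonneg: "f \<in> H \<Longrightarrow> 0 \<le> nrm f"
  using ip_nonneg by (simp add: hilbert_norm_def)

lemma ip_self: "f \<in> H \<Longrightarrow> ip f f = complex_of_real ((nrm f)\<^sup>2)"
proof -
  assume f: "f \<in> H"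
  have "Im (ip f f) = 0" using ip_commute[OF f f] by (metis complex_cnj_cancel_iff complex_eq_iff cnj.sel(2) equal_neg_zero)
  then show ?thesis using norm_square[OF f] by (simp add: complex_eq_iff)
qed

lemma nrm_zero_iff: "f \<in> H \<Longrightarrow> nrm f = 0 \<longleftrightarrow> f = 0"
proof -
  assume f: "f \<in> H"
  have "f = 0" if "nrm f = 0" using ip_self[OF f] that ip_definite[OF f] by simp
  moreover have "nrm 0 = 0" using zero_ip[OF zero_mem] by (simp add: hilbert_norm_def)
  ultimately show ?thesis by blast
qed

lemma nrm_0: "nrm 0 = 0"
  using nrm_zero_iff[OF zero_mem] by simp

text \<open>The quadratic expansion behind the parallelogram identity, the Cauchy-Schwarz inequality
  and the variational argument in \<open>mem_if_bounded\<close>.\<close>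

lemma norm_square_add:
  assumes f: "f \<in> H" and g: "g \<in> H"
  shows "(nrm (f + (\<lambda>x. c * g x)))\<^sup>2 = (nrm f)\<^sup>2 + 2 * Re (cnj c * ip f g) + (cmod c)\<^sup>2 * (nrm g)\<^sup>2"
proof -
  let ?cg = "\<lambda>x. c * g x"
  have cg: "?cg \<in> H" using g by (rule scale_mem)
  have "ip (f + ?cg) (f + ?cg) = ip f f + cnj c * ip f g + (c * ip g f + c * (cnj c * ip g g))"
    using f g cg
    by (simp add: ip_add[OF f cg add_mem[OF f cg]] ip_add_right[OF f cg] ip_scale ip_scale_right algebra_simps)
  moreover have "Re (c * ip g f) = Re (cnj c * ip f g)"
    unfolding ip_commute[OF f g] by simp
  moreover have "Re (c * (cnj c * ip g g)) = (cmod c)\<^sup>2 * (nrm g)\<^sup>2"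
  proof -
    have "c * (cnj c * ip g g) = complex_of_real ((cmod c)\<^sup>2 * (nrm g)\<^sup>2)"
      unfolding ip_self[OF g] mult.assoc[symmetric] complex_norm_square[symmetric] by simp
    then show ?thesis by simp
  qed
  ultimately show ?thesis
    using norm_square f g cg add_mem by simp
qed

lemma norm_square_plus:
  assumes "f \<in> H" "g \<in> H" shows "(nrm (f + g))\<^sup>2 = (nrm f)\<^sup>2 + 2 * Re (ip f g) + (nrm g)\<^sup>2"
  using norm_square_add[OF assms, of 1] by simp

lemma norm_square_minus:
  assumes "f \<in> H" "g \<in> H" shows "(nrm (f - g))\<^sup>2 = (nrm f)\<^sup>2 - 2 * Re (ip f g) + (nrm g)\<^sup>2"
proof -
  have "f + (\<lambda>x. (-1) * g x) = f - g" by (simp add: fun_eq_iff)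
  then show ?thesis using norm_square_add[OF assms, of "-1"] by simp
qed

lemma nrm_scale: "f \<in> H \<Longrightarrow> nrm (\<lambda>x. c * f x) = cmod c * nrm f"
proof -
  assume f: "f \<in> H"
  have eq: "0 + (\<lambda>x. c * f x) = (\<lambda>x. c * f x)" by simp
  have "(nrm (\<lambda>x. c * f x))\<^sup>2 = (cmod c * nrm f)\<^sup>2"
    using norm_square_add[OF zero_mem f, of c] unfolding eq
    by (simp add: nrm_0 zero_ip f power_mult_distrib)
  then show ?thesis using f by (simp add: nrm_nonneg scale_mem)
qed

lemma cauchy_schwarz:
  assumes f: "f \<in> H" and g: "g \<in> H" shows "cmod (ip f g) \<le> nrm f * nrm g"
proof (cases "g = 0")
  case True
  then have "ip f g = 0" using ip_commute[OF zero_mem f] zero_ip[OF f] by simp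
  then show ?thesis using f g by (simp add: nrm_nonneg)
next
  case False
  then have pos: "0 < nrm g" using nrm_zero_iff[OF g] nrm_nonneg[OF g] by simp
  \<comment> \<open>Minus the coefficient of the projection of f onto g, where the quadratic is
    smallest.\<close>
  let ?c = "- ip f g / complex_of_real ((nrm g)\<^sup>2)"
  have "0 \<le> (nrm (f + (\<lambda>x. ?c * g x)))\<^sup>2" by simp
  also have "\<dots> = (nrm f)\<^sup>2 + 2 * Re (cnj ?c * ip f g) + (cmod ?c)\<^sup>2 * (nrm g)\<^sup>2"
    by (rule norm_square_add[OF f g])
  also have "cnj ?c * ip f g = complex_of_real (- ((cmod (ip f g))\<^sup>2 / (nrm g)\<^sup>2))"
  proof -
    have "cnj (ip f g) * ip f g = complex_of_real ((cmod (ip f g))\<^sup>2)"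
      unfolding complex_norm_square by (rule mult.commute)
    then show ?thesis by simp
  qed
  also have "(cmod ?c)\<^sup>2 * (nrm g)\<^sup>2 = (cmod (ip f g))\<^sup>2 / (nrm g)\<^sup>2"
  proof -
    have "cmod ?c = cmod (ip f g) / (nrm g)\<^sup>2" by (simp add: norm_divide norm_power)
    then show ?thesis using pos by (simp add: power_divide power2_eq_square)
  qed
  finally have "(cmod (ip f g))\<^sup>2 / (nrm g)\<^sup>2 \<le> (nrm f)\<^sup>2" by simp
  then have "(cmod (ip f g))\<^sup>2 \<le> (nrm f * nrm g)\<^sup>2" using pos by (simp add: field_simps)
  then show ?thesis by (rule power2_le_imp_le) (use f g in \<open>simp add: nrm_nonneg\<close>)
qed

lemma nrm_triangle:
  assumes f: "f \<in> H" and g: "g \<in> H" shows "nrm (f + g) \<le> nrm f + nrm g"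
proof (rule power2_le_imp_le)
  have "Re (ip f g) \<le> nrm f * nrm g"
    using cauchy_schwarz[OF f g] complex_Re_le_cmod[of "ip f g"] by linarith
  then show "(nrm (f + g))\<^sup>2 \<le> (nrm f + nrm g)\<^sup>2"
    unfolding norm_square_plus[OF f g] by (simp add: power2_sum)
qed (use f g in \<open>simp add: nrm_nonneg\<close>)

lemma nrm_minus_commute: "f \<in> H \<Longrightarrow> g \<in> H \<Longrightarrow> nrm (f - g) = nrm (g - f)"
proof -
  assume f: "f \<in> H" and g: "g \<in> H"
  have "(\<lambda>x. (-1) * (f - g) x) = g - f" by (simp add: fun_eq_iff)
  then show ?thesis using nrm_scale[OF diff_mem[OF f g], of "-1"] by simp
qed

lemma nrm_triangle_diff:
  assumes "f \<in> H" "g \<in> H" "h \<in> H" shows "nrm (f - h) \<le> nrm (f - g) + nrm (g - h)"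
proof -
  have "f - h = (f - g) + (g - h)" by simp
  then show ?thesis
    using nrm_triangle[OF diff_mem[OF assms(1,2)] diff_mem[OF assms(2,3)]] by (simp only:)
qed

lemma complete_nrm:
  assumes "\<And>n :: nat. F n \<in> H"
    and "\<And>e. 0 < e \<Longrightarrow> \<exists>N. \<forall>m\<ge>N. \<forall>n\<ge>N. nrm (F m - F n) < e"
  obtains f where "f \<in> H" "(\<lambda>n. nrm (F n - f)) \<longlonglongrightarrow> 0"
proof -
  have "\<forall>n. F n \<in> H" "\<forall>e>0. \<exists>N. \<forall>m\<ge>N. \<forall>n\<ge>N. nrm (F m - F n) < e"
    by (rule allI, rule assms(1)) (intro allI impI assms(2))
  then have "\<exists>f\<in>H. (\<lambda>n. nrm (F n - f)) \<longlonglongrightarrow> 0"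
    unfolding hilbert_norm_def by (rule complete)
  then obtain f where "f \<in> H" "(\<lambda>n. nrm (F n - f)) \<longlonglongrightarrow> 0" by (rule bexE)
  then show ?thesis by (rule that)
qed

end

section \<open>Membership and boundedness tested on combinations of kernels\<close>

context reproducing_kernel_hilbert_space
begin

definition kern :: "'a \<Rightarrow> 'a \<Rightarrow> complex" where
  "kern z = zero_ext S (\<lambda>w. K w z)"

definition comb :: "'a set \<Rightarrow> ('a \<Rightarrow> complex) \<Rightarrow> 'a \<Rightarrow> complex" where
  "comb F c = (\<lambda>x. \<Sum>w\<in>F. c w * kern w x)"

lemma kern_mem: "z \<in> S \<Longrightarrow> kern z \<in> H"
  unfolding kern_def by (rule kernel_mem)

lemma ip_kern: "f \<in> H \<Longrightarrow> z \<in> S \<Longrightarrow> ip f (kern z) = f z"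
  unfolding kern_def by (rule reproducing)

lemma comb_mem_ip:
  assumes "finite F" "F \<subseteq> S"
  shows "comb F c \<in> H" and "f \<in> H \<Longrightarrow> ip f (comb F c) = (\<Sum>w\<in>F. cnj (c w) * f w)"
proof -
  have "comb F c \<in> H \<and> (\<forall>f\<in>H. ip f (comb F c) = (\<Sum>w\<in>F. cnj (c w) * f w))"
    using assms
  proof (induction F)
    case empty
    have "comb {} c = 0" by (simp add: comb_def fun_eq_iff)
    moreover have "ip f 0 = 0" if "f \<in> H" for f
      using ip_commute[OF zero_mem that] zero_ip[OF that] by simp
    ultimately show ?case using zero_mem by (simp only: sum.empty) blast
  next
    case (insert z F)
    have eq: "comb (insert z F) c = (\<lambda>x. c z * kern z x) + comb F c"
      using insert by (simp add: comb_def fun_eq_iff)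
    have z: "z \<in> S" and F: "comb F c \<in> H" using insert by auto
    have cz: "(\<lambda>x. c z * kern z x) \<in> H" using z by (intro scale_mem kern_mem)
    show ?case
      unfolding eq
    proof (intro conjI ballI add_mem cz F)
      fix f assume f: "f \<in> H"
      have "ip f ((\<lambda>x. c z * kern z x) + comb F c) = cnj (c z) * f z + ip f (comb F c)"
        using ip_add_right[OF cz F f] ip_scale_right[OF f kern_mem[OF z]] ip_kern[OF f z] by simp
      then show "ip f ((\<lambda>x. c z * kern z x) + comb F c) = (\<Sum>w\<in>insert z F. cnj (c w) * f w)"
        using insert f by simp
    qed
  qed
  then show "comb F c \<in> H" and "f \<in> H \<Longrightarrow> ip f (comb F c) = (\<Sum>w\<in>F. cnj (c w) * f w)" by auto
qed

lemma eval_bound: "f \<in> H \<Longrightarrow> z \<in> S \<Longrightarrow> cmod (f z) \<le> nrm f * nrm (kern z)"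
  using cauchy_schwarz[OF _ kern_mem] ip_kern by metis

text \<open>Coefficients are extended by 0 to the union, so that combinations over different finite
  sets can be added; this makes the graph D in \<open>mem_if_bounded\<close> linear.\<close>

lemma sum_union_combine:
  fixes k :: "'a \<Rightarrow> complex"
  assumes "finite F" "finite G"
  shows "(\<Sum>w\<in>F \<union> G. ((if w \<in> F then c w else 0) + a * (if w \<in> G then d w else 0)) * k w) =
    (\<Sum>w\<in>F. c w * k w) + a * (\<Sum>w\<in>G. d w * k w)"
proof -
  have "(\<Sum>w\<in>F. c w * k w) = (\<Sum>w\<in>F \<union> G. (if w \<in> F then c w else 0) * k w)"
    using assms by (intro sum.mono_neutral_cong_left) auto
  moreover have "(\<Sum>w\<in>G. d w * k w) = (\<Sum>w\<in>F \<union> G. (if w \<in> G then d w else 0) * k w)"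
    using assms by (intro sum.mono_neutral_cong_left) auto
  ultimately show ?thesis
    by (simp only: sum_distrib_left sum.distrib[symmetric]) (simp add: algebra_simps)
qed

text \<open>A function whose pairing with the span of the kernels is bounded belongs to the space: it is the
  minimiser of \<open>\<parallel>g\<parallel>\<^sup>2 - 2 Re L(g)\<close> over the closure of that span, where \<open>L\<close> is the pairing.\<close>

theorem mem_if_bounded:
  assumes u: "zero_ext S u = u" and C: "0 \<le> C"
    and bound: "\<And>F c. finite F \<Longrightarrow> F \<subseteq> S \<Longrightarrow> cmod (\<Sum>w\<in>F. cnj (c w) * u w) \<le> C * nrm (comb F c)"
  shows "u \<in> H" and "nrm u \<le> C"
proof -
  \<comment> \<open>The graph of the pairing L on the span of the kernels, kept as a relation
    because one function may have several representations as a combination.\<close>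
  define D where "D = {(comb F c, \<Sum>w\<in>F. cnj (c w) * u w) | F c. finite F \<and> F \<subseteq> S}"
  \<comment> \<open>Formally |g - u|^2 - |u|^2, so that a minimising sequence approaches u.\<close>
  define J where "J q = (nrm (fst q))\<^sup>2 - 2 * Re (snd q)" for q :: "('a \<Rightarrow> complex) \<times> complex"
  have D_H: "g \<in> H" if "(g, l) \<in> D" for g l using that comb_mem_ip(1) by (auto simp: D_def)
  have D_bound: "cmod l \<le> C * nrm g" if "(g, l) \<in> D" for g l using that bound by (auto simp: D_def)
  have D_lin: "(g + (\<lambda>x. a * g' x), l + cnj a * l') \<in> D" if gl: "(g, l) \<in> D" "(g', l') \<in> D" for g l g' l' a
  proof -
    obtain F c where F: "finite F" "F \<subseteq> S" "g = comb F c" "l = (\<Sum>w\<in>F. cnj (c w) * u w)"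
      using gl(1) by (auto simp: D_def)
    obtain G d where G: "finite G" "G \<subseteq> S" "g' = comb G d" "l' = (\<Sum>w\<in>G. cnj (d w) * u w)"
      using gl(2) by (auto simp: D_def)
    define e where "e w = (if w \<in> F then c w else 0) + a * (if w \<in> G then d w else 0)" for w
    have "g + (\<lambda>x. a * g' x) = comb (F \<union> G) e"
      unfolding F(3) G(3) comb_def e_def using sum_union_combine[OF F(1) G(1)] by (simp add: fun_eq_iff)
    moreover have "l + cnj a * l' = (\<Sum>w\<in>F \<union> G. cnj (e w) * u w)"
    proof -
      have "cnj (e w) = (if w \<in> F then cnj (c w) else 0) + cnj a * (if w \<in> G then cnj (d w) else 0)" for w
        by (simp add: e_def)
      then show ?thesis unfolding F(4) G(4) by (simp only: sum_union_combine[OF F(1) G(1)])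
    qed
    ultimately show ?thesis unfolding D_def using F(1,2) G(1,2) by blast
  qed
  have D_0: "(0, 0) \<in> D"
    unfolding D_def by (intro CollectI exI[of _ "{}"]) (simp add: comb_def fun_eq_iff)
  have D_kern: "(kern w, u w) \<in> D" if "w \<in> S" for w
    unfolding D_def using that
    by (intro CollectI exI[of _ "{w}"] exI[of _ "\<lambda>_. 1"]) (simp add: comb_def)
  have J_lower: "- C\<^sup>2 \<le> J q" if "q \<in> D" for q
  proof -
    obtain g l where q: "q = (g, l)" by (metis surj_pair)
    have "Re l \<le> C * nrm g" using D_bound[of g l] that q complex_Re_le_cmod[of l] by simp
    moreover have "0 \<le> (nrm g - C)\<^sup>2" by simp
    ultimately show ?thesis by (simp add: J_def q power2_diff algebra_simps)
  qed
  then have bdd: "bdd_below (J ` D)" by (intro bdd_belowI2)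
  define I where "I = (INF q\<in>D. J q)"
  have I_le: "I \<le> J q" if "q \<in> D" for q unfolding I_def by (rule cINF_lower[OF bdd that])
  have "\<forall>n::nat. \<exists>q. q \<in> D \<and> J q < I + 1 / (real n + 1)"
  proof
    fix n :: nat
    have "(INF q\<in>D. J q) < I + 1 / (real n + 1)" unfolding I_def by simp
    then show "\<exists>q. q \<in> D \<and> J q < I + 1 / (real n + 1)"
      using D_0 bdd by (subst (asm) cINF_less_iff) auto
  qed
  then obtain q where "\<forall>n::nat. q n \<in> D \<and> J (q n) < I + 1 / (real n + 1)" by (rule choice[THEN exE])
  then have qD: "q n \<in> D" and qJ: "J (q n) < I + 1 / (real n + 1)" for n by blast+
  define g where "g n = fst (q n)" for n
  define l where "l n = snd (q n)" for n
  have gl: "(g n, l n) \<in> D" and J_gl: "(nrm (g n))\<^sup>2 - 2 * Re (l n) < I + 1 / (real n + 1)" for n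
    using qD[of n] qJ[of n] by (auto simp: g_def l_def J_def)
  have gH: "g n \<in> H" for n using D_H gl by blast
  \<comment> \<open>The mean of g m and g n is also in the graph, so its value of J is at least I;
    the parallelogram identity then bounds the distance of two near-minimisers.\<close>
  have cauchy: "(nrm (g m - g n))\<^sup>2 \<le> 2 / (real m + 1) + 2 / (real n + 1)" for m n
  proof -
    have "(g m + (\<lambda>x. 1 * g n x), l m + cnj 1 * l n) \<in> D" using D_lin gl by blast
    from D_lin[OF D_0 this, of "1/2"]
    have half: "((\<lambda>x. 1/2 * (g m + g n) x), 1/2 * (l m + l n)) \<in> D" by simp
    have "nrm (\<lambda>x. 1/2 * (g m + g n) x) = 1/2 * nrm (g m + g n)"
      using nrm_scale[OF add_mem[OF gH gH], of "1/2"] by (simp add: norm_divide)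
    moreover have "I \<le> (nrm (\<lambda>x. 1/2 * (g m + g n) x))\<^sup>2 - 2 * Re (1/2 * (l m + l n))"
      using I_le[OF half] unfolding J_def fst_conv snd_conv .
    ultimately have "I \<le> (1/2 * nrm (g m + g n))\<^sup>2 - 2 * Re (1/2 * (l m + l n))" by (simp only:)
    then have "I \<le> (nrm (g m + g n))\<^sup>2 / 4 - (Re (l m) + Re (l n))"
      by (simp add: power_divide add_divide_distrib)
    moreover have "(nrm (g m - g n))\<^sup>2 = 2 * (nrm (g m))\<^sup>2 + 2 * (nrm (g n))\<^sup>2 - (nrm (g m + g n))\<^sup>2"
      by (simp add: norm_square_plus norm_square_minus gH)
    ultimately show ?thesis using J_gl[of m] J_gl[of n] by simp
  qed
  obtain v where v: "v \<in> H" and lim: "(\<lambda>n. nrm (g n - v)) \<longlonglongrightarrow> 0"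
  proof (rule complete_nrm[of g, OF gH])
    fix e :: real assume e: "0 < e"
    obtain N where N: "1 / (real (Suc N)) < e\<^sup>2 / 4" using nat_approx_posE[of "e\<^sup>2 / 4"] e by auto
    have "nrm (g m - g n) < e" if "N \<le> m" "N \<le> n" for m n
    proof (rule power2_less_imp_less)
      have "1 / (real m + 1) \<le> 1 / real (Suc N)" "1 / (real n + 1) \<le> 1 / real (Suc N)"
        using that by (auto intro!: divide_left_mono)
      then show "(nrm (g m - g n))\<^sup>2 < e\<^sup>2" using cauchy[of m n] N by simp
    qed (use e in simp)
    then show "\<exists>N. \<forall>m\<ge>N. \<forall>n\<ge>N. nrm (g m - g n) < e" by blast
  qed (rule that)
  have vu: "v w = u w" if w: "w \<in> S" for w
  proof -
    have g_lim: "(\<lambda>n. g n w) \<longlonglongrightarrow> v w"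
    proof (rule LIM_zero_cancel, rule Lim_null_comparison)
      show "\<forall>\<^sub>F n in sequentially. norm (g n w - v w) \<le> nrm (g n - v) * nrm (kern w)"
        using eval_bound[OF diff_mem[OF gH v] w] by simp
      show "(\<lambda>n. nrm (g n - v) * nrm (kern w)) \<longlonglongrightarrow> 0" using lim by (rule tendsto_mult_left_zero)
    qed
    define d where "d = v w - u w"
    define \<kappa> where "\<kappa> = (nrm (kern w))\<^sup>2"
    \<comment> \<open>The first variation at a near-minimiser: adding a multiple of the kernel at w
      cannot push J below I.\<close>
    have ineq: "- (1 / (real n + 1)) \<le> 2 * Re (cnj a * (g n w - u w)) + (cmod a)\<^sup>2 * \<kappa>" for a n
    proof -
      have "I \<le> J (g n + (\<lambda>x. a * kern w x), l n + cnj a * u w)"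
        by (rule I_le[OF D_lin[OF gl D_kern[OF w]]])
      then have "I \<le> (nrm (g n))\<^sup>2 + 2 * Re (cnj a * g n w) + (cmod a)\<^sup>2 * \<kappa> - 2 * Re (l n) - 2 * Re (cnj a * u w)"
        using norm_square_add[OF gH kern_mem[OF w], of n a] ip_kern[OF gH w]
        by (simp add: J_def \<kappa>_def)
      then show ?thesis using J_gl[of n] by (simp add: algebra_simps)
    qed
    have lim_ineq: "0 \<le> 2 * Re (cnj a * d) + (cmod a)\<^sup>2 * \<kappa>" for a
    proof (rule LIMSEQ_le)
      show "(\<lambda>n. - (1 / (real n + 1))) \<longlonglongrightarrow> 0"
        using tendsto_minus[OF LIMSEQ_inverse_real_of_nat] by (simp add: inverse_eq_divide add.commute)
      show "(\<lambda>n. 2 * Re (cnj a * (g n w - u w)) + (cmod a)\<^sup>2 * \<kappa>) \<longlonglongrightarrow> 2 * Re (cnj a * d) + (cmod a)\<^sup>2 * \<kappa>"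
        unfolding d_def by (intro tendsto_intros g_lim)
    qed (use ineq in blast)
    \<comment> \<open>With a = - r d the limiting inequality reads 0 <= r |d|^2 (r \<kappa> - 2),
      and r \<kappa> < 1 forces d = 0. The + 1 covers \<kappa> = 0.\<close>
    define r where "r = 1 / (\<kappa> + 1)"
    have \<kappa>: "0 \<le> \<kappa>" by (simp add: \<kappa>_def)
    have r: "0 < r" "r * \<kappa> < 1" using \<kappa> by (auto simp: r_def)
    have "cnj (- complex_of_real r * d) * d = - complex_of_real (r * (cmod d)\<^sup>2)"
    proof -
      have "cnj d * d = complex_of_real ((cmod d)\<^sup>2)"
        unfolding complex_norm_square by (rule mult.commute)
      then show ?thesis by (simp add: mult.assoc)
    qed
    moreover have "(cmod (- complex_of_real r * d))\<^sup>2 = r\<^sup>2 * (cmod d)\<^sup>2"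
      by (simp add: norm_mult power_mult_distrib)
    ultimately have "0 \<le> 2 * Re (- complex_of_real (r * (cmod d)\<^sup>2)) + r\<^sup>2 * (cmod d)\<^sup>2 * \<kappa>"
      using lim_ineq[of "- complex_of_real r * d"] by (simp only:)
    then have "0 \<le> - 2 * r * (cmod d)\<^sup>2 + r\<^sup>2 * (cmod d)\<^sup>2 * \<kappa>" by simp
    also have "\<dots> = r * (cmod d)\<^sup>2 * (r * \<kappa> - 2)" by (simp add: power2_eq_square algebra_simps)
    finally have "r * (cmod d)\<^sup>2 * (2 - r * \<kappa>) \<le> 0" by (simp add: algebra_simps)
    then have "(cmod d)\<^sup>2 \<le> 0" using r by (simp add: mult_le_0_iff)
    then show ?thesis by (simp add: d_def)
  qed
  have "v = u"
  proof
    fix x show "v x = u x"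
      using vu supported[OF v] u by (cases "x \<in> S") (auto simp: zero_ext_def fun_eq_iff, metis)
  qed
  then show uH: "u \<in> H" using v by simp
  \<comment> \<open>Split the pairing of u with itself along u = (u - g n) + g n. The second part is
    l n, bounded by C times the norm of g n, and g n tends to u.\<close>
  have "(nrm u)\<^sup>2 \<le> C * nrm u"
  proof (rule LIMSEQ_le_const)
    show "(\<lambda>n. C * nrm u + (C + nrm u) * nrm (g n - u)) \<longlonglongrightarrow> C * nrm u"
      using tendsto_add[OF tendsto_const tendsto_mult_right_zero[OF lim[unfolded \<open>v = u\<close>]]] by simp
    have "(nrm u)\<^sup>2 \<le> C * nrm u + (C + nrm u) * nrm (g n - u)" for n
    proof -
      have du: "u - g n \<in> H" by (rule diff_mem[OF uH gH])
      have "ip u u = ip u (u - g n) + ip u (g n)"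
        using ip_add_right[OF du gH[of n] uH] by simp
      moreover have "ip u (g n) = l n"
        using gl[of n] comb_mem_ip(2)[OF _ _ uH] by (auto simp: D_def)
      ultimately have "(nrm u)\<^sup>2 = Re (ip u (u - g n)) + Re (l n)" by (simp add: norm_square[OF uH])
      moreover have "Re (ip u (u - g n)) \<le> nrm u * nrm (g n - u)"
        using cauchy_schwarz[OF uH du] complex_Re_le_cmod[of "ip u (u - g n)"] nrm_minus_commute[OF uH gH]
        by simp
      moreover have "Re (l n) \<le> C * nrm (g n)"
        using D_bound[OF gl[of n]] complex_Re_le_cmod[of "l n"] by linarith
      moreover have "C * nrm (g n) \<le> C * (nrm (g n - u) + nrm u)"
        using nrm_triangle[OF diff_mem[OF gH uH] uH, of n] C by (intro mult_left_mono) simp_all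
      ultimately show ?thesis by (simp add: algebra_simps)
    qed
    then show "\<exists>N. \<forall>n\<ge>N. (nrm u)\<^sup>2 \<le> C * nrm u + (C + nrm u) * nrm (g n - u)" by blast
  qed
  then show "nrm u \<le> C"
    using nrm_nonneg[OF uH] C by (cases "nrm u = 0") (auto simp: power2_eq_square)
qed

text \<open>The closed graph theorem for multiplication operators, by a gliding hump argument: if the
  operator norms of the functionals \<open>h \<mapsto> \<langle>f h, g n\<rangle>\<close> grow like \<open>4 ^ n\<close>, a series with increments
  of norm \<open>3 ^ -n\<close> can be steered to a point where all of them are large.\<close>

lemma multiplication_bounded:
  assumes f: "\<And>h. h \<in> H \<Longrightarrow> f * h \<in> H"
  shows "\<exists>C\<ge>0. \<forall>h\<in>H. nrm (f * h) \<le> C * nrm h"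
proof (rule ccontr)
  assume unb: "\<not> ?thesis"
  have f_add: "f * (a + b) = f * a + f * b" for a b by (simp add: fun_eq_iff algebra_simps)
  have f_scale: "f * (\<lambda>x. c * h x) = (\<lambda>x. c * (f * h) x)" for c h by (simp add: fun_eq_iff)
  \<comment> \<open>Otherwise R bounds the functionals of all normalised kernel combinations, and
    \<open>mem_if_bounded\<close> makes R a bound for multiplication by f. The witness g is such a
    combination, B the norm of its functional, and y a vector in the unit ball attaining three
    quarters of it.\<close>
  have big: "\<exists>g B y. g \<in> H \<and> nrm g \<le> 1 \<and> (\<forall>h\<in>H. cmod (ip (f * h) g) \<le> B * nrm h) \<and>
      y \<in> H \<and> nrm y \<le> 1 \<and> R < B \<and> 3/4 * B \<le> cmod (ip (f * y) g)" if R: "0 \<le> R" for R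
  proof (rule ccontr)
    assume no: "\<not> ?thesis"
    have comb_bound: "cmod (ip (f * h) (comb F c)) \<le> R * nrm h * nrm (comb F c)"
      if F: "finite F" "F \<subseteq> S" and h: "h \<in> H" for F c h
    proof (cases "nrm (comb F c) = 0")
      case True
      have "cmod (ip (f * h) (comb F c)) \<le> nrm (f * h) * nrm (comb F c)"
        by (rule cauchy_schwarz[OF f[OF h] comb_mem_ip(1)[OF F]])
      then show ?thesis using True by simp
    next
      case False
      define k where "k = nrm (comb F c)"
      have cF: "comb F c \<in> H" by (rule comb_mem_ip(1)[OF F])
      have k: "0 < k" using False nrm_nonneg[OF cF] by (simp add: k_def)
      define g where "g = (\<lambda>x. complex_of_real (1 / k) * comb F c x)"
      have g: "g \<in> H" unfolding g_def by (rule scale_mem[OF cF])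
      have g1: "nrm g = 1"
        unfolding g_def nrm_scale[OF cF] k_def[symmetric] using k by (simp add: norm_divide)
      have ip_g: "ip (f * h) g = complex_of_real (1 / k) * ip (f * h) (comb F c)" if "h \<in> H" for h
        unfolding g_def using ip_scale_right[OF f[OF that] cF, of "complex_of_real (1 / k)"] by simp
      \<comment> \<open>Pairing with a kernel combination is a finite sum of point evaluations, so C
        is some finite bound; B below is the exact norm.\<close>
      define C where "C = (1 / k) * (\<Sum>w\<in>F. cmod (c w) * (cmod (f w) * nrm (kern w)))"
      have C: "cmod (ip (f * h) g) \<le> C * nrm h" if h: "h \<in> H" for h
      proof -
        have "cmod (ip (f * h) (comb F c)) \<le> (\<Sum>w\<in>F. cmod (cnj (c w) * (f * h) w))"
          unfolding comb_mem_ip(2)[OF F f[OF h]] by (rule norm_sum)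
        also have "\<dots> \<le> (\<Sum>w\<in>F. cmod (c w) * (cmod (f w) * (nrm h * nrm (kern w))))"
          using F eval_bound[OF h] by (intro sum_mono) (auto simp: norm_mult intro!: mult_left_mono)
        also have "\<dots> = k * (C * nrm h)"
          using k by (simp add: C_def sum_distrib_right sum_distrib_left mult_ac)
        finally show ?thesis unfolding ip_g[OF h] using k by (simp add: norm_mult norm_divide field_simps)
      qed
      define A where "A = (\<lambda>y. cmod (ip (f * y) g)) ` {y \<in> H. nrm y \<le> 1}"
      define B where "B = Sup A"
      have C0: "0 \<le> C"
      proof -
        have "0 \<le> (\<Sum>w\<in>F. cmod (c w) * (cmod (f w) * nrm (kern w)))"
          using F kern_mem nrm_nonneg by (intro sum_nonneg mult_nonneg_nonneg) auto
        then show ?thesis using k by (simp add: C_def)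
      qed
      have A_bdd: "bdd_above A"
        unfolding A_def
      proof (rule bdd_aboveI2)
        fix y assume "y \<in> {y \<in> H. nrm y \<le> 1}"
        then have y: "y \<in> H" "nrm y \<le> 1" by auto
        have "C * nrm y \<le> C * 1" using y(2) C0 by (rule mult_left_mono)
        then have "cmod (ip (f * y) g) \<le> C * 1" using C[OF y(1)] by linarith
        then show "cmod (ip (f * y) g) \<le> C" by simp
      qed
      have A_le: "cmod (ip (f * y) g) \<le> B" if "y \<in> H" "nrm y \<le> 1" for y
        unfolding B_def using that by (intro cSup_upper A_bdd) (auto simp: A_def)
      have B_bound: "cmod (ip (f * y) g) \<le> B * nrm y" if y: "y \<in> H" for y
      proof (cases "nrm y = 0")
        case True then show ?thesis using C[OF y] by simp
      next
        case False
        then have pos: "0 < nrm y" using nrm_nonneg[OF y] by simp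
        let ?y = "\<lambda>x. complex_of_real (1 / nrm y) * y x"
        have "cmod (ip (f * ?y) g) \<le> B"
          using pos nrm_scale[OF y, of "complex_of_real (1 / nrm y)"]
          by (intro A_le scale_mem y) (simp add: norm_divide)
        then have "cmod (complex_of_real (1 / nrm y) * ip (f * y) g) \<le> B"
          unfolding f_scale ip_scale[OF f[OF y] g] .
        then show ?thesis using pos by (simp add: norm_mult norm_divide field_simps)
      qed
      have B_le: "B \<le> R"
      proof (rule ccontr)
        assume "\<not> B \<le> R"
        then have RB: "R < B" by simp
        then have "3/4 * B < Sup A" using R by (simp add: B_def)
        moreover have "A \<noteq> {}" using zero_mem by (auto simp: A_def nrm_0 intro!: exI[of _ 0])
        ultimately obtain a where "a \<in> A" "3/4 * B < a" using less_cSupE by blast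
        then obtain y where "y \<in> H" "nrm y \<le> 1" "3/4 * B \<le> cmod (ip (f * y) g)"
          by (auto simp: A_def)
        then have "g \<in> H \<and> nrm g \<le> 1 \<and> (\<forall>h\<in>H. cmod (ip (f * h) g) \<le> B * nrm h) \<and>
            y \<in> H \<and> nrm y \<le> 1 \<and> R < B \<and> 3/4 * B \<le> cmod (ip (f * y) g)"
          using g g1 B_bound RB by simp
        with no show False by blast
      qed
      have "cmod (ip (f * h) g) \<le> R * nrm h"
        using B_bound[OF h] mult_right_mono[OF B_le nrm_nonneg[OF h]] by linarith
      then have "cmod (ip (f * h) (comb F c)) / k \<le> R * nrm h"
        unfolding ip_g[OF h] using k by (simp add: norm_mult norm_divide)
      then show ?thesis unfolding k_def[symmetric] using k by (simp add: field_simps)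
    qed
    have "nrm (f * h) \<le> R * nrm h" if h: "h \<in> H" for h
    proof (rule mem_if_bounded(2))
      show "zero_ext S (f * h) = f * h" by (rule supported[OF f[OF h]])
      show "0 \<le> R * nrm h" using R nrm_nonneg[OF h] by simp
      show "cmod (\<Sum>w\<in>F. cnj (c w) * (f * h) w) \<le> R * nrm h * nrm (comb F c)"
        if "finite F" "F \<subseteq> S" for F c
        using comb_bound[OF that h, of c] unfolding comb_mem_ip(2)[OF that f[OF h]] .
    qed
    then show False using unb R by blast
  qed
  have "\<forall>n::nat. \<exists>q. case q of (g, B, y) \<Rightarrow> g \<in> H \<and> nrm g \<le> 1 \<and> (\<forall>h\<in>H. cmod (ip (f * h) g) \<le> B * nrm h) \<and>
      y \<in> H \<and> nrm y \<le> 1 \<and> 4 ^ n < B \<and> 3/4 * B \<le> cmod (ip (f * y) g)"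
  proof
    fix n :: nat
    obtain g B y where "g \<in> H \<and> nrm g \<le> 1 \<and> (\<forall>h\<in>H. cmod (ip (f * h) g) \<le> B * nrm h) \<and>
      y \<in> H \<and> nrm y \<le> 1 \<and> 4 ^ n < B \<and> 3/4 * B \<le> cmod (ip (f * y) g)"
      using big[of "4 ^ n"] by auto
    then show "\<exists>q. case q of (g, B, y) \<Rightarrow> g \<in> H \<and> nrm g \<le> 1 \<and> (\<forall>h\<in>H. cmod (ip (f * h) g) \<le> B * nrm h) \<and>
      y \<in> H \<and> nrm y \<le> 1 \<and> 4 ^ n < B \<and> 3/4 * B \<le> cmod (ip (f * y) g)"
      by (intro exI[of _ "(g, B, y)"]) simp
  qed
  then obtain q where q: "\<forall>n::nat. case q n of (g, B, y) \<Rightarrow> g \<in> H \<and> nrm g \<le> 1 \<and> (\<forall>h\<in>H. cmod (ip (f * h) g) \<le> B * nrm h) \<and>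
      y \<in> H \<and> nrm y \<le> 1 \<and> 4 ^ n < B \<and> 3/4 * B \<le> cmod (ip (f * y) g)"
    by (rule choice[THEN exE])
  define g where "g n = fst (q n)" for n
  define B where "B n = fst (snd (q n))" for n
  define y where "y n = snd (snd (q n))" for n
  have gH: "g n \<in> H" and g1: "nrm (g n) \<le> 1" and gB: "\<And>h. h \<in> H \<Longrightarrow> cmod (ip (f * h) (g n)) \<le> B n * nrm h"
    and yH: "y n \<in> H" and y1: "nrm (y n) \<le> 1" and B4: "4 ^ n < B n"
    and gy: "3/4 * B n \<le> cmod (ip (f * y n) (g n))" for n
  proof -
    have qn: "q n = (g n, B n, y n)" by (simp add: g_def B_def y_def)
    have "g n \<in> H \<and> nrm (g n) \<le> 1 \<and> (\<forall>h\<in>H. cmod (ip (f * h) (g n)) \<le> B n * nrm h) \<and>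
      y n \<in> H \<and> nrm (y n) \<le> 1 \<and> 4 ^ n < B n \<and> 3/4 * B n \<le> cmod (ip (f * y n) (g n))"
      using spec[OF q, of n] unfolding qn prod.case .
    then show "g n \<in> H" "nrm (g n) \<le> 1" "\<And>h. h \<in> H \<Longrightarrow> cmod (ip (f * h) (g n)) \<le> B n * nrm h"
      "y n \<in> H" "nrm (y n) \<le> 1" "4 ^ n < B n" "3/4 * B n \<le> cmod (ip (f * y n) (g n))"
      by blast+
  qed
  define st where "st n v a = v + (\<lambda>z. (a * complex_of_real ((1/3)^n)) * y n z)" for n v a
  \<comment> \<open>The two candidate values of the n-th functional differ by twice 3^-n times its
    value at y n, so one of them has modulus at least 3^-n times that of the latter. The sign is
    chosen accordingly.\<close>
  define x where "x = rec_nat 0 (\<lambda>n v. st n v (if (1/3)^n * cmod (ip (f * y n) (g n)) \<le> cmod (ip (f * st n v 1) (g n)) then 1 else - 1))"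
  have st_H: "st n v a \<in> H" if "v \<in> H" for n v a
    unfolding st_def using that by (intro add_mem scale_mem yH)
  have x_step: "x (Suc n) = st n (x n) (if (1/3)^n * cmod (ip (f * y n) (g n)) \<le> cmod (ip (f * st n (x n) 1) (g n)) then 1 else - 1)" for n
    by (simp add: x_def)
  have x_Suc: "\<exists>a. cmod a = 1 \<and> x (Suc n) = st n (x n) a" for n
  proof -
    let ?a = "if (1/3)^n * cmod (ip (f * y n) (g n)) \<le> cmod (ip (f * st n (x n) 1) (g n)) then 1 else - 1 :: complex"
    have "cmod ?a = 1 \<and> x (Suc n) = st n (x n) ?a" using x_step[of n] by simp
    then show ?thesis by (rule exI)
  qed
  have xH: "x n \<in> H" for n
  proof (induction n)
    case 0
    have "x 0 = 0" by (simp only: x_def old.nat.simps(6))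
    then show ?case using zero_mem by (simp only:)
  next
    case (Suc n)
    then show ?case unfolding x_step by (rule st_H)
  qed
  have ip_st: "ip (f * st n v a) (g n) = ip (f * v) (g n) + a * complex_of_real ((1/3)^n) * ip (f * y n) (g n)"
    if v: "v \<in> H" for n v a
  proof -
    have "f * st n v a = f * v + (\<lambda>z. (a * complex_of_real ((1/3)^n)) * (f * y n) z)"
      unfolding st_def f_add f_scale ..
    then show ?thesis
      using ip_add[OF f[OF v] scale_mem[OF f[OF yH]] gH] ip_scale[OF f[OF yH] gH] by simp
  qed
  have hump: "(1/3)^n * cmod (ip (f * y n) (g n)) \<le> cmod (ip (f * x (Suc n)) (g n))" for n
  proof (cases "(1/3)^n * cmod (ip (f * y n) (g n)) \<le> cmod (ip (f * st n (x n) 1) (g n))")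
    case True
    then have "x (Suc n) = st n (x n) 1" by (simp only: x_step if_True)
    then show ?thesis using True by simp
  next
    case False
    then have "x (Suc n) = st n (x n) (-1)" by (simp only: x_step if_False)
    moreover have "2 * ((1/3)^n * cmod (ip (f * y n) (g n)))
        \<le> cmod (ip (f * st n (x n) 1) (g n)) + cmod (ip (f * st n (x n) (-1)) (g n))"
    proof -
      have "ip (f * st n (x n) 1) (g n) - ip (f * st n (x n) (-1)) (g n)
          = 2 * complex_of_real ((1/3)^n) * ip (f * y n) (g n)"
        by (simp add: ip_st[OF xH] algebra_simps)
      then have "cmod (ip (f * st n (x n) 1) (g n) - ip (f * st n (x n) (-1)) (g n))
          = 2 * ((1/3)^n * cmod (ip (f * y n) (g n)))"
        by (simp add: norm_mult norm_power norm_divide)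
      then show ?thesis by (metis norm_triangle_ineq4)
    qed
    ultimately show ?thesis using False by simp
  qed
  have step: "nrm (x (Suc n) - x n) \<le> (1/3)^n" for n
  proof -
    obtain a where a: "cmod a = 1" "x (Suc n) = st n (x n) a" using x_Suc by blast
    have "x (Suc n) - x n = (\<lambda>z. (a * complex_of_real ((1/3)^n)) * y n z)"
      unfolding a(2) st_def by (simp add: fun_eq_iff)
    then have "nrm (x (Suc n) - x n) = (1/3)^n * nrm (y n)"
      using nrm_scale[OF yH] a(1) by (simp add: norm_mult norm_power norm_divide)
    then show ?thesis using y1[of n] by (simp add: mult_left_le)
  qed
  have tail: "nrm (x (n + k) - x n) \<le> 3/2 * ((1/3)^n - (1/3)^(n + k))" for n k
  proof (induction k)
    case 0
    have "x (n + 0) - x n = 0" by simp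
    then show ?case unfolding \<open>x (n + 0) - x n = 0\<close> nrm_0 by simp
  next
    case (Suc k)
    have "nrm (x (n + Suc k) - x n) \<le> nrm (x (Suc (n + k)) - x (n + k)) + nrm (x (n + k) - x n)"
      unfolding add_Suc_right by (rule nrm_triangle_diff[OF xH xH xH])
    moreover have "(1/3 :: real)^(n + Suc k) = (1/3)^(n + k) / 3" by simp
    moreover have "D \<le> s + t \<Longrightarrow> c = b / 3 \<Longrightarrow> t \<le> 3/2 * (a - b) \<Longrightarrow> s \<le> b \<Longrightarrow> D \<le> 3/2 * (a - c)"
      for D s t a b c :: real by (simp add: algebra_simps)
    ultimately show ?case using Suc.IH step[of "n + k"] by blast
  qed
  have tail': "nrm (x (n + k) - x n) \<le> 3/2 * (1/3)^n" for n k
  proof -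
    have "0 \<le> (1/3 :: real)^(n + k)" by simp
    moreover have "0 \<le> b \<Longrightarrow> D \<le> 3/2 * (a - b) \<Longrightarrow> D \<le> 3/2 * a" for D a b :: real
      by (simp add: algebra_simps)
    ultimately show ?thesis using tail[of n k] by blast
  qed
  obtain v where v: "v \<in> H" and lim: "(\<lambda>n. nrm (x n - v)) \<longlonglongrightarrow> 0"
  proof (rule complete_nrm[of x, OF xH])
    fix e :: real assume e: "0 < e"
    have "(\<lambda>n. 3 * (1/3 :: real)^n) \<longlonglongrightarrow> 3 * 0" by (intro tendsto_intros LIMSEQ_power_zero) simp
    then have "\<forall>\<^sub>F n in sequentially. 3 * (1/3 :: real)^n < e"
      using e by (intro order_tendstoD(2)) auto
    then obtain N where N: "3 * (1/3 :: real)^N < e" by (auto simp: eventually_sequentially)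
    have "nrm (x m - x n) < e" if "N \<le> m" "N \<le> n" for m n
    proof -
      have "nrm (x m - x n) \<le> nrm (x m - x N) + nrm (x n - x N)"
        using nrm_triangle_diff[OF xH[of m] xH[of N] xH[of n]] unfolding nrm_minus_commute[OF xH[of N] xH[of n]] .
      moreover have "nrm (x m - x N) \<le> 3/2 * (1/3)^N" "nrm (x n - x N) \<le> 3/2 * (1/3)^N"
        using tail'[of N "m - N"] tail'[of N "n - N"] unfolding le_add_diff_inverse[OF that(1)] le_add_diff_inverse[OF that(2)] .
      moreover have "D \<le> s + t \<Longrightarrow> s \<le> 3/2 * c \<Longrightarrow> t \<le> 3/2 * c \<Longrightarrow> 3 * c < e \<Longrightarrow> D < e"
        for D s t c :: real by simp
      ultimately show ?thesis using N by blast
    qed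
    then show "\<exists>N. \<forall>m\<ge>N. \<forall>n\<ge>N. nrm (x m - x n) < e" by blast
  qed (rule that)
  \<comment> \<open>The increments after x (Suc n) are at most 3^-(n+1), 3^-(n+2), and so on, with
    sum 3^-n / 2.\<close>
  have close: "nrm (x (Suc n) - v) \<le> 1/2 * (1/3)^n" for n
  proof (rule LIMSEQ_le_const)
    have "(\<lambda>k. nrm (x (k + Suc n) - v)) \<longlonglongrightarrow> 0" by (rule LIMSEQ_ignore_initial_segment[OF lim])
    from tendsto_add[OF tendsto_const this]
    show "(\<lambda>k. 1/2 * (1/3)^n + nrm (x (k + Suc n) - v)) \<longlonglongrightarrow> 1/2 * (1/3)^n" by simp
    have "nrm (x (Suc n) - v) \<le> 1/2 * (1/3)^n + nrm (x (k + Suc n) - v)" for k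
    proof -
      have "nrm (x (Suc n) - v) \<le> nrm (x (k + Suc n) - x (Suc n)) + nrm (x (k + Suc n) - v)"
        using nrm_triangle_diff[OF xH[of "Suc n"] xH[of "k + Suc n"] v] unfolding nrm_minus_commute[OF xH[of "Suc n"] xH[of "k + Suc n"]] .
      moreover have "nrm (x (k + Suc n) - x (Suc n)) \<le> 3/2 * (1/3)^Suc n"
        using tail'[of "Suc n" k] unfolding add.commute[of "Suc n" k] .
      moreover have "3/2 * (1/3 :: real)^Suc n = 1/2 * (1/3)^n" by simp
      ultimately show ?thesis by linarith
    qed
    then show "\<exists>N. \<forall>k\<ge>N. nrm (x (Suc n) - v) \<le> 1/2 * (1/3)^n + nrm (x (k + Suc n) - v)" by blast
  qed
  \<comment> \<open>The hump contributes at least three quarters of 3^-n B n, and the later steps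
    take away at most one half of it. A quarter remains, and B n > 4^n.\<close>
  have large: "1/4 * (4/3)^n \<le> nrm (f * v)" for n
  proof -
    have B0: "0 < B n" using B4[of n] by (rule less_trans[rotated]) simp
    have "f * x (Suc n) = f * (x (Suc n) - v) + f * v" by (simp add: fun_eq_iff algebra_simps)
    then have "ip (f * x (Suc n)) (g n) = ip (f * (x (Suc n) - v)) (g n) + ip (f * v) (g n)"
      using ip_add[OF f[OF diff_mem[OF xH v]] f[OF v] gH] by (simp only:)
    then have "cmod (ip (f * x (Suc n)) (g n)) \<le> cmod (ip (f * (x (Suc n) - v)) (g n)) + cmod (ip (f * v) (g n))"
      by (simp only: norm_triangle_ineq)
    moreover have "cmod (ip (f * (x (Suc n) - v)) (g n)) \<le> B n * (1/2 * (1/3)^n)"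
      using order_trans[OF gB[OF diff_mem[OF xH v]] mult_left_mono[OF close less_imp_le[OF B0]]] .
    moreover have "cmod (ip (f * v) (g n)) \<le> nrm (f * v)"
      using cauchy_schwarz[OF f[OF v] gH[of n]] mult_left_le[OF g1[of n] nrm_nonneg[OF f[OF v]]] by linarith
    moreover have "(1/3)^n * (3/4 * B n) \<le> (1/3)^n * cmod (ip (f * y n) (g n))"
      using gy by (intro mult_left_mono) simp_all
    ultimately have "(1/3)^n * (3/4 * B n) \<le> B n * (1/2 * (1/3)^n) + nrm (f * v)"
      using hump[of n] by linarith
    then have "1/4 * ((1/3)^n * B n) \<le> nrm (f * v)" by (simp add: algebra_simps)
    moreover have "(1/3)^n * 4^n \<le> (1/3)^n * B n" using B4[of n] by (intro mult_left_mono) simp_all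
    moreover have "(1/3 :: real)^n * 4^n = (4/3)^n" by (simp add: power_divide)
    ultimately show ?thesis by linarith
  qed
  obtain n where "4 * nrm (f * v) < (4/3 :: real)^n" using real_arch_pow[of "4/3"] by auto
  then show False using large[of n] by simp
qed

end


section \<open>Multipliers of the Drury--Arveson space\<close>

lemma zero_ext_mem [simp]: "x \<in> S \<Longrightarrow> zero_ext S f x = f x"
  and zero_ext_off [simp]: "x \<notin> S \<Longrightarrow> zero_ext S f x = 0"
  by (simp_all add: zero_ext_def)

lemma zero_ext_eq_iff: "zero_ext S f = f \<longleftrightarrow> (\<forall>x. x \<notin> S \<longrightarrow> f x = 0)"
  by (auto simp: zero_ext_def fun_eq_iff)

lemma analytic_funsI:
  assumes "\<And>x. x \<notin> S \<Longrightarrow> f x = 0"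
    and "\<And>z. z \<in> S \<Longrightarrow> \<exists>D. (f has_derivative D) (at z) \<and> (\<forall>c v. D (c *s v) = c * D v)"
  shows "f \<in> analytic_funs S"
  using assms by (simp add: analytic_funs_def zero_ext_eq_iff)

lemma analytic_funs_off: "f \<in> analytic_funs S \<Longrightarrow> x \<notin> S \<Longrightarrow> f x = 0"
  by (simp add: analytic_funs_def zero_ext_eq_iff)

lemma analytic_funs_deriv:
  assumes "f \<in> analytic_funs S" "z \<in> S"
  obtains D where "(f has_derivative D) (at z)" "\<And>c v. D (c *s v) = c * D v"
  using assms by (auto simp: analytic_funs_def)

lemma analytic_funs_add:
  assumes f: "f \<in> analytic_funs S" and g: "g \<in> analytic_funs S" shows "f + g \<in> analytic_funs S"
proof (rule analytic_funsI)
  fix z assume z: "z \<in> S"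
  obtain D where D: "(f has_derivative D) (at z)" "\<And>c v. D (c *s v) = c * D v"
    by (rule analytic_funs_deriv[OF f z]) (rule that)
  obtain D' where D': "(g has_derivative D') (at z)" "\<And>c v. D' (c *s v) = c * D' v"
    by (rule analytic_funs_deriv[OF g z]) (rule that)
  have "((\<lambda>x. f x + g x) has_derivative (\<lambda>v. D v + D' v)) (at z)"
    by (rule has_derivative_add[OF D(1) D'(1)])
  moreover have "(\<lambda>x. f x + g x) = f + g" by (simp add: fun_eq_iff)
  ultimately show "\<exists>D. (f + g has_derivative D) (at z) \<and> (\<forall>c v. D (c *s v) = c * D v)"
    using D(2) D'(2) by (intro exI[of _ "\<lambda>v. D v + D' v"]) (simp add: distrib_left)
qed (use assms in \<open>simp add: analytic_funs_off\<close>)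

lemma analytic_funs_mult:
  assumes f: "f \<in> analytic_funs S" and g: "g \<in> analytic_funs S" shows "f * g \<in> analytic_funs S"
proof (rule analytic_funsI)
  fix z assume z: "z \<in> S"
  obtain D where D: "(f has_derivative D) (at z)" "\<And>c v. D (c *s v) = c * D v"
    by (rule analytic_funs_deriv[OF f z]) (rule that)
  obtain D' where D': "(g has_derivative D') (at z)" "\<And>c v. D' (c *s v) = c * D' v"
    by (rule analytic_funs_deriv[OF g z]) (rule that)
  have "((\<lambda>x. f x * g x) has_derivative (\<lambda>v. f z * D' v + D v * g z)) (at z)"
    by (rule has_derivative_mult[OF D(1) D'(1)])
  moreover have "(\<lambda>x. f x * g x) = f * g" by (simp add: fun_eq_iff)
  ultimately show "\<exists>D. (f * g has_derivative D) (at z) \<and> (\<forall>c v. D (c *s v) = c * D v)"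
    using D(2) D'(2) by (intro exI[of _ "\<lambda>v. f z * D' v + D v * g z"]) (simp add: algebra_simps)
qed (use assms in \<open>simp add: analytic_funs_off\<close>)

lemma analytic_funs_zero_ext:
  assumes S: "open S" and F: "\<And>z. z \<in> S \<Longrightarrow> (F has_derivative D z) (at z)"
    and lin: "\<And>z c v. D z (c *s v) = c * D z v"
  shows "zero_ext S F \<in> analytic_funs S"
proof (rule analytic_funsI)
  fix z assume z: "z \<in> S"
  have "(zero_ext S F has_derivative D z) (at z)"
    by (rule has_derivative_transform_within_open[OF F[OF z] S z]) simp
  then show "\<exists>D. (zero_ext S F has_derivative D) (at z) \<and> (\<forall>c v. D (c *s v) = c * D v)"
    using lin by blast
qed simp

lemma analytic_funs_const: "open S \<Longrightarrow> zero_ext S (\<lambda>z. c) \<in> analytic_funs S"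
  by (rule analytic_funs_zero_ext[where D = "\<lambda>z v. 0"]) auto

lemma analytic_funs_coord: "open S \<Longrightarrow> zero_ext S (\<lambda>z. z $ i) \<in> analytic_funs S"
  by (rule analytic_funs_zero_ext[where D = "\<lambda>z v. v $ i"])
    (auto intro!: bounded_linear_imp_has_derivative bounded_linear_vec_nth)

lemma analytic_funs_scale:
  assumes "open S" "f \<in> analytic_funs S" shows "(\<lambda>x. c * f x) \<in> analytic_funs S"
proof -
  have "zero_ext S (\<lambda>z. c) * f = (\<lambda>x. c * f x)"
    using assms(2) by (auto simp: fun_eq_iff zero_ext_def analytic_funs_off)
  then show ?thesis using analytic_funs_mult[OF analytic_funs_const[OF assms(1), of c] assms(2)] by (simp only:)
qed

lemma cmod_sum_cnj_le: "cmod (\<Sum>i\<in>UNIV. w $ i * cnj (z $ i)) \<le> norm w * norm (z :: complex ^ 'd)"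
proof -
  have "cmod (\<Sum>i\<in>UNIV. w $ i * cnj (z $ i)) \<le> (\<Sum>i\<in>UNIV. \<bar>cmod (w $ i)\<bar> * \<bar>cmod (z $ i)\<bar>)"
    by (rule order_trans[OF norm_sum]) (simp add: norm_mult)
  also have "\<dots> \<le> L2_set (\<lambda>i. cmod (w $ i)) UNIV * L2_set (\<lambda>i. cmod (z $ i)) UNIV"
    by (rule L2_set_mult_ineq)
  finally show ?thesis by (simp add: norm_vec_def)
qed

text \<open>The geometric series identity k = 1 + <w, z> k, valid because |<w, z>| < 1 on the ball.
  It splits the kernel into a rank-one part and one part per coordinate, which is the source of
  contractivity.\<close>

lemma drury_arveson_kernel_eq:
  assumes "norm w < 1" "norm z < 1"
  shows "drury_arveson_kernel w z = 1 + (\<Sum>i\<in>UNIV. w $ i * cnj (z $ i) * drury_arveson_kernel w z)"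
proof -
  let ?s = "\<Sum>i\<in>UNIV. w $ i * cnj (z $ i)"
  have "norm w * norm z \<le> norm w * 1" using assms by (intro mult_left_mono) auto
  then have "cmod ?s < 1" using cmod_sum_cnj_le[of w z] assms by linarith
  then have "?s \<noteq> 1" by auto
  then have "drury_arveson_kernel w z * (1 - ?s) = 1" by (simp add: drury_arveson_kernel_def)
  then have "drury_arveson_kernel w z = 1 + ?s * drury_arveson_kernel w z" by (simp add: algebra_simps)
  then show ?thesis by (simp add: sum_distrib_right)
qed

context drury_arveson_space
begin

abbreviation "coord i \<equiv> zero_ext (ball 0 1) (\<lambda>z. z $ i)"
abbreviation "mnorm \<equiv> multiplier_norm H ip"

lemma ip_comb_self:
  assumes F: "finite F" "F \<subseteq> ball 0 1"
  shows "ip (comb F c) (comb F c) = (\<Sum>v\<in>F. \<Sum>w\<in>F. cnj (c v) * (c w * drury_arveson_kernel v w))"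
proof -
  have "comb F c v = (\<Sum>w\<in>F. c w * drury_arveson_kernel v w)" if "v \<in> F" for v
    using that F unfolding comb_def kern_def by (intro sum.cong) auto
  then show ?thesis
    unfolding comb_mem_ip(2)[OF F comb_mem_ip(1)[OF F]]
    by (intro sum.cong refl) (simp only: sum_distrib_left)
qed

text \<open>Positivity of the kernel \<open>(1 - w\<^sub>i z\<^sub>i\<^sup>*) k(w, z) = 1 + (\<Sum>l \<noteq> i. w\<^sub>l z\<^sub>l\<^sup>* k(w, z))\<close>, in quadratic form.\<close>

lemma nrm_comb_coord_le:
  assumes F: "finite F" "F \<subseteq> ball 0 1"
  shows "nrm (comb F (\<lambda>w. c w * cnj (w $ i))) \<le> nrm (comb F c)"
proof (rule power2_le_imp_le)
  let ?K = "drury_arveson_kernel"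
  let ?c = "\<lambda>l w. c w * cnj (w $ l)"
  have mem: "comb F d \<in> H" for d by (rule comb_mem_ip(1)[OF F])
  have "ip (comb F c) (comb F c) = (\<Sum>v\<in>F. \<Sum>w\<in>F. cnj (c v) * (c w * ?K v w))"
    by (rule ip_comb_self[OF F])
  also have "\<dots> = (\<Sum>v\<in>F. \<Sum>w\<in>F. cnj (c v) * c w + (\<Sum>l\<in>UNIV. cnj (?c l v) * (?c l w * ?K v w)))"
  proof (intro sum.cong refl)
    fix v w assume "v \<in> F" "w \<in> F"
    then have "norm v < 1" "norm w < 1" using F by auto
    then have "cnj (c v) * (c w * ?K v w) = cnj (c v) * (c w * (1 + (\<Sum>l\<in>UNIV. v $ l * cnj (w $ l) * ?K v w)))"
      by (simp only: drury_arveson_kernel_eq[symmetric])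
    then show "cnj (c v) * (c w * ?K v w) = cnj (c v) * c w + (\<Sum>l\<in>UNIV. cnj (?c l v) * (?c l w * ?K v w))"
      by (simp add: distrib_left sum_distrib_left mult_ac)
  qed
  also have "\<dots> = (\<Sum>v\<in>F. \<Sum>w\<in>F. cnj (c v) * c w) + (\<Sum>v\<in>F. \<Sum>w\<in>F. \<Sum>l\<in>UNIV. cnj (?c l v) * (?c l w * ?K v w))"
    by (simp only: sum.distrib)
  also have "(\<Sum>v\<in>F. \<Sum>w\<in>F. cnj (c v) * c w) = cnj (\<Sum>v\<in>F. c v) * (\<Sum>w\<in>F. c w)"
    by (simp only: cnj_sum sum_product)
  also have "(\<Sum>v\<in>F. \<Sum>w\<in>F. \<Sum>l\<in>UNIV. cnj (?c l v) * (?c l w * ?K v w))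
      = (\<Sum>l\<in>UNIV. \<Sum>v\<in>F. \<Sum>w\<in>F. cnj (?c l v) * (?c l w * ?K v w))"
    by (subst sum.swap[of _ UNIV F]) (intro sum.cong refl sum.swap)
  also have "\<dots> = (\<Sum>l\<in>UNIV. ip (comb F (?c l)) (comb F (?c l)))"
    by (simp only: ip_comb_self[OF F])
  \<comment> \<open>Thus the squared norm of \<open>comb F c\<close> is the squared modulus of the
    sum of c plus the squared norms of all \<open>comb F (?c l)\<close>; dropping everything but l =
    i gives the claim.\<close>
  finally have sum: "Re (ip (comb F c) (comb F c)) = Re (cnj (\<Sum>v\<in>F. c v) * (\<Sum>w\<in>F. c w))
      + (\<Sum>l\<in>UNIV. Re (ip (comb F (?c l)) (comb F (?c l))))"
    by (simp only: plus_complex.sel Re_sum)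
  have nonneg: "0 \<le> Re (cnj a * a)" for a :: complex by simp
  have le: "Re (ip (comb F (?c i)) (comb F (?c i))) \<le> (\<Sum>l\<in>UNIV. Re (ip (comb F (?c l)) (comb F (?c l))))"
    by (rule member_le_sum[of i UNIV "\<lambda>l. Re (ip (comb F (?c l)) (comb F (?c l)))"])
      (simp_all only: UNIV_I finite ip_nonneg[OF mem])
  have arith: "P = X + Y \<Longrightarrow> 0 \<le> X \<Longrightarrow> Z \<le> Y \<Longrightarrow> Z \<le> P" for P X Y Z :: real by simp
  have "Re (ip (comb F (?c i)) (comb F (?c i))) \<le> Re (ip (comb F c) (comb F c))"
    by (rule arith[OF sum nonneg le])
  then show "(nrm (comb F (?c i)))\<^sup>2 \<le> (nrm (comb F c))\<^sup>2"
    by (simp only: norm_square[OF mem])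
  show "0 \<le> nrm (comb F c)" by (rule nrm_nonneg[OF mem])
qed

text \<open>The adjoint of multiplication by the i-th coordinate multiplies the coefficient at w by
  the conjugate of \<open>w $ i\<close>, which does not increase norms by
  \<open>nrm_comb_coord_le\<close>. As the product is not known beforehand to lie in H, the bound
  goes through \<open>mem_if_bounded\<close>.\<close>

lemma coord_contractive:
  assumes h: "h \<in> H" shows "coord i * h \<in> H" and "nrm (coord i * h) \<le> nrm h"
proof -
  have off: "zero_ext (ball 0 1) (coord i * h) = coord i * h"
    by (simp add: zero_ext_eq_iff)
  have bound: "cmod (\<Sum>w\<in>F. cnj (c w) * (coord i * h) w) \<le> nrm h * nrm (comb F c)"
    if F: "finite F" "F \<subseteq> ball 0 1" for F c
  proof -
    have "(\<Sum>w\<in>F. cnj (c w) * (coord i * h) w) = (\<Sum>w\<in>F. cnj (c w * cnj (w $ i)) * h w)"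
    proof (rule sum.cong[OF refl])
      fix w assume "w \<in> F"
      then have "w \<in> ball 0 1" using F by blast
      then have "coord i w = w $ i" by (rule zero_ext_mem)
      then show "cnj (c w) * (coord i * h) w = cnj (c w * cnj (w $ i)) * h w" by simp
    qed
    also have "\<dots> = ip h (comb F (\<lambda>w. c w * cnj (w $ i)))"
      by (rule comb_mem_ip(2)[OF F h, symmetric])
    also have "cmod \<dots> \<le> nrm h * nrm (comb F (\<lambda>w. c w * cnj (w $ i)))"
      by (rule cauchy_schwarz[OF h comb_mem_ip(1)[OF F]])
    also have "\<dots> \<le> nrm h * nrm (comb F c)"
      by (rule mult_left_mono[OF nrm_comb_coord_le[OF F] nrm_nonneg[OF h]])
    finally show ?thesis .
  qed
  show "coord i * h \<in> H" by (rule mem_if_bounded(1)[OF off nrm_nonneg[OF h] bound])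
  show "nrm (coord i * h) \<le> nrm h" by (rule mem_if_bounded(2)[OF off nrm_nonneg[OF h] bound])
qed

section \<open>The multiplier norm\<close>

lemma multipliers_mult: "f \<in> multipliers H \<Longrightarrow> h \<in> H \<Longrightarrow> f * h \<in> H"
  by (simp add: multipliers_def)

lemma multipliers_add: "f \<in> multipliers H \<Longrightarrow> g \<in> multipliers H \<Longrightarrow> f + g \<in> multipliers H"
proof -
  assume f: "f \<in> multipliers H" and g: "g \<in> multipliers H"
  have "(f + g) * h \<in> H" if h: "h \<in> H" for h
  proof -
    have "(f + g) * h = f * h + g * h" by (simp add: fun_eq_iff algebra_simps)
    then show ?thesis using add_mem[OF multipliers_mult[OF f h] multipliers_mult[OF g h]] by (simp only:)
  qed
  then show ?thesis using f g analytic_funs_add unfolding multipliers_def by blast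
qed

lemma multipliers_scale: "f \<in> multipliers H \<Longrightarrow> (\<lambda>x. c * f x) \<in> multipliers H"
proof -
  assume f: "f \<in> multipliers H"
  have "(\<lambda>x. c * f x) * h \<in> H" if h: "h \<in> H" for h
  proof -
    have "(\<lambda>x. c * f x) * h = (\<lambda>x. c * (f * h) x)" by (simp add: fun_eq_iff)
    then show ?thesis using scale_mem[OF multipliers_mult[OF f h]] by (simp only:)
  qed
  moreover have "(\<lambda>x. c * f x) \<in> analytic_funs (ball 0 1)"
    using f by (intro analytic_funs_scale) (auto simp: multipliers_def)
  ultimately show ?thesis by (simp only: multipliers_def mem_Collect_eq) blast
qed

lemma multipliers_diff:
  assumes f: "f \<in> multipliers H" and g: "g \<in> multipliers H" shows "f - g \<in> multipliers H"
proof -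
  have "f - g = f + (\<lambda>x. (-1) * g x)" by (simp add: fun_eq_iff)
  then show ?thesis using multipliers_add[OF f multipliers_scale[OF g]] by (simp only:)
qed

lemma mnorm_le:
  assumes "0 \<le> C" "\<And>h. h \<in> H \<Longrightarrow> nrm (f * h) \<le> C * nrm h" shows "mnorm f \<le> C"
  unfolding multiplier_norm_def
proof (rule cSUP_least)
  show "{h \<in> H. nrm h \<le> 1} \<noteq> {}" using zero_mem nrm_0 by force
  fix h assume h: "h \<in> {h \<in> H. nrm h \<le> 1}"
  then have "nrm (f * h) \<le> C * nrm h" using assms(2) by blast
  also have "\<dots> \<le> C * 1" using h assms(1) by (intro mult_left_mono) auto
  finally show "nrm (f * h) \<le> C" by simp
qed

text \<open>\<open>multiplication_bounded\<close> enters here: a real supremum over an unbounded set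
  would bound nothing.\<close>

lemma mnorm_upper:
  assumes f: "f \<in> multipliers H" and h: "h \<in> H" "nrm h \<le> 1" shows "nrm (f * h) \<le> mnorm f"
  unfolding multiplier_norm_def
proof (rule cSUP_upper)
  obtain C where C: "0 \<le> C" "\<forall>h\<in>H. nrm (f * h) \<le> C * nrm h"
    using multiplication_bounded[OF multipliers_mult[OF f]] by blast
  show "bdd_above ((\<lambda>h. nrm (f * h)) ` {h \<in> H. nrm h \<le> 1})"
  proof (rule bdd_aboveI2)
    fix h assume h: "h \<in> {h \<in> H. nrm h \<le> 1}"
    then have "nrm (f * h) \<le> C * nrm h" using C by blast
    also have "\<dots> \<le> C * 1" using h C by (intro mult_left_mono) auto
    finally show "nrm (f * h) \<le> C" by simp
  qed
qed (use h in simp)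

lemma mnorm_nonneg: "f \<in> multipliers H \<Longrightarrow> 0 \<le> mnorm f"
proof -
  assume f: "f \<in> multipliers H"
  have "nrm (f * 0) \<le> mnorm f" using nrm_0 by (intro mnorm_upper[OF f zero_mem]) simp
  then show ?thesis using nrm_nonneg[OF multipliers_mult[OF f zero_mem]] by linarith
qed

lemma mnorm_bound:
  assumes f: "f \<in> multipliers H" and h: "h \<in> H" shows "nrm (f * h) \<le> mnorm f * nrm h"
proof (cases "nrm h = 0")
  case True
  then have "h = 0" using nrm_zero_iff[OF h] by blast
  then have "f * h = 0" by (simp add: fun_eq_iff)
  then show ?thesis using True nrm_0 by (simp only: mult_zero_right)
next
  case False
  then have pos: "0 < nrm h" using nrm_nonneg[OF h] by simp
  let ?c = "complex_of_real (1 / nrm h)"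
  have c: "cmod ?c = 1 / nrm h" using pos by (simp add: norm_divide)
  have "nrm (\<lambda>x. ?c * h x) \<le> 1" unfolding nrm_scale[OF h] c using pos by simp
  then have "nrm (f * (\<lambda>x. ?c * h x)) \<le> mnorm f" by (rule mnorm_upper[OF f scale_mem[OF h]])
  moreover have "f * (\<lambda>x. ?c * h x) = (\<lambda>x. ?c * (f * h) x)" by (simp add: fun_eq_iff)
  ultimately have "1 / nrm h * nrm (f * h) \<le> mnorm f"
    using nrm_scale[OF multipliers_mult[OF f h], of ?c] unfolding c by (simp only:)
  then show ?thesis using pos by (simp add: field_simps)
qed

lemma mnorm_add:
  assumes f: "f \<in> multipliers H" and g: "g \<in> multipliers H" shows "mnorm (f + g) \<le> mnorm f + mnorm g"
proof (rule mnorm_le)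
  show "0 \<le> mnorm f + mnorm g" using mnorm_nonneg f g by simp
  fix h assume h: "h \<in> H"
  have "(f + g) * h = f * h + g * h" by (simp add: fun_eq_iff algebra_simps)
  then have "nrm ((f + g) * h) \<le> nrm (f * h) + nrm (g * h)"
    using nrm_triangle[OF multipliers_mult[OF f h] multipliers_mult[OF g h]] by (simp only:)
  then show "nrm ((f + g) * h) \<le> (mnorm f + mnorm g) * nrm h"
    using mnorm_bound[OF f h] mnorm_bound[OF g h] by (simp add: distrib_right)
qed

lemma mnorm_scale_le:
  assumes f: "f \<in> multipliers H" shows "mnorm (\<lambda>x. c * f x) \<le> cmod c * mnorm f"
proof (rule mnorm_le)
  show "0 \<le> cmod c * mnorm f" using mnorm_nonneg[OF f] by simp
  fix h assume h: "h \<in> H"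
  have "(\<lambda>x. c * f x) * h = (\<lambda>x. c * (f * h) x)" by (simp add: fun_eq_iff)
  then have "nrm ((\<lambda>x. c * f x) * h) = cmod c * nrm (f * h)"
    using nrm_scale[OF multipliers_mult[OF f h]] by (simp only:)
  also have "\<dots> \<le> cmod c * (mnorm f * nrm h)" by (intro mult_left_mono mnorm_bound f h) simp
  finally show "nrm ((\<lambda>x. c * f x) * h) \<le> cmod c * mnorm f * nrm h" by (simp add: mult.assoc)
qed

lemma mnorm_scale:
  assumes f: "f \<in> multipliers H" shows "mnorm (\<lambda>x. c * f x) = cmod c * mnorm f"
proof (cases "c = 0")
  case True
  then show ?thesis using mnorm_scale_le[OF f, of c] mnorm_nonneg[OF multipliers_scale[OF f, of c]] by simp
next
  case False
  have "(\<lambda>x. (1 / c) * (c * f x)) = f" using False by (simp add: fun_eq_iff)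
  then have "mnorm f \<le> cmod (1 / c) * mnorm (\<lambda>x. c * f x)"
    using mnorm_scale_le[OF multipliers_scale[OF f, of c], of "1 / c"] by (simp only:)
  then have "cmod c * mnorm f \<le> mnorm (\<lambda>x. c * f x)" using False by (simp add: norm_divide field_simps)
  then show ?thesis using mnorm_scale_le[OF f, of c] by simp
qed

section \<open>Monomials, polynomials and their closure\<close>

definition monomial :: "('d \<Rightarrow> nat) \<Rightarrow> complex ^ 'd \<Rightarrow> complex" where
  "monomial \<alpha> = zero_ext (ball 0 1) (\<lambda>z. \<Prod>i\<in>UNIV. (z $ i) ^ \<alpha> i)"

text \<open>Phrased through the action on H rather than \<open>multiplier_norm\<close>, which makes
  closure under products immediate.\<close>

definition contractive :: "(complex ^ 'd \<Rightarrow> complex) \<Rightarrow> bool" where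
  "contractive f \<longleftrightarrow> f \<in> multipliers H \<and> (\<forall>h\<in>H. nrm (f * h) \<le> nrm h)"

lemma contractive_coord: "contractive (coord i)"
  using coord_contractive analytic_funs_coord[OF open_ball]
  by (simp add: contractive_def multipliers_def)

lemma contractive_one: "contractive (zero_ext (ball 0 1) (\<lambda>z. 1))"
proof -
  have "zero_ext (ball 0 1) (\<lambda>z. 1) * h = h" if h: "h \<in> H" for h
    using supported[OF h] unfolding zero_ext_eq_iff by (auto simp: fun_eq_iff zero_ext_def)
  then show ?thesis
    using analytic_funs_const[OF open_ball, of 0 1 1] by (simp add: contractive_def multipliers_def)
qed

lemma contractive_mult:
  assumes f: "contractive f" and g: "contractive g" shows "contractive (f * g)"
proof -
  have fm: "f \<in> multipliers H" and gm: "g \<in> multipliers H" using f g by (auto simp: contractive_def)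
  have "f * (g * h) \<in> H \<and> nrm (f * (g * h)) \<le> nrm h" if h: "h \<in> H" for h
    using f g multipliers_mult[OF gm h] multipliers_mult[OF fm multipliers_mult[OF gm h]] h
    unfolding contractive_def by (meson order_trans)
  moreover have "f * g \<in> analytic_funs (ball 0 1)"
    using fm gm by (intro analytic_funs_mult) (auto simp: multipliers_def)
  ultimately show ?thesis
    unfolding contractive_def multipliers_def mem_Collect_eq mult.assoc by blast
qed

text \<open>The induction on an exponent carries an arbitrary contractive factor g along, so that
  powers of the coordinates can be attached one after another.\<close>

lemma contractive_mono: "contractive (monomial \<alpha>)"
proof -
  have pow: "contractive (zero_ext (ball 0 1) (\<lambda>z. (z $ i) ^ n * g z))"
    if g: "contractive (zero_ext (ball 0 1) g)" for i n g
  proof (induction n)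
    case 0 then show ?case using g by simp
  next
    case (Suc n)
    have "zero_ext (ball 0 1) (\<lambda>z. (z $ i) ^ Suc n * g z) = coord i * zero_ext (ball 0 1) (\<lambda>z. (z $ i) ^ n * g z)"
      by (auto simp: fun_eq_iff zero_ext_def)
    then show ?case using contractive_mult[OF contractive_coord Suc] by (simp only:)
  qed
  have "contractive (zero_ext (ball 0 1) (\<lambda>z. \<Prod>i\<in>I. (z $ i) ^ \<alpha> i))" if "finite I" for I
    using that
  proof (induction I)
    case empty then show ?case using contractive_one by simp
  next
    case (insert i I)
    then show ?case using pow[OF insert.IH, of i "\<alpha> i"] by simp
  qed
  then show ?thesis unfolding monomial_def by simp
qed

text \<open>The bound 1 is what lets evaluation at the monomials map the dual ball into a product of
  unit discs.\<close>

lemma mono_multiplier: "monomial \<alpha> \<in> multipliers H" and mnorm_mono: "mnorm (monomial \<alpha>) \<le> 1"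
  using contractive_mono[of \<alpha>] mnorm_le[of 1 "monomial \<alpha>"] by (auto simp: contractive_def)

definition poly_comb :: "('d \<Rightarrow> nat) set \<Rightarrow> (('d \<Rightarrow> nat) \<Rightarrow> complex) \<Rightarrow> complex ^ 'd \<Rightarrow> complex" where
  "poly_comb F a = (\<lambda>z. \<Sum>\<alpha>\<in>F. a \<alpha> * monomial \<alpha> z)"

lemma ball_polynomials_eq: "ball_polynomials = {poly_comb F a | F a. finite F}"
proof -
  have "zero_ext (ball 0 1) (\<lambda>z. \<Sum>\<alpha>\<in>F. a \<alpha> * (\<Prod>i\<in>UNIV. (z $ i) ^ \<alpha> i)) = poly_comb F a" for F a
    by (auto simp: fun_eq_iff zero_ext_def poly_comb_def monomial_def)
  then show ?thesis unfolding ball_polynomials_def by simp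
qed

lemma poly_comb_mem:
  assumes "finite F" shows "poly_comb F a \<in> multipliers H"
  using assms
proof (induction F)
  case empty
  have "poly_comb {} a = (\<lambda>x. 0 * monomial undefined x)" by (simp add: poly_comb_def fun_eq_iff)
  then show ?case using multipliers_scale[OF mono_multiplier, of 0] by (simp only:)
next
  case (insert \<alpha> F)
  have "poly_comb (insert \<alpha> F) a = (\<lambda>x. a \<alpha> * monomial \<alpha> x) + poly_comb F a"
    using insert by (simp add: poly_comb_def fun_eq_iff)
  then show ?case using multipliers_add[OF multipliers_scale[OF mono_multiplier] insert.IH] by (simp only:)
qed

lemma poly_comb_add_scale:
  assumes "finite F" "finite G"
  shows "poly_comb F a + (\<lambda>x. c * poly_comb G b x) \<in> ball_polynomials"
proof -
  define d where "d \<alpha> = (if \<alpha> \<in> F then a \<alpha> else 0) + c * (if \<alpha> \<in> G then b \<alpha> else 0)" for \<alpha>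
  have "poly_comb F a z = (\<Sum>\<alpha>\<in>F \<union> G. (if \<alpha> \<in> F then a \<alpha> else 0) * monomial \<alpha> z)" for z
    unfolding poly_comb_def using assms by (intro sum.mono_neutral_cong_left) auto
  moreover have "poly_comb G b z = (\<Sum>\<alpha>\<in>F \<union> G. (if \<alpha> \<in> G then b \<alpha> else 0) * monomial \<alpha> z)" for z
    unfolding poly_comb_def using assms by (intro sum.mono_neutral_cong_left) auto
  ultimately have "poly_comb F a + (\<lambda>x. c * poly_comb G b x) = poly_comb (F \<union> G) d"
    by (simp add: fun_eq_iff) (simp add: poly_comb_def d_def sum_distrib_left sum.distrib algebra_simps)
  then show ?thesis using assms unfolding ball_polynomials_eq by blast
qed

abbreviation "\<A> \<equiv> multiplier_poly_closure H ip"

lemma \<A>_multiplier: "f \<in> \<A> \<Longrightarrow> f \<in> multipliers H"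
  by (simp add: multiplier_poly_closure_def)

lemma \<A>_approx:
  assumes "f \<in> \<A>" "0 < e"
  obtains F a where "finite F" "mnorm (f - poly_comb F a) < e"
  using assms unfolding multiplier_poly_closure_def ball_polynomials_eq by blast

lemma \<A>I:
  assumes "f \<in> multipliers H" "\<And>e. 0 < e \<Longrightarrow> \<exists>p\<in>ball_polynomials. mnorm (f - p) < e"
  shows "f \<in> \<A>"
  using assms by (simp add: multiplier_poly_closure_def)

lemma \<A>_add_scale:
  assumes f: "f \<in> \<A>" and g: "g \<in> \<A>" shows "f + (\<lambda>x. c * g x) \<in> \<A>"
proof (rule \<A>I)
  note fm = \<A>_multiplier[OF f] and gm = \<A>_multiplier[OF g]
  show "f + (\<lambda>x. c * g x) \<in> multipliers H" by (intro multipliers_add multipliers_scale fm gm)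
  fix e :: real assume e: "0 < e"
  \<comment> \<open>The error in g is multiplied by |c| and must then be at most e / 2; the + 1
    covers c = 0.\<close>
  define k where "k = e / 2 / (cmod c + 1)"
  have k: "0 < k" "cmod c * k \<le> e / 2" using e by (auto simp: k_def field_simps add_pos_nonneg)
  obtain F a where F: "finite F" "mnorm (f - poly_comb F a) < e / 2"
    by (rule \<A>_approx[OF f, of "e / 2"]) (use e that in auto)
  obtain G b where G: "finite G" "mnorm (g - poly_comb G b) < k"
    by (rule \<A>_approx[OF g k(1)]) (rule that)
  let ?p = "poly_comb F a + (\<lambda>x. c * poly_comb G b x)"
  have "f + (\<lambda>x. c * g x) - ?p = (f - poly_comb F a) + (\<lambda>x. c * (g - poly_comb G b) x)"
    by (simp add: fun_eq_iff algebra_simps)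
  moreover have "mnorm ((f - poly_comb F a) + (\<lambda>x. c * (g - poly_comb G b) x))
      \<le> mnorm (f - poly_comb F a) + cmod c * mnorm (g - poly_comb G b)"
    using mnorm_add[OF multipliers_diff[OF fm poly_comb_mem[OF F(1)]] multipliers_scale[OF multipliers_diff[OF gm poly_comb_mem[OF G(1)]]]]
    unfolding mnorm_scale[OF multipliers_diff[OF gm poly_comb_mem[OF G(1)]]] .
  moreover have "cmod c * mnorm (g - poly_comb G b) \<le> cmod c * k"
    using G(2) by (intro mult_left_mono) auto
  ultimately have "mnorm (f + (\<lambda>x. c * g x) - ?p) < e"
    using F(2) k(2) by (simp only:)
  then show "\<exists>p\<in>ball_polynomials. mnorm (f + (\<lambda>x. c * g x) - p) < e"
    using poly_comb_add_scale[OF F(1) G(1)] by blast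
qed

lemma \<A>_poly: "finite F \<Longrightarrow> poly_comb F a \<in> \<A>"
proof (rule \<A>I)
  assume F: "finite F"
  show "poly_comb F a \<in> multipliers H" by (rule poly_comb_mem[OF F])
  fix e :: real assume e: "0 < e"
  have "poly_comb F a - poly_comb F a = (\<lambda>x. 0 * monomial undefined x)" by (simp add: fun_eq_iff)
  then have "mnorm (poly_comb F a - poly_comb F a) = cmod 0 * mnorm (monomial undefined)"
    using mnorm_scale[OF mono_multiplier, of 0] by (simp only:)
  then have "mnorm (poly_comb F a - poly_comb F a) < e" using e by (simp only: norm_zero mult_zero_left)
  then show "\<exists>p\<in>ball_polynomials. mnorm (poly_comb F a - p) < e"
    using F unfolding ball_polynomials_eq by blast
qed

lemma \<A>_mono: "monomial \<alpha> \<in> \<A>"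
proof -
  have "poly_comb {\<alpha>} (\<lambda>_. 1) = monomial \<alpha>" by (simp add: poly_comb_def fun_eq_iff)
  then show ?thesis using \<A>_poly[of "{\<alpha>}" "\<lambda>_. 1"] by simp
qed

lemma \<A>_0: "0 \<in> \<A>"
proof -
  have "poly_comb {} undefined = 0" by (simp add: poly_comb_def fun_eq_iff)
  then show ?thesis using \<A>_poly[of "{}" undefined] by (simp only: finite.emptyI)
qed

lemma \<A>_add: "f \<in> \<A> \<Longrightarrow> g \<in> \<A> \<Longrightarrow> f + g \<in> \<A>"
  using \<A>_add_scale[of f g 1] by simp

lemma \<A>_scale: "f \<in> \<A> \<Longrightarrow> (\<lambda>x. c * f x) \<in> \<A>"
proof -
  assume "f \<in> \<A>"
  moreover have "0 + (\<lambda>x. c * f x) = (\<lambda>x. c * f x)" by (rule add_0_left)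
  ultimately show ?thesis using \<A>_add_scale[OF \<A>_0, of f c] by (simp only:)
qed

end


section \<open>The dual unit ball of the polynomial closure\<close>

text \<open>Tychonoff's theorem for discs whose radius depends on the index.\<close>

lemma compact_Pi_cball: "compact {\<xi> :: 'a \<Rightarrow> complex. \<forall>f. \<xi> f \<in> cball 0 (r f)}"
proof -
  have "compactin (product_topology (\<lambda>f::'a. euclidean) UNIV) (PiE UNIV (\<lambda>f. cball (0::complex) (r f)))"
    by (simp add: compactin_PiE compactin_euclidean_iff)
  then have "compact (PiE UNIV (\<lambda>f::'a. cball (0::complex) (r f)))"
    by (simp only: euclidean_product_topology compactin_euclidean_iff)
  moreover have "PiE UNIV (\<lambda>f::'a. cball (0::complex) (r f)) = {\<xi>. \<forall>f. \<xi> f \<in> cball 0 (r f)}"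
    by (auto simp: PiE_def Pi_def)
  ultimately show ?thesis by (simp only:)
qed

context drury_arveson_space
begin

abbreviation "\<X> \<equiv> dual_unit_ball \<A> mnorm"

text \<open>Replaces the supremum in \<open>dual_norm\<close> by pointwise conditions that are
  closed under pointwise limits and convex combinations; compactness and convexity are proved from
  this form.\<close>

lemma mem_\<X>_iff: "\<xi> \<in> \<X> \<longleftrightarrow> (\<forall>f. f \<notin> \<A> \<longrightarrow> \<xi> f = 0) \<and> (\<forall>f\<in>\<A>. \<forall>g\<in>\<A>. \<xi> (f + g) = \<xi> f + \<xi> g) \<and>
    (\<forall>c. \<forall>f\<in>\<A>. \<xi> (\<lambda>x. c * f x) = c * \<xi> f) \<and> (\<forall>f\<in>\<A>. cmod (\<xi> f) \<le> mnorm f)"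
  (is "?l \<longleftrightarrow> ?r")
proof
  assume l: ?l
  then have \<xi>: "\<xi> \<in> dual_space \<A> mnorm" and le1: "dual_norm \<A> mnorm \<xi> \<le> 1"
    by (simp_all add: dual_unit_ball_def)
  have "cmod (\<xi> f) \<le> mnorm f" if f: "f \<in> \<A>" for f
  proof -
    have "cmod (\<xi> f) \<le> dual_norm \<A> mnorm \<xi> * mnorm f"
      by (rule dual_norm_bound[OF \<xi> f]) (intro \<A>_scale mnorm_scale mnorm_nonneg \<A>_multiplier; assumption)+
    also have "\<dots> \<le> 1 * mnorm f"
      using le1 by (rule mult_right_mono) (rule mnorm_nonneg[OF \<A>_multiplier[OF f]])
    finally show ?thesis by simp
  qed
  then show ?r using \<xi> unfolding dual_space_def zero_ext_eq_iff by blast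
next
  assume r: ?r
  then have le: "cmod (\<xi> f) \<le> 1 * mnorm f" if "f \<in> \<A>" for f using that by simp
  have "\<xi> \<in> dual_space \<A> mnorm"
    unfolding dual_space_def zero_ext_eq_iff mem_Collect_eq
  proof (intro conjI)
    show "\<exists>C. \<forall>f\<in>\<A>. cmod (\<xi> f) \<le> C * mnorm f" using le by blast
  qed (use r in blast)+
  moreover have "dual_norm \<A> mnorm \<xi> \<le> 1"
    unfolding dual_norm_def
  proof (rule cSUP_least)
    have "mnorm 0 \<le> 1"
    proof (rule mnorm_le)
      fix h assume h: "h \<in> H"
      have "0 * h = 0" by (rule mult_zero_left)
      then show "nrm (0 * h) \<le> 1 * nrm h" using nrm_0 nrm_nonneg[OF h] by (simp only: mult_1)
    qed simp
    then show "{f \<in> \<A>. mnorm f \<le> 1} \<noteq> {}" using \<A>_0 by blast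
    fix f assume "f \<in> {f \<in> \<A>. mnorm f \<le> 1}"
    then show "cmod (\<xi> f) \<le> 1" using le[of f] by simp
  qed
  ultimately show ?l by (simp add: dual_unit_ball_def)
qed

lemma \<X>_off: "\<xi> \<in> \<X> \<Longrightarrow> f \<notin> \<A> \<Longrightarrow> \<xi> f = 0"
  and \<X>_add: "\<xi> \<in> \<X> \<Longrightarrow> f \<in> \<A> \<Longrightarrow> g \<in> \<A> \<Longrightarrow> \<xi> (f + g) = \<xi> f + \<xi> g"
  and \<X>_scale: "\<xi> \<in> \<X> \<Longrightarrow> f \<in> \<A> \<Longrightarrow> \<xi> (\<lambda>x. c * f x) = c * \<xi> f"
  and \<X>_bound: "\<xi> \<in> \<X> \<Longrightarrow> f \<in> \<A> \<Longrightarrow> cmod (\<xi> f) \<le> mnorm f"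
  unfolding mem_\<X>_iff by blast+

lemma \<X>_zero: "\<xi> \<in> \<X> \<Longrightarrow> \<xi> 0 = 0"
proof -
  assume "\<xi> \<in> \<X>"
  then have "\<xi> (0 + 0) = \<xi> 0 + \<xi> 0" by (rule \<X>_add[OF _ \<A>_0 \<A>_0])
  then have "\<xi> 0 = \<xi> 0 + \<xi> 0" unfolding add_0_left .
  then show ?thesis unfolding add_cancel_right_right .
qed

lemma zero_mem_\<X>: "(\<lambda>f. 0) \<in> \<X>"
  unfolding mem_\<X>_iff using mnorm_nonneg[OF \<A>_multiplier] by simp

lemma convex_\<X>: "convex \<X>"
proof (rule convexI)
  fix \<xi> \<eta> and u v :: real
  assume m: "\<xi> \<in> \<X>" "\<eta> \<in> \<X>" and uv: "0 \<le> u" "0 \<le> v" "u + v = 1"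
  have ev: "(u *\<^sub>R \<xi> + v *\<^sub>R \<eta>) f = complex_of_real u * \<xi> f + complex_of_real v * \<eta> f" for f
    by (simp add: scaleR_fun_def scaleR_conv_of_real)
  show "u *\<^sub>R \<xi> + v *\<^sub>R \<eta> \<in> \<X>"
    unfolding mem_\<X>_iff ev
  proof (intro conjI allI ballI impI)
    fix f assume f: "f \<in> \<A>"
    have "cmod (complex_of_real u * \<xi> f + complex_of_real v * \<eta> f) \<le> u * cmod (\<xi> f) + v * cmod (\<eta> f)"
      using norm_triangle_ineq[of "complex_of_real u * \<xi> f" "complex_of_real v * \<eta> f"] uv by (simp add: norm_mult)
    also have "\<dots> \<le> u * mnorm f + v * mnorm f"
      using uv \<X>_bound[OF m(1) f] \<X>_bound[OF m(2) f] by (intro add_mono mult_left_mono)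
    also have "\<dots> = mnorm f" using uv by (simp flip: distrib_right)
    finally show "cmod (complex_of_real u * \<xi> f + complex_of_real v * \<eta> f) \<le> mnorm f" .
  qed (use m in \<open>simp_all add: \<X>_off \<X>_add \<X>_scale algebra_simps\<close>)
qed

text \<open>Banach-Alaoglu: a closed subset of a product of discs. The radius 0 off \<A> encodes
  that functionals vanish there.\<close>

lemma compact_\<X>: "compact \<X>"
proof -
  let ?P = "{\<xi> :: (complex ^ 'd \<Rightarrow> complex) \<Rightarrow> complex. \<forall>f. \<xi> f \<in> cball 0 (if f \<in> \<A> then mnorm f else 0)}"
  let ?C1 = "{\<xi> :: (complex ^ 'd \<Rightarrow> complex) \<Rightarrow> complex. \<forall>p\<in>\<A> \<times> \<A>. \<xi> (fst p + snd p) = \<xi> (fst p) + \<xi> (snd p)}"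
  let ?C2 = "{\<xi> :: (complex ^ 'd \<Rightarrow> complex) \<Rightarrow> complex. \<forall>p\<in>UNIV \<times> \<A>. \<xi> (\<lambda>x. fst p * snd p x) = fst p * \<xi> (snd p)}"
  have ev: "continuous_on UNIV (\<lambda>\<xi> :: (complex ^ 'd \<Rightarrow> complex) \<Rightarrow> complex. \<xi> f)" for f
    by (rule continuous_on_product_coordinates)
  have C1: "closed ?C1"
    unfolding Collect_ball_eq by (intro closed_INT ballI closed_Collect_eq continuous_on_add ev)
  have C2: "closed ?C2"
    unfolding Collect_ball_eq by (intro closed_INT ballI closed_Collect_eq continuous_on_mult continuous_on_const ev)
  have "\<X> = ?P \<inter> (?C1 \<inter> ?C2)"
  proof (intro equalityI subsetI)
    fix \<xi> assume x: "\<xi> \<in> \<X>"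
    then have "\<xi> f \<in> cball 0 (if f \<in> \<A> then mnorm f else 0)" for f
      using \<X>_off[OF x] \<X>_bound[OF x] by simp
    then show "\<xi> \<in> ?P \<inter> (?C1 \<inter> ?C2)" using \<X>_add[OF x] \<X>_scale[OF x] by auto
  next
    fix \<xi> assume x: "\<xi> \<in> ?P \<inter> (?C1 \<inter> ?C2)"
    then have P: "\<xi> f \<in> cball 0 (if f \<in> \<A> then mnorm f else 0)" for f by blast
    have "\<xi> f = 0" if "f \<notin> \<A>" for f using P[of f] that by simp
    moreover have "cmod (\<xi> f) \<le> mnorm f" if "f \<in> \<A>" for f using P[of f] that by simp
    ultimately show "\<xi> \<in> \<X>" unfolding mem_\<X>_iff using x by auto
  qed
  moreover have "compact (?P \<inter> (?C1 \<inter> ?C2))"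
    using compact_Pi_cball C1 C2 by (intro compact_Int_closed closed_Int)
  ultimately show ?thesis by (simp only:)
qed

text \<open>The coordinates of the embedding. \<open>from_nat\<close> reaches every exponent, since
  exponents over a finite index type are countable.\<close>

definition eval_monomials :: "((complex ^ 'd \<Rightarrow> complex) \<Rightarrow> complex) \<Rightarrow> nat \<Rightarrow> complex" where
  "eval_monomials \<xi> n = \<xi> (monomial (from_nat n))"

lemma \<X>_poly:
  assumes \<xi>: "\<xi> \<in> \<X>" and F: "finite F"
  shows "\<xi> (poly_comb F a) = (\<Sum>\<alpha>\<in>F. a \<alpha> * \<xi> (monomial \<alpha>))"
  using F
proof (induction F)
  case empty
  have "poly_comb {} a = (\<lambda>x. 0 * monomial undefined x)" by (simp add: poly_comb_def fun_eq_iff)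
  then show ?case using \<X>_scale[OF \<xi> \<A>_mono, of 0] by (simp only: sum.empty mult_zero_left)
next
  case (insert \<alpha> F)
  have "poly_comb (insert \<alpha> F) a = (\<lambda>x. a \<alpha> * monomial \<alpha> x) + poly_comb F a"
    using insert by (simp add: poly_comb_def fun_eq_iff)
  then have "\<xi> (poly_comb (insert \<alpha> F) a) = a \<alpha> * \<xi> (monomial \<alpha>) + \<xi> (poly_comb F a)"
    using \<X>_add[OF \<xi> \<A>_scale[OF \<A>_mono] \<A>_poly[OF insert.hyps(1)]] \<X>_scale[OF \<xi> \<A>_mono] by (simp only:)
  then show ?case using insert by simp
qed

lemma \<X>_diff: "\<xi> \<in> \<X> \<Longrightarrow> f \<in> \<A> \<Longrightarrow> g \<in> \<A> \<Longrightarrow> cmod (\<xi> f - \<xi> g) \<le> mnorm (f - g)"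
proof -
  assume \<xi>: "\<xi> \<in> \<X>" and f: "f \<in> \<A>" and g: "g \<in> \<A>"
  have eq: "f + (\<lambda>x. (-1) * g x) = f - g" by (simp add: fun_eq_iff)
  then have "f - g \<in> \<A>" using \<A>_add_scale[OF f g, of "-1"] by (simp only:)
  moreover have "\<xi> (f - g) = \<xi> f - \<xi> g"
    using \<X>_add[OF \<xi> f \<A>_scale[OF g, of "-1"]] \<X>_scale[OF \<xi> g, of "-1"] unfolding eq by simp
  ultimately show ?thesis using \<X>_bound[OF \<xi>, of "f - g"] by (simp only:)
qed

text \<open>Functionals that agree on monomials agree on polynomials, which are dense in \<A>. Both
  are bounded by the multiplier norm, so a polynomial within half the gap between their values gives
  a contradiction.\<close>

lemma eval_monomials_inj: "inj_on eval_monomials \<X>"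
proof (rule inj_onI)
  fix \<xi> \<eta> assume m: "\<xi> \<in> \<X>" "\<eta> \<in> \<X>" and eq: "eval_monomials \<xi> = eval_monomials \<eta>"
  have mon: "\<xi> (monomial \<alpha>) = \<eta> (monomial \<alpha>)" for \<alpha>
    using fun_cong[OF eq, of "to_nat \<alpha>"] by (simp add: eval_monomials_def)
  have "\<xi> f = \<eta> f" if f: "f \<in> \<A>" for f
  proof (rule ccontr)
    assume "\<xi> f \<noteq> \<eta> f"
    then have e: "0 < cmod (\<xi> f - \<eta> f) / 2" by simp
    obtain F a where F: "finite F" "mnorm (f - poly_comb F a) < cmod (\<xi> f - \<eta> f) / 2"
      by (rule \<A>_approx[OF f e]) (rule that)
    let ?p = "poly_comb F a"
    have "\<xi> ?p = \<eta> ?p" using \<X>_poly[OF m(1) F(1)] \<X>_poly[OF m(2) F(1)] mon by (simp only:)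
    then have "\<xi> f - \<eta> f = (\<xi> f - \<xi> ?p) - (\<eta> f - \<eta> ?p)" by simp
    then have "cmod (\<xi> f - \<eta> f) \<le> cmod (\<xi> f - \<xi> ?p) + cmod (\<eta> f - \<eta> ?p)"
      by (simp only: norm_triangle_ineq4)
    then show False
      using \<X>_diff[OF m(1) f \<A>_poly[OF F(1)], of a] \<X>_diff[OF m(2) f \<A>_poly[OF F(1)], of a] F(2) by linarith
  qed
  then show "\<xi> = \<eta>" using \<X>_off m by (metis ext)
qed

lemma midpoint_eval: "midpoint \<xi> \<eta> f = (\<xi> f + \<eta> f) / 2" for \<xi> \<eta> :: "'b \<Rightarrow> complex"
  by (simp add: midpoint_def scaleR_fun_def scaleR_conv_of_real)

lemma compact_convex_coordinates_\<X>: "compact_convex_coordinates \<X> eval_monomials"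
proof
  show "compact \<X>" "convex \<X>" "inj_on eval_monomials \<X>"
    by (rule compact_\<X> convex_\<X> eval_monomials_inj)+
  show "continuous_on \<X> eval_monomials"
    unfolding eval_monomials_def[abs_def]
    by (intro continuous_on_coordinatewise_then_product continuous_on_subset[OF continuous_on_product_coordinates]) simp
  show "eval_monomials (midpoint x y) n = (eval_monomials x n + eval_monomials y n) / 2" for x y n
    by (simp only: eval_monomials_def midpoint_eval)
  show "norm (eval_monomials \<xi> n) \<le> 1" if "\<xi> \<in> \<X>" for \<xi> n
    unfolding eval_monomials_def by (rule order_trans[OF \<X>_bound[OF that \<A>_mono] mnorm_mono])
  have "continuous_on (\<X> \<times> \<X>) (\<lambda>p. (fst p f + snd p f) / 2)" for f
  proof -
    have "continuous_on (\<X> \<times> \<X>) (\<lambda>p. fst p f)" "continuous_on (\<X> \<times> \<X>) (\<lambda>p. snd p f)"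
      by (rule continuous_on_product_then_coordinatewise[OF continuous_on_fst[OF continuous_on_id]]
          continuous_on_product_then_coordinatewise[OF continuous_on_snd[OF continuous_on_id]])+
    then show ?thesis by (intro continuous_intros) simp_all
  qed
  then have "continuous_on (\<X> \<times> \<X>) (\<lambda>p. midpoint (fst p) (snd p))"
    by (intro continuous_on_coordinatewise_then_product) (simp only: midpoint_eval)
  then show "continuous_on (\<X> \<times> \<X>) (\<lambda>(x, y). midpoint x y)" by (simp only: case_prod_unfold)
qed

section \<open>The weighted space as an instance of the abstract setting\<close>

definition wfun :: "((((complex ^ 'd \<Rightarrow> complex) \<Rightarrow> complex) \<Rightarrow> real)) \<Rightarrow> complex \<Rightarrow> (complex ^ 'd \<Rightarrow> complex) \<Rightarrow>
    ((complex ^ 'd \<Rightarrow> complex) \<Rightarrow> complex) \<Rightarrow> complex" where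
  "wfun t c \<phi> = zero_ext \<X> (\<lambda>\<xi>. (c + \<xi> \<phi>) / complex_of_real (t \<xi>))"

lemma weighted_space_eq: "weighted_space \<A> \<X> t = {wfun t c \<phi> | c \<phi>. \<phi> \<in> \<A>}"
proof -
  have "zero_ext \<X> (\<lambda>\<xi>. (c + canonical_image \<X> \<phi> \<xi>) / complex_of_real (t \<xi>)) = wfun t c \<phi>" for c \<phi>
    by (auto simp: wfun_def canonical_image_def zero_ext_def fun_eq_iff)
  then show ?thesis by (simp only: weighted_space_def)
qed

lemma wfun_mem: "\<xi> \<in> \<X> \<Longrightarrow> wfun t c \<phi> \<xi> = (c + \<xi> \<phi>) / complex_of_real (t \<xi>)"
  and wfun_off: "\<xi> \<notin> \<X> \<Longrightarrow> wfun t c \<phi> \<xi> = 0"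
  unfolding wfun_def by (rule zero_ext_mem zero_ext_off, assumption)+

lemma wfun_zero: "wfun t 0 0 = 0"
proof (rule ext)
  fix \<xi>
  show "wfun t 0 0 \<xi> = 0 \<xi>"
  proof (cases "\<xi> \<in> \<X>")
    case True
    show ?thesis unfolding wfun_mem[OF True] \<X>_zero[OF True] by simp
  next
    case False
    show ?thesis unfolding wfun_off[OF False] by simp
  qed
qed

lemma wfun_add:
  assumes \<phi>: "\<phi> \<in> \<A>" "\<phi>' \<in> \<A>"
  shows "wfun t c \<phi> + wfun t c' \<phi>' = wfun t (c + c') (\<phi> + \<phi>')"
proof (rule ext)
  fix \<xi>
  show "(wfun t c \<phi> + wfun t c' \<phi>') \<xi> = wfun t (c + c') (\<phi> + \<phi>') \<xi>"
  proof (cases "\<xi> \<in> \<X>")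
    case True
    show ?thesis unfolding plus_fun_apply wfun_mem[OF True] \<X>_add[OF True \<phi>] by (simp flip: add_divide_distrib)
  next
    case False
    show ?thesis unfolding plus_fun_apply wfun_off[OF False] by simp
  qed
qed

lemma wfun_scale:
  assumes \<phi>: "\<phi> \<in> \<A>"
  shows "(\<lambda>x. k * wfun t c \<phi> x) = wfun t (k * c) (\<lambda>x. k * \<phi> x)"
proof (rule ext)
  fix \<xi>
  show "k * wfun t c \<phi> \<xi> = wfun t (k * c) (\<lambda>x. k * \<phi> x) \<xi>"
  proof (cases "\<xi> \<in> \<X>")
    case True
    show ?thesis unfolding wfun_mem[OF True] \<X>_scale[OF True \<phi>] by (simp add: distrib_left)
  next
    case False
    show ?thesis unfolding wfun_off[OF False] by simp
  qed
qed

text \<open>Multiplication by t removes the weight and leaves a function affine in \<xi>, which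
  yields the continuity and midpoint conditions of \<open>weighted_affine_space\<close>.\<close>

lemma wfun_mult_t: "\<xi> \<in> \<X> \<Longrightarrow> 0 < t \<xi> \<Longrightarrow> wfun t c \<phi> \<xi> * complex_of_real (t \<xi>) = c + \<xi> \<phi>"
  by (simp only: wfun_mem) simp

lemma weighted_affine_space_\<X>:
  assumes t_cont: "continuous_on \<X> t" and t_pos: "\<forall>x\<in>\<X>. t x > 0" and t_conc: "midpoint_concave_on \<X> t"
    and \<Phi>: "\<Phi> \<in> dual_space (weighted_space \<A> \<X> t) (sup_norm \<X>)"
  shows "weighted_affine_space \<X> eval_monomials t (weighted_space \<A> \<X> t) \<Phi>"
proof -
  interpret C: compact_convex_coordinates \<X> eval_monomials by (rule compact_convex_coordinates_\<X>)
  have mem: "b \<in> weighted_space \<A> \<X> t \<longleftrightarrow> (\<exists>c \<phi>. b = wfun t c \<phi> \<and> \<phi> \<in> \<A>)" for b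
    unfolding weighted_space_eq by blast
  have in_W: "wfun t c \<phi> \<in> weighted_space \<A> \<X> t" if "\<phi> \<in> \<A>" for c \<phi>
    unfolding mem using that by blast
  have pos: "0 < t x" if "x \<in> \<X>" for x using t_pos that by (rule bspec)
  have mult_t: "wfun t c \<phi> \<xi> * complex_of_real (t \<xi>) = c + \<xi> \<phi>" if "\<xi> \<in> \<X>" for c \<phi> \<xi>
    using wfun_mult_t[of \<xi> t c \<phi>] that pos[OF that] by blast
  have cont: "continuous_on \<X> (\<lambda>x. wfun t c \<phi> x * complex_of_real (t x))" for c \<phi>
  proof -
    have "continuous_on \<X> (\<lambda>\<xi>. c + \<xi> \<phi>)"
      by (intro continuous_on_add continuous_on_const continuous_on_subset[OF continuous_on_product_coordinates]) simp
    then show ?thesis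
      by (rule continuous_on_cong[THEN iffD1, OF refl, rotated]) (rule mult_t[symmetric])
  qed
  have mid: "wfun t c \<phi> (midpoint x y) * complex_of_real (t (midpoint x y)) =
      (wfun t c \<phi> x * complex_of_real (t x) + wfun t c \<phi> y * complex_of_real (t y)) / 2"
    if xy: "x \<in> \<X>" "y \<in> \<X>" for c \<phi> x y
  proof -
    have m: "midpoint x y \<in> \<X>" by (rule C.midpoint_mem[OF xy])
    have "c + (x \<phi> + y \<phi>) / 2 = ((c + x \<phi>) + (c + y \<phi>)) / 2" by (simp add: add_divide_distrib)
    then show ?thesis
      by (simp only: mult_t[OF m] mult_t[OF xy(1)] mult_t[OF xy(2)] midpoint_eval)
  qed
  have W_off: "\<forall>b x. b \<in> weighted_space \<A> \<X> t \<longrightarrow> x \<notin> \<X> \<longrightarrow> b x = 0"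
    unfolding mem by (intro allI impI, elim exE conjE) (simp only: wfun_off not_False_eq_True)
  have W_0: "0 \<in> weighted_space \<A> \<X> t" using in_W[OF \<A>_0, of 0] unfolding wfun_zero .
  have W_add: "\<forall>b b'. b \<in> weighted_space \<A> \<X> t \<longrightarrow> b' \<in> weighted_space \<A> \<X> t \<longrightarrow> b + b' \<in> weighted_space \<A> \<X> t"
  proof (intro allI impI)
    fix b b' assume b: "b \<in> weighted_space \<A> \<X> t" "b' \<in> weighted_space \<A> \<X> t"
    obtain c \<phi> where eq1: "b = wfun t c \<phi>" and \<phi>1: "\<phi> \<in> \<A>"
      using b(1) unfolding mem by (elim exE conjE) (rule that)
    obtain c' \<phi>' where eq2: "b' = wfun t c' \<phi>'" and \<phi>2: "\<phi>' \<in> \<A>"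
      using b(2) unfolding mem by (elim exE conjE) (rule that)
    show "b + b' \<in> weighted_space \<A> \<X> t"
      unfolding eq1 eq2 wfun_add[OF \<phi>1 \<phi>2] by (rule in_W[OF \<A>_add[OF \<phi>1 \<phi>2]])
  qed
  have W_scale: "\<forall>k b. b \<in> weighted_space \<A> \<X> t \<longrightarrow> (\<lambda>x. k * b x) \<in> weighted_space \<A> \<X> t"
  proof (intro allI impI)
    fix k b assume b: "b \<in> weighted_space \<A> \<X> t"
    obtain c \<phi> where eq: "b = wfun t c \<phi>" and \<phi>: "\<phi> \<in> \<A>"
      using b unfolding mem by (elim exE conjE) (rule that)
    show "(\<lambda>x. k * b x) \<in> weighted_space \<A> \<X> t"
      unfolding eq wfun_scale[OF \<phi>] by (rule in_W[OF \<A>_scale[OF \<phi>]])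
  qed
  have W_cont: "\<forall>b. b \<in> weighted_space \<A> \<X> t \<longrightarrow> continuous_on \<X> (\<lambda>x. b x * complex_of_real (t x))"
    unfolding mem by (intro allI impI, elim exE conjE) (simp only: cont)
  have W_mid: "\<forall>b x y. b \<in> weighted_space \<A> \<X> t \<longrightarrow> x \<in> \<X> \<longrightarrow> y \<in> \<X> \<longrightarrow>
      b (midpoint x y) * complex_of_real (t (midpoint x y)) =
      (b x * complex_of_real (t x) + b y * complex_of_real (t y)) / 2"
    unfolding mem by (intro allI impI, elim exE conjE) (simp only: mid)
  have "\<X> \<noteq> {}" using zero_mem_\<X> by blast
  moreover have "\<forall>x. x \<in> \<X> \<longrightarrow> 0 < t x" using t_pos by blast
  ultimately have "weighted_affine_space_axioms \<X> t (weighted_space \<A> \<X> t) \<Phi>"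
    unfolding weighted_affine_space_axioms_def
    by (intro conjI t_cont t_conc \<Phi> W_off W_0 W_add W_scale W_cont W_mid)
  then show ?thesis by (rule weighted_affine_space.intro[OF compact_convex_coordinates_\<X>])
qed

end

theorem theorem8p4:
  fixes H :: "(complex ^ 'd \<Rightarrow> complex) set"
    and ip :: "(complex ^ 'd \<Rightarrow> complex) \<Rightarrow> (complex ^ 'd \<Rightarrow> complex) \<Rightarrow> complex"
    and A :: "(complex ^ 'd \<Rightarrow> complex) set"
    and X :: "((complex ^ 'd \<Rightarrow> complex) \<Rightarrow> complex) set"
    and t :: "((complex ^ 'd \<Rightarrow> complex) \<Rightarrow> complex) \<Rightarrow> real"
    and B :: "(((complex ^ 'd \<Rightarrow> complex) \<Rightarrow> complex) \<Rightarrow> complex) set"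
    and \<Phi> :: "(((complex ^ 'd \<Rightarrow> complex) \<Rightarrow> complex) \<Rightarrow> complex) \<Rightarrow> complex"
  assumes H: "drury_arveson_space H ip"
    and A: "A = multiplier_poly_closure H ip"
    and X: "X = dual_unit_ball A (multiplier_norm H ip)"
    and t_continuous: "continuous_on X t"
    and t_positive: "\<forall>x\<in>X. t x > 0"
    and t_concave: "midpoint_concave_on X t"
    and B: "B = weighted_space A X t"
    and \<Phi>: "\<Phi> \<in> dual_space B (sup_norm X)"
  shows "\<exists>\<mu> \<in> regular_complex_borel_measures X.
           concentrated_on (borel_on X) \<mu> (extreme_points X) \<and>
           total_variation_norm (borel_on X) \<mu> = dual_norm B (sup_norm X) \<Phi> \<and>
           (\<forall>b\<in>B. \<Phi> b = complex_integral (borel_on X) \<mu> (extreme_points X) b)"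
proof -
  interpret drury_arveson_space H ip by (rule H)
  have "weighted_affine_space X eval_monomials t B \<Phi>"
    using t_continuous t_positive t_concave \<Phi> unfolding A X B by (rule weighted_affine_space_\<X>)
  then show ?thesis by (rule weighted_affine_space.exists_representing_measure)
qed

end
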